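(* Let $D$ be a Mumford–Tate domain for a semisimple group $G$ with $\mathfrak g\subset\mathrm{End}(V,Q)$, and let $(V,W_\bullet(N),F^\bullet)$ be a (polarized) limiting mixed Hodge structure for $D$. Then $(V,W_\bullet(N),F^\bullet)$ is of Hodge–Tate type if and only if the associated adjoint limiting mixed Hodge structure $(\mathfrak g,W_\bullet(N)_{\mathfrak g},F^\bullet_{\mathfrak g})$ is of Hodge–Tate type.
   Context: A polarized Hodge structure of weight $n$ is $(V,Q,F^\bullet)$ with $V$ a real vector space (with rational structure), $Q$ a nondegenerate $(-1)^n$-symmetric bilinear form, and $F^n\subset\dots\subset F^0=V_{\mathbb C}$ with $F^p\oplus\overline{F^{n-p+1}}=V_{\mathbb C}$, $Q(F^p,F^{n-p+1})=0$, and $Q(Cv,\bar v)>0$ for $v\neq0$, where $C=i^{p-q}$ on $V^{p,q}=F^p\cap\overline{F^q}$. A Mumford–Tate domain $D=G_{\mathbb R}/R$ is the $G_{\mathbb R}$-orbit of a polarized Hodge structure $(V,Q,F^\bullet)$ of weight $n$ whose Mumford–Tate group is $G$ and whose stabilizer in $G_{\mathbb R}$ is the compact group $R$. Here $G_{\mathbb R}$ is a connected real form of the complex semisimple group $G_{\mathbb C}$. $D$ is open in its compact dual $\check D=G_{\mathbb C}/P$, the $G_{\mathbb C}$-orbit of $F^\bullet$ in the variety of $Q$-isotropic filtrations. A nilpotent orbit is a pair $(F^\bullet,N)$ with $F^\bullet\in\check D$, $N\in\mathfrak g_{\mathbb R}$ nilpotent, $e^{zN}F^\bullet\in D$ for $\mathrm{Im}(z)\gg0$,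 and $N(F^p)\subset F^{p-1}$. The associated limiting mixed Hodge structure is $(V,W_\bullet(N),F^\bullet)$, where $W_\bullet(N)$ is the monodromy weight filtration of $N$ on $V$ centered at $n$ ($NW_k\subset W_{k-2}$ and $N^k:\mathrm{Gr}^W_{n+k}\to\mathrm{Gr}^W_{n-k}$ an isomorphism). All limiting mixed Hodge structures are of this form. The Deligne splitting $V_{\mathbb C}=\bigoplus I^{p,q}$ of a mixed Hodge structure is the unique bigrading with $W_k=\bigoplus_{p+q\le k}I^{p,q}$, $F^p=\bigoplus_{r\ge p}I^{r,\bullet}$ and $\overline{I^{p,q}}\equiv I^{q,p}$ modulo $\bigoplus_{r<q,\,s<p}I^{r,s}$. The adjoint limiting mixed Hodge structure on $\mathfrak g$ is given by $F^p_{\mathfrak g}=\{\xi\in\mathfrak g_{\mathbb C}:\xi(F^q)\subset F^{p+q}\ \forall q\}$, $W_\ell(N)_{\mathfrak g}=\{\xi\in\mathfrak g_{\mathbb R}:\xi(W_m(N))\subset W_{m+\ell}(N)\ \forall m\}$; its Deligne splitting is denoted $\mathfrak g_{\mathbb C}=\bigoplus I^{p,q}_{\mathfrak g}$. A mixed Hodge structure is of Hodge–Tate type if its Deligne splitting satisfies $I^{p,q}=0$ for all $p\ne q$. *)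

theory Defs
  imports "HOL-Analysis.Analysis"
begin

text \<open>
  Conventions. A finite-dimensional rational vector space is taken in the form
  \<open>V\<^sub>\<rat> = \<rat>\<^sup>v\<close>, so that \<open>V\<^sub>\<complex>\<close> is the type \<^typ>\<open>complex ^ 'v\<close>. All objects live over \<open>\<complex>\<close>; real
  objects (vectors, endomorphisms, weight filtrations) are those consisting of fixed points of
  complex conjugation. Filtrations are indexed by \<^typ>\<open>int\<close>. Mixed Hodge structures occur both
  on \<^typ>\<open>complex ^ 'v\<close> and on spaces of matrices, so the notions below take the complex scalar
  multiplication \<open>scl\<close> and the complex conjugation \<open>cj\<close> of the ambient space as parameters.
\<close>

type_synonym 'a filtration = "int \<Rightarrow> 'a set"

definition vconj :: "complex ^ 'v \<Rightarrow> complex ^ 'v" where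
  "vconj u = (\<chi> i. cnj (u $ i))"

abbreviation mconj :: "complex ^ 'v ^ 'v \<Rightarrow> complex ^ 'v ^ 'v" where
  "mconj \<equiv> map_matrix cnj"

text \<open>The library operation \<open>*s\<close> on \<^typ>\<open>complex ^ 'v ^ 'v\<close> scales by a vector, componentwise;
  this is scaling by a complex number.\<close>

definition mscale :: "complex \<Rightarrow> complex ^ 'v ^ 'v \<Rightarrow> complex ^ 'v ^ 'v" where
  "mscale c A = map_matrix (\<lambda>x. c * x) A"

global_interpretation cmat: vector_space mscale
  by unfold_locales (simp_all add: mscale_def vec_eq_iff algebra_simps)

definition mpow :: "complex ^ 'v ^ 'v \<Rightarrow> nat \<Rightarrow> complex ^ 'v ^ 'v" where
  "mpow A k = ((\<lambda>B. A ** B) ^^ k) (mat 1)"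

definition mexp :: "complex ^ 'v ^ 'v \<Rightarrow> complex ^ 'v ^ 'v" where
  "mexp A = (\<Sum>k. (1 / fact k) *\<^sub>R mpow A k)"

definition real_points :: "(complex ^ 'v) set" where
  "real_points = {u. vconj u = u}"

definition real_matrices :: "(complex ^ 'v ^ 'v) set" where
  "real_matrices = {A. mconj A = A}"

definition bilin :: "complex ^ 'v ^ 'v \<Rightarrow> complex ^ 'v \<Rightarrow> complex ^ 'v \<Rightarrow> complex" where
  "bilin Q u w = (\<Sum>i\<in>UNIV. u $ i * (Q *v w) $ i)"

definition act :: "complex ^ 'v ^ 'v \<Rightarrow> (complex ^ 'v) filtration \<Rightarrow> (complex ^ 'v) filtration" where
  "act A F = (\<lambda>p. (\<lambda>u. A *v u) ` F p)"


subsection \<open>Polarized Hodge structures\<close>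

definition hodge_piece :: "(complex ^ 'v) filtration \<Rightarrow> int \<Rightarrow> int \<Rightarrow> (complex ^ 'v) set" where
  "hodge_piece F p q = F p \<inter> vconj ` F q"

definition hodge_structure :: "nat \<Rightarrow> (complex ^ 'v) filtration \<Rightarrow> bool" where
  "hodge_structure n F \<longleftrightarrow>
     (\<forall>p. vec.subspace (F p)) \<and> antimono F \<and> F 0 = UNIV \<and>
     (\<forall>p. F p \<inter> vconj ` F (int n - p + 1) = {0} \<and>
          {a + b | a b. a \<in> F p \<and> b \<in> vconj ` F (int n - p + 1)} = UNIV)"

text \<open>\<open>hodge_circle n F z\<close> is the endomorphism \<open>\<phi>(z)\<close> acting on \<open>V\<^sup>p\<^sup>,\<^sup>q\<close>, \<open>p + q = n\<close>, as \<open>z\<^sup>p\<^sup>-\<^sup>q\<close>.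
  The Weil operator \<open>C\<close> is \<open>\<phi>(\<i>)\<close>.\<close>

definition hodge_circle :: "nat \<Rightarrow> (complex ^ 'v) filtration \<Rightarrow> complex \<Rightarrow> complex ^ 'v ^ 'v" where
  "hodge_circle n F z = (THE A. \<forall>p q. p + q = int n \<longrightarrow>
     (\<forall>u \<in> hodge_piece F p q. A *v u = (z powi (p - q)) *s u))"

definition weil_operator :: "nat \<Rightarrow> (complex ^ 'v) filtration \<Rightarrow> complex ^ 'v ^ 'v" where
  "weil_operator n F = hodge_circle n F \<i>"

definition polarized_hodge_structure ::
    "nat \<Rightarrow> complex ^ 'v ^ 'v \<Rightarrow> (complex ^ 'v) filtration \<Rightarrow> bool" where
  "polarized_hodge_structure n Q F \<longleftrightarrow>
     Q \<in> real_matrices \<and> invertible Q \<and> transpose Q = mscale ((- 1) ^ n) Q \<and>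
     hodge_structure n F \<and>
     (\<forall>p. \<forall>u \<in> F p. \<forall>w \<in> F (int n - p + 1). bilin Q u w = 0) \<and>
     (\<forall>u. u \<noteq> 0 \<longrightarrow> bilin Q (weil_operator n F *v u) (vconj u) \<in> \<real> \<and>
                    Re (bilin Q (weil_operator n F *v u) (vconj u)) > 0)"

definition end_Q :: "complex ^ 'v ^ 'v \<Rightarrow> (complex ^ 'v ^ 'v) set" where
  "end_Q Q = {X. \<forall>u w. bilin Q (X *v u) w + bilin Q u (X *v w) = 0}"


subsection \<open>Algebraic groups and Lie algebras\<close>

text \<open>Polynomial functions of the matrix entries with coefficients in the subring \<open>K\<close>.\<close>

inductive matrix_poly :: "complex set \<Rightarrow> (complex ^ 'v ^ 'v \<Rightarrow> complex) \<Rightarrow> bool"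
  for K :: "complex set" where
  const: "c \<in> K \<Longrightarrow> matrix_poly K (\<lambda>A. c)"
| entry: "matrix_poly K (\<lambda>A. A $ i $ j)"
| add: "matrix_poly K f \<Longrightarrow> matrix_poly K g \<Longrightarrow> matrix_poly K (\<lambda>A. f A + g A)"
| mult: "matrix_poly K f \<Longrightarrow> matrix_poly K g \<Longrightarrow> matrix_poly K (\<lambda>A. f A * g A)"

text \<open>An algebraic subgroup of \<open>GL(V)\<close> defined over \<open>\<rat>\<close>, given by its group of complex points.\<close>

definition rational_algebraic_group :: "(complex ^ 'v ^ 'v) set \<Rightarrow> bool" where
  "rational_algebraic_group H \<longleftrightarrow>
     (\<exists>P. (\<forall>f \<in> P. matrix_poly \<rat> f) \<and> H = {A. invertible A \<and> (\<forall>f \<in> P. f A = 0)}) \<and>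
     mat 1 \<in> H \<and> (\<forall>A \<in> H. \<forall>B \<in> H. A ** B \<in> H) \<and> (\<forall>A \<in> H. matrix_inv A \<in> H)"

text \<open>The smallest algebraic group over \<open>\<rat>\<close> containing \<open>\<phi>(S\<^sup>1)\<close>, as a group of complex points.\<close>

definition mumford_tate_group :: "nat \<Rightarrow> (complex ^ 'v) filtration \<Rightarrow> (complex ^ 'v ^ 'v) set" where
  "mumford_tate_group n F =
     \<Inter> {H. rational_algebraic_group H \<and> (\<forall>z. norm z = 1 \<longrightarrow> hodge_circle n F z \<in> H)}"

text \<open>The connected real Lie group \<open>G\<^sub>\<real>\<close>: the identity component of the group of real points.\<close>

definition real_form :: "(complex ^ 'v ^ 'v) set \<Rightarrow> (complex ^ 'v ^ 'v) set" where
  "real_form G = connected_component_set (G \<inter> real_matrices) (mat 1)"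

text \<open>The complex Lie algebra \<open>\<gg>\<^sub>\<complex>\<close>, as the (Zariski) tangent space of \<open>G\<close> at the identity.\<close>

definition lie_algebra :: "(complex ^ 'v ^ 'v) set \<Rightarrow> (complex ^ 'v ^ 'v) set" where
  "lie_algebra G = {X. \<forall>f. matrix_poly UNIV f \<and> (\<forall>A \<in> G. f A = 0) \<longrightarrow>
     ((\<lambda>t. f (mat 1 + mscale t X)) has_field_derivative 0) (at 0)}"

definition real_lie_algebra :: "(complex ^ 'v ^ 'v) set \<Rightarrow> (complex ^ 'v ^ 'v) set" where
  "real_lie_algebra G = lie_algebra G \<inter> real_matrices"

definition lie_bracket :: "complex ^ 'v ^ 'v \<Rightarrow> complex ^ 'v ^ 'v \<Rightarrow> complex ^ 'v ^ 'v" where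
  "lie_bracket X Y = X ** Y - Y ** X"

definition lie_ideal :: "(complex ^ 'v ^ 'v) set \<Rightarrow> (complex ^ 'v ^ 'v) set \<Rightarrow> bool" where
  "lie_ideal \<gg> \<aa> \<longleftrightarrow> cmat.subspace \<aa> \<and> \<aa> \<subseteq> \<gg> \<and> (\<forall>X \<in> \<gg>. \<forall>Y \<in> \<aa>. lie_bracket X Y \<in> \<aa>)"

definition derived_algebra :: "(complex ^ 'v ^ 'v) set \<Rightarrow> (complex ^ 'v ^ 'v) set" where
  "derived_algebra \<aa> = cmat.span {lie_bracket X Y | X Y. X \<in> \<aa> \<and> Y \<in> \<aa>}"

definition solvable_lie_algebra :: "(complex ^ 'v ^ 'v) set \<Rightarrow> bool" where
  "solvable_lie_algebra \<aa> \<longleftrightarrow> (\<exists>k. (derived_algebra ^^ k) \<aa> = {0})"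

definition semisimple_lie_algebra :: "(complex ^ 'v ^ 'v) set \<Rightarrow> bool" where
  "semisimple_lie_algebra \<gg> \<longleftrightarrow> (\<forall>\<aa>. lie_ideal \<gg> \<aa> \<and> solvable_lie_algebra \<aa> \<longrightarrow> \<aa> = {0})"


subsection \<open>Mumford--Tate domains and nilpotent orbits\<close>

definition mumford_tate_domain ::
    "nat \<Rightarrow> complex ^ 'v ^ 'v \<Rightarrow> (complex ^ 'v ^ 'v) set \<Rightarrow> (complex ^ 'v) filtration set \<Rightarrow> bool" where
  "mumford_tate_domain n Q G D \<longleftrightarrow>
     (\<exists>F\<^sub>0. polarized_hodge_structure n Q F\<^sub>0 \<and> mumford_tate_group n F\<^sub>0 = G \<and>
           compact {A \<in> real_form G. act A F\<^sub>0 = F\<^sub>0} \<and>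
           D = {act A F\<^sub>0 | A. A \<in> real_form G})"

definition compact_dual ::
    "(complex ^ 'v ^ 'v) set \<Rightarrow> (complex ^ 'v) filtration set \<Rightarrow> (complex ^ 'v) filtration set" where
  "compact_dual G D = {act A F | A F. A \<in> G \<and> F \<in> D}"

definition nilpotent_orbit ::
    "(complex ^ 'v ^ 'v) set \<Rightarrow> (complex ^ 'v) filtration set \<Rightarrow>
     (complex ^ 'v) filtration \<Rightarrow> complex ^ 'v ^ 'v \<Rightarrow> bool" where
  "nilpotent_orbit G D F N \<longleftrightarrow>
     F \<in> compact_dual G D \<and>
     N \<in> real_lie_algebra G \<and> (\<exists>k. mpow N k = 0) \<and>
     (\<exists>c. \<forall>z. Im z > c \<longrightarrow> act (mexp (mscale z N)) F \<in> D) \<and>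
     (\<forall>p. \<forall>u \<in> F p. N *v u \<in> F (p - 1))"

text \<open>The monodromy weight filtration centred at \<open>n\<close>, by real subspaces of \<open>V\<^sub>\<real>\<close>. The last two
  conjuncts say that \<open>N\<^sup>k : Gr\<^sub>n\<^sub>+\<^sub>k \<rightarrow> Gr\<^sub>n\<^sub>-\<^sub>k\<close> is surjective and injective.\<close>

definition monodromy_weight_filtration ::
    "nat \<Rightarrow> complex ^ 'v ^ 'v \<Rightarrow> (complex ^ 'v) filtration \<Rightarrow> bool" where
  "monodromy_weight_filtration n N W \<longleftrightarrow>
     (\<forall>k. subspace (W k) \<and> W k \<subseteq> real_points) \<and> mono W \<and>
     (\<exists>k. W k = {0}) \<and> (\<exists>k. W k = real_points) \<and>
     (\<forall>k. \<forall>u \<in> W k. N *v u \<in> W (k - 2)) \<and>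
     (\<forall>k. \<forall>w \<in> W (int n - int k). \<exists>u \<in> W (int n + int k).
        w - mpow N k *v u \<in> W (int n - int k - 1)) \<and>
     (\<forall>k. \<forall>u \<in> W (int n + int k).
        mpow N k *v u \<in> W (int n - int k - 1) \<longrightarrow> u \<in> W (int n + int k - 1))"


subsection \<open>Deligne splittings and Hodge--Tate type\<close>

definition is_direct_sum :: "('i \<Rightarrow> 'a::ab_group_add set) \<Rightarrow> 'a set \<Rightarrow> bool" where
  "is_direct_sum A U \<longleftrightarrow>
     (\<forall>i. A i \<subseteq> U) \<and>
     (\<forall>u \<in> U. \<exists>!f. finite {i. f i \<noteq> 0} \<and> (\<forall>i. f i \<in> A i) \<and> u = (\<Sum>i | f i \<noteq> 0. f i))"

text \<open>\<open>I\<close> is the Deligne splitting of the mixed Hodge structure with complex vector space \<open>U\<close>, real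
  weight filtration \<open>W\<close> (complexified by taking complex spans) and Hodge filtration \<open>F\<close>. The last
  clause is the congruence of subspaces \<open>cj I\<^sup>p\<^sup>,\<^sup>q \<equiv> I\<^sup>q\<^sup>,\<^sup>p\<close> modulo the sum of the \<open>I\<^sup>r\<^sup>,\<^sup>s\<close> with
  \<open>r < q\<close>, \<open>s < p\<close>.\<close>

definition deligne_splitting ::
    "(complex \<Rightarrow> 'a \<Rightarrow> 'a) \<Rightarrow> ('a \<Rightarrow> 'a) \<Rightarrow> 'a::ab_group_add set \<Rightarrow> 'a filtration \<Rightarrow> 'a filtration \<Rightarrow>
     (int \<Rightarrow> int \<Rightarrow> 'a set) \<Rightarrow> bool" where
  "deligne_splitting scl cj U W F I \<longleftrightarrow>
     (\<forall>p q. module.subspace scl (I p q)) \<and>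
     is_direct_sum (\<lambda>(p, q). I p q) U \<and>
     (\<forall>k. module.span scl (W k) = module.span scl (\<Union> {I p q | p q. p + q \<le> k})) \<and>
     (\<forall>p. F p = module.span scl (\<Union> {I r s | r s. r \<ge> p})) \<and>
     (\<forall>p q. module.span scl (cj ` I p q \<union> \<Union> {I r s | r s. r < q \<and> s < p}) =
            module.span scl (I q p \<union> \<Union> {I r s | r s. r < q \<and> s < p}))"

text \<open>A Deligne splitting is unique if it exists, and it exists precisely for mixed Hodge
  structures.\<close>

definition hodge_tate ::
    "(complex \<Rightarrow> 'a \<Rightarrow> 'a) \<Rightarrow> ('a \<Rightarrow> 'a) \<Rightarrow> 'a::ab_group_add set \<Rightarrow> 'a filtration \<Rightarrow> 'a filtration \<Rightarrow>
     bool" where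
  "hodge_tate scl cj U W F \<longleftrightarrow>
     (\<exists>I. deligne_splitting scl cj U W F I \<and> (\<forall>p q. p \<noteq> q \<longrightarrow> I p q = {0}))"

definition adjoint_F ::
    "(complex ^ 'v ^ 'v) set \<Rightarrow> (complex ^ 'v) filtration \<Rightarrow> (complex ^ 'v ^ 'v) filtration" where
  "adjoint_F G F p = {X \<in> lie_algebra G. \<forall>q. \<forall>u \<in> F q. X *v u \<in> F (p + q)}"

definition adjoint_W ::
    "(complex ^ 'v ^ 'v) set \<Rightarrow> (complex ^ 'v) filtration \<Rightarrow> (complex ^ 'v ^ 'v) filtration" where
  "adjoint_W G W l = {X \<in> real_lie_algebra G. \<forall>m. \<forall>u \<in> W m. X *v u \<in> W (m + l)}"

end

theory Submission
  imports Defs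
begin

text \<open>
  Write \<open>\<gg>\<close> for the Lie algebra. A mixed Hodge structure is of Hodge--Tate type iff \<open>F\<^sup>p\<close> and
  \<open>W\<^bsub>2p-2\<^esub>\<close> are complementary for all \<open>p\<close> and the odd graded pieces of \<open>W\<close> vanish; so no existence
  theorem for limiting mixed Hodge structures is needed. Both filtrations of \<open>V\<close> are graded by elements
  of \<open>\<gg>\<close>: \<open>F\<close> by a conjugate \<open>E\<close> of the derivative of the Hodge circle, acting on \<open>Gr\<^sub>F\<^sup>p\<close> as
  \<open>p - n/2\<close>, and \<open>W\<close> by \<open>K = [N, U]\<close>, acting on \<open>Gr\<^sup>W\<^sub>k\<close> as \<open>(k - n)/2\<close>, where \<open>U \<in> \<gg>\<close> solves
  \<open>[N, [N, U]] = N\<close>. Such \<open>U\<close> exists because the polarization makes the trace form nondegenerate on \<open>\<gg>\<close>.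

  If \<open>V\<close> is of Hodge--Tate type, then \<open>F\<^sup>p \<inter> W\<^bsub>2p-2\<^esub> = 0\<close> on \<open>\<gg>\<close> is clear, and the sum is
  everything because its orthogonal complement for the trace form lies in \<open>F\<^bsup>1-p\<^esup> \<inter> W\<^bsub>1-2p\<^esub> = 0\<close>.
  Conversely, if \<open>\<gg> = \<Oplus> I\<^bsup>p,p\<^esup>\<close>, then the components of \<open>E\<close> and \<open>K\<close> in \<open>I\<^bsup>0,0\<^esup>\<close> both act
  as \<open>p\<close> on \<open>I\<^bsup>p,p\<^esup>\<close>. Since \<open>\<gg>\<close> has trivial centre they coincide, and this element of \<open>\<gg>\<close>
  grades \<open>F\<close> and \<open>W\<close> on \<open>V\<close> simultaneously.
\<close>

subsection \<open>Opposite filtrations and Hodge--Tate type\<close>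

text \<open>An endomorphism sees only differences of bidegrees, so a structure on V all of whose
  I^{p,q} had the same nonzero p - q would also look Hodge--Tate on \<gg>. This is excluded because
  both gradings are by elements of \<gg> itself: their additive constants take the common value
  -n/2, and with trivial centre no scalar discrepancy between E and K can survive.

  The equation [N, [N, U]] = N is the fragment of an sl2-triple that suffices: K = [N, U] then
  satisfies [N, K] = N and behaves like half the semisimple element of a triple. It is solved by
  duality for the trace form.

  That form is nondegenerate because every X in \<gg> has an adjoint inside \<gg> for the positive
  Hermitian form h(u, v) = Q(Cu, conj v), namely minus the complex conjugate of C X C^{-1}, and the
  trace of a nonzero X times its adjoint is positive.\<close>

lemma sum_support_eq:
  fixes f :: "'i \<Rightarrow> 'a::comm_monoid_add"
  assumes "finite A" "{i. f i \<noteq> 0} \<subseteq> A"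
  shows "(\<Sum>i | f i \<noteq> 0. f i) = sum f A"
  using assms by (intro sum.mono_neutral_left) auto

text \<open>Filtrations are indexed by all integers but are constant far out; the base case
  therefore covers the whole half-line from \<open>b\<close> on, where they have reached their final
  value.\<close>

lemma int_down_induct [case_names base step]:
  fixes b :: int
  assumes "\<And>m. b \<le> m \<Longrightarrow> P m" "\<And>m. P (m + 1) \<Longrightarrow> P m"
  shows "P m"
proof (cases "m \<le> b")
  case True
  then show ?thesis
  proof (induction m rule: int_le_induct)
    case (step i)
    then show ?case using assms(2)[of "i - 1"] by simp
  qed (use assms in simp)
qed (use assms in auto)

lemma int_up_induct [case_names base step]:
  fixes b :: int
  assumes "\<And>m. m \<le> b \<Longrightarrow> P m" "\<And>m. P (m - 1) \<Longrightarrow> P m"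
  shows "P m"
proof -
  have "P (- k)" for k
  proof (induction k rule: int_down_induct[where b = "- b"])
    case (step k)
    moreover have "- (k + 1) = - k - 1" by simp
    ultimately show ?case using assms(2)[of "- k"] by metis
  qed (use assms(1) in simp)
  from this[of "- m"] show ?thesis by simp
qed

text \<open>A criterion free of bigradings and conjugation. For finite filtrations with real weights
  the splitting is recovered from it as I^{p,p} = F^p \<inter> W_{2p}.\<close>

definition opposite_filtrations :: "'a::ab_group_add set \<Rightarrow> 'a filtration \<Rightarrow> 'a filtration \<Rightarrow> bool" where
  "opposite_filtrations U F W \<longleftrightarrow>
     (\<forall>p. F p \<inter> W (2 * p - 2) = {0}) \<and>
     (\<forall>p. \<forall>u \<in> U. \<exists>a \<in> F p. \<exists>b \<in> W (2 * p - 2). u = a + b) \<and>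
     (\<forall>p. W (2 * p - 1) = W (2 * p - 2))"

locale conjugated_space = vector_space scl
  for scl :: "complex \<Rightarrow> 'a::ab_group_add \<Rightarrow> 'a" (infixr \<open>\<cdot>\<close> 75) +
  fixes cj :: "'a \<Rightarrow> 'a"
  assumes cj_add: "cj (u + v) = cj u + cj v"
    and cj_scale: "cj (c \<cdot> u) = cnj c \<cdot> cj u"
    and cj_cj: "cj (cj u) = u"
begin

text \<open>Always decreasing: a weight filtration \<open>W\<close> enters as
  \<open>\<lambda>m. W (- m)\<close>, so that one splitting lemma serves both kinds.\<close>

definition finite_filtration :: "'a set \<Rightarrow> 'a filtration \<Rightarrow> bool" where
  "finite_filtration U \<Phi> \<longleftrightarrow>
     (\<forall>m. subspace (\<Phi> m)) \<and> antimono \<Phi> \<and> (\<forall>m. \<Phi> m \<subseteq> U) \<and> (\<exists>a. \<Phi> a = U) \<and> (\<exists>b. \<Phi> b = {0})"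

lemma finite_filtrationD:
  assumes "finite_filtration U \<Phi>"
  shows "subspace (\<Phi> m)" "i \<le> j \<Longrightarrow> \<Phi> j \<subseteq> \<Phi> i" "\<Phi> m \<subseteq> U" "subspace U"
    "\<exists>a. \<forall>m\<le>a. \<Phi> m = U" "\<exists>b. \<forall>m\<ge>b. \<Phi> m = {0}"
proof -
  have sub: "subspace (\<Phi> m)" and mono: "i \<le> j \<Longrightarrow> \<Phi> j \<subseteq> \<Phi> i"
    and le: "\<Phi> m \<subseteq> U" for i j m
    using assms by (auto simp: finite_filtration_def monotone_def)
  then show "subspace (\<Phi> m)" "i \<le> j \<Longrightarrow> \<Phi> j \<subseteq> \<Phi> i" "\<Phi> m \<subseteq> U" by auto
  obtain a b where ab: "\<Phi> a = U" "\<Phi> b = {0}"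
    using assms by (auto simp: finite_filtration_def)
  show "subspace U" using sub[of a] ab by simp
  show "\<exists>a. \<forall>m\<le>a. \<Phi> m = U" using mono[of _ a] le ab by (intro exI[of _ a]) blast
  show "\<exists>b. \<forall>m\<ge>b. \<Phi> m = {0}"
    using mono[of b] ab subspace_0[OF sub] by (intro exI[of _ b]) blast
qed

text \<open>Solving (T - c m) x = (T - c m) u with x in \<open>\<Phi> (m + 1)\<close> and replacing
  \<open>u\<close> by \<open>u - x\<close> gives an exact eigenvector with the same class in the
  graded piece. The equation is solvable once \<open>\<Phi> (m + 1)\<close> is known to be spanned
  by eigenvectors, so the two conclusions support each other in a descending induction on
  \<open>m\<close>.\<close>

lemma graded_part_exists:
  assumes \<Phi>: "finite_filtration U \<Phi>"
    and T: "\<And>u v. T (u + v) = T u + T v" "\<And>a u. T (a \<cdot> u) = a \<cdot> T u"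
    and c: "inj c" and gr: "\<And>m u. u \<in> \<Phi> m \<Longrightarrow> T u - c m \<cdot> u \<in> \<Phi> (m + 1)"
    and u: "u \<in> \<Phi> m"
  shows "\<exists>v \<in> \<Phi> m. T v = c m \<cdot> v \<and> u - v \<in> \<Phi> (m + 1)"
    and "u \<in> span {v. \<exists>j\<ge>m. v \<in> \<Phi> j \<and> T v = c j \<cdot> v}"
proof -
  note D = finite_filtrationD[OF \<Phi>]
  have T0: "T 0 = 0" using T(2)[of 0 0] by simp
  have Tdiff: "T (x - y) = T x - T y" for x y
    using T(1)[of "x - y" y] by (simp add: algebra_simps)
  let ?E = "\<lambda>m. {v. \<exists>j\<ge>m. v \<in> \<Phi> j \<and> T v = c j \<cdot> v}"
  text \<open>On the eigenspace of \<open>c j\<close>, \<open>j > m\<close>, the operator \<open>T - c m\<close> is invertible.\<close>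
  have solve: "\<exists>x \<in> \<Phi> (m + 1). T x - c m \<cdot> x = v" if "v \<in> span (?E (m + 1))" for v m
    using that
  proof (induction rule: span_induct_alt)
    case base
    show ?case using T0 subspace_0[OF D(1)] by (intro bexI[of _ 0]) auto
  next
    case (step a x y)
    then obtain j y' where j: "j \<ge> m + 1" "x \<in> \<Phi> j" "T x = c j \<cdot> x"
      and y': "y' \<in> \<Phi> (m + 1)" "T y' - c m \<cdot> y' = y" by auto
    have ne: "c j - c m \<noteq> 0" using c j(1) by (auto dest: injD)
    have "x \<in> \<Phi> (m + 1)" using j D(2) by blast
    then have "(a / (c j - c m)) \<cdot> x + y' \<in> \<Phi> (m + 1)"
      using y' D(1) by (intro subspace_add subspace_scale)
    moreover have "T ((a / (c j - c m)) \<cdot> x + y') - c m \<cdot> ((a / (c j - c m)) \<cdot> x + y') =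
        ((c j - c m) * (a / (c j - c m))) \<cdot> x + (T y' - c m \<cdot> y')"
      unfolding T j(3) by (simp add: algebra_simps diff_divide_distrib)
    moreover have "(c j - c m) * (a / (c j - c m)) = a" using ne by simp
    ultimately show ?case using y' by (intro bexI) auto
  qed
  have split: "\<exists>v \<in> \<Phi> m. T v = c m \<cdot> v \<and> u - v \<in> \<Phi> (m + 1)"
    if hu: "u \<in> \<Phi> m" and sp: "\<Phi> (m + 1) \<subseteq> span (?E (m + 1))" for u m
  proof -
    obtain x where x: "x \<in> \<Phi> (m + 1)" "T x - c m \<cdot> x = T u - c m \<cdot> u"
      using solve[of "T u - c m \<cdot> u" m] gr[of u m] hu sp by blast
    have "T (u - x) = c m \<cdot> (u - x)"
      using x(2) by (simp add: Tdiff scale_right_diff_distrib algebra_simps)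
    moreover have "u - x \<in> \<Phi> m"
      using that(1) x(1) D(2)[of m "m + 1"] D(1) by (intro subspace_diff) auto
    ultimately show ?thesis using x(1) by (intro bexI[of _ "u - x"]) auto
  qed
  have all: "\<Phi> m \<subseteq> span (?E m)" for m
  proof -
    obtain b where b: "\<And>m. m \<ge> b \<Longrightarrow> \<Phi> m = {0}" using D(6) by blast
    show ?thesis
    proof (induction m rule: int_down_induct[where b = b])
      case (base m)
      then show ?case using b span_zero by simp
    next
      case (step m)
      show ?case
      proof
        fix u assume "u \<in> \<Phi> m"
        then obtain v where v: "v \<in> \<Phi> m" "T v = c m \<cdot> v" "u - v \<in> \<Phi> (m + 1)"
          using split step by blast
        have "?E (m + 1) \<subseteq> ?E m" by (intro Collect_mono impI ex_mono) auto
        then have "u - v \<in> span (?E m)" using v(3) step span_mono by blast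
        moreover have "v \<in> span (?E m)" using v by (intro span_base) auto
        ultimately show "u \<in> span (?E m)" using span_add by fastforce
      qed
    qed
  qed
  show "\<exists>v \<in> \<Phi> m. T v = c m \<cdot> v \<and> u - v \<in> \<Phi> (m + 1)"
    using split[OF u all] .
  show "u \<in> span (?E m)" using all u by blast
qed

text \<open>Collects a linear combination into one vector per index, the form to which the
  uniqueness clause of \<open>is_direct_sum\<close> applies.\<close>

lemma span_family_repr:
  assumes sub: "\<And>i. subspace (J i)" and u: "u \<in> span (\<Union> (J ` S))"
  shows "\<exists>f. finite {i. f i \<noteq> 0} \<and> (\<forall>i. f i \<in> J i) \<and> {i. f i \<noteq> 0} \<subseteq> S \<and> u = (\<Sum>i | f i \<noteq> 0. f i)"
  using u
proof (induction rule: span_induct_alt)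
  case base
  show ?case using subspace_0[OF sub] by (intro exI[of _ "\<lambda>_. 0"]) auto
next
  case (step c x y)
  then obtain i f where i: "i \<in> S" "x \<in> J i" and f: "finite {i. f i \<noteq> 0}" "\<forall>i. f i \<in> J i"
    "{i. f i \<noteq> 0} \<subseteq> S" "y = (\<Sum>i | f i \<noteq> 0. f i)" by auto
  let ?g = "\<lambda>k. (if k = i then c \<cdot> x else 0) + f k"
  let ?A = "insert i {i. f i \<noteq> 0}"
  have supp: "{k. ?g k \<noteq> 0} \<subseteq> ?A" by auto
  have fin: "finite ?A" using f by simp
  have "(\<Sum>k | ?g k \<noteq> 0. ?g k) = sum ?g ?A" by (rule sum_support_eq[OF fin supp])
  also have "\<dots> = c \<cdot> x + sum f ?A"
    unfolding sum.distrib using fin by (subst sum.delta) auto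
  also have "sum f ?A = y" using f fin by (subst f(4), intro sum.mono_neutral_right) auto
  finally have "c \<cdot> x + y = (\<Sum>k | ?g k \<noteq> 0. ?g k)" by simp
  moreover have "?g k \<in> J k" for k
    using f i sub by (auto intro!: subspace_add subspace_scale)
  moreover have "finite {k. ?g k \<noteq> 0}" using finite_subset[OF supp fin] .
  moreover have "{k. ?g k \<noteq> 0} \<subseteq> S" using supp f i by auto
  ultimately show ?case by (intro exI[of _ ?g]) auto
qed

lemma cj_0: "cj 0 = 0"
  using cj_scale[of 0 0] by simp

lemma cj_span:
  assumes "\<And>w. w \<in> S \<Longrightarrow> cj w = w" "u \<in> span S"
  shows "cj u \<in> span S"
  using assms(2)
proof (induction rule: span_induct_alt)
  case (step c x y)
  then show ?case
    using assms(1)[of x] span_base[of x S] by (auto simp: cj_add cj_scale intro!: span_add span_scale)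
qed (simp add: cj_0 span_zero)

text \<open>Off the diagonal \<open>I\<close> vanishes, and a diagonal index (r, r) satisfies
  exactly one of r \<ge> p and 2r \<le> 2p - 2. So the two filtrations collect complementary sets of
  summands, and an odd bound on 2r can be lowered by one.\<close>

lemma hodge_tate_imp_opposite:
  assumes HT: "hodge_tate scl cj U W F" and U: "subspace U"
  shows "opposite_filtrations U F (\<lambda>k. span (W k))"
proof -
  obtain I where I: "\<And>p q. subspace (I p q)" "is_direct_sum (\<lambda>(p, q). I p q) U"
    "\<And>k. span (W k) = span (\<Union> {I p q | p q. p + q \<le> k})"
    "\<And>p. F p = span (\<Union> {I r s | r s. r \<ge> p})"
    and diag: "\<And>p q. p \<noteq> q \<Longrightarrow> I p q = {0}"
    using HT unfolding hodge_tate_def deligne_splitting_def by auto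
  define J where "J = (\<lambda>(p, q). I p q)"
  have J: "subspace (J i)" for i using I(1) by (cases i) (auto simp: J_def)
  have Jd: "fst i = snd i" if "x \<in> J i" "x \<noteq> 0" for i x
    using that diag by (cases i) (auto simp: J_def split: if_splits)
  define rep where "rep u f \<longleftrightarrow> finite {i. f i \<noteq> 0} \<and> (\<forall>i. f i \<in> J i) \<and> u = (\<Sum>i | f i \<noteq> 0. f i)" for u f
  have ds: "\<And>i. J i \<subseteq> U" "\<And>u. u \<in> U \<Longrightarrow> \<exists>!f. rep u f"
    using I(2) unfolding is_direct_sum_def J_def rep_def by blast+
  have W: "span (W k) = span (\<Union> (J ` {i. fst i + snd i \<le> k}))" for k
    unfolding I(3) by (rule arg_cong[where f = span]) (force simp: J_def)
  have F: "F p = span (\<Union> (J ` {i. fst i \<ge> p}))" for p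
    unfolding I(4) by (rule arg_cong[where f = span]) (force simp: J_def)
  have sU: "F p \<subseteq> U" for p
    unfolding F using ds(1) U by (intro span_minimal) blast+
  show ?thesis
    unfolding opposite_filtrations_def
  proof (intro conjI allI ballI)
    fix p
    show "F p \<inter> span (W (2 * p - 2)) = {0}"
    proof (intro equalityI subsetI)
      fix u assume u: "u \<in> F p \<inter> span (W (2 * p - 2))"
      obtain f where f: "finite {i. f i \<noteq> 0}" "\<forall>i. f i \<in> J i" "{i. f i \<noteq> 0} \<subseteq> {i. fst i \<ge> p}"
        "u = (\<Sum>i | f i \<noteq> 0. f i)"
        using u span_family_repr[where J = J, OF J, where u = u and S = "{i. fst i \<ge> p}"] unfolding F by blast
      obtain g where g: "finite {i. g i \<noteq> 0}" "\<forall>i. g i \<in> J i"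
        "{i. g i \<noteq> 0} \<subseteq> {i. fst i + snd i \<le> 2 * p - 2}"
        "u = (\<Sum>i | g i \<noteq> 0. g i)"
        using u span_family_repr[where J = J, OF J, where u = u and S = "{i. fst i + snd i \<le> 2 * p - 2}"] unfolding W by blast
      have "rep u f" "rep u g" using f g by (auto simp: rep_def)
      moreover have "u \<in> U" using u sU by blast
      ultimately have "f = g" using ds(2) by blast
      have "f i = 0" for i
      proof (rule ccontr)
        assume "f i \<noteq> 0"
        then have "fst i \<ge> p" "fst i + snd i \<le> 2 * p - 2" "fst i = snd i"
          using f(2,3) g(3) Jd \<open>f = g\<close> by blast+
        then show False by simp
      qed
      then show "u \<in> {0}" using f(4) by simp
    qed (auto simp: F span_zero)
  next
    fix p u assume "u \<in> U"
    then obtain f where f: "finite {i. f i \<noteq> 0}" "\<forall>i. f i \<in> J i" "u = (\<Sum>i | f i \<noteq> 0. f i)"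
      using ds(2) unfolding rep_def by blast
    let ?A = "{i. f i \<noteq> 0 \<and> fst i \<ge> p}" and ?B = "{i. f i \<noteq> 0 \<and> \<not> fst i \<ge> p}"
    have eq: "{i. f i \<noteq> 0} = ?A \<union> ?B" by blast
    have "finite ?A" by (rule finite_subset[OF _ f(1)]) blast
    moreover have "finite ?B" by (rule finite_subset[OF _ f(1)]) blast
    ultimately have "sum f (?A \<union> ?B) = sum f ?A + sum f ?B" by (intro sum.union_disjoint) blast+
    then have "u = sum f ?A + sum f ?B" unfolding f(3) eq .
    moreover have "sum f ?A \<in> F p"
      unfolding F using f(2) by (intro span_sum span_base) blast
    moreover have "sum f ?B \<in> span (W (2 * p - 2))"
    proof -
      have "f i \<in> \<Union> (J ` {i. fst i + snd i \<le> 2 * p - 2})" if i: "i \<in> ?B" for i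
      proof -
        have "fst i = snd i" using i f(2) Jd[of "f i" i] by blast
        then have "fst i + snd i \<le> 2 * p - 2" using i by auto
        then show ?thesis using f(2) by blast
      qed
      then show ?thesis unfolding W by (intro span_sum span_base)
    qed
    ultimately show "\<exists>a\<in>F p. \<exists>b\<in>span (W (2 * p - 2)). u = a + b" by blast
  next
    fix p
    have "x \<in> span (W (2 * p - 2))" if x: "x \<in> J i" "fst i + snd i \<le> 2 * p - 1" for x i
    proof (cases "x = 0")
      case False
      then have "fst i = snd i" using Jd x by blast
      then have "fst i + snd i \<le> 2 * p - 2" using x(2) by presburger
      then show ?thesis unfolding W using x by (intro span_base) blast
    qed (simp add: span_zero)
    then have "span (W (2 * p - 1)) \<subseteq> span (W (2 * p - 2))"
      unfolding W[of "2 * p - 1"] by (intro span_minimal) auto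
    moreover have "span (W (2 * p - 2)) \<subseteq> span (W (2 * p - 1))"
      unfolding W by (intro span_mono Union_mono image_mono) auto
    ultimately show "span (W (2 * p - 1)) = span (W (2 * p - 2))" by simp
  qed
qed

text \<open>With I^{p,p} = F^p \<inter> W_{2p} one has F^p = I^{p,p} + F^{p+1} and W_{2p} = I^{p,p}
  + W_{2p-2}; iterating these over the finite filtrations gives the span formulas. On the diagonal
  the conjugation clause holds because both of its sides are W_{2p}, which is stable under
  conjugation.\<close>

lemma opposite_imp_hodge_tate:
  assumes F: "finite_filtration U F"
    and W: "finite_filtration U (\<lambda>m. span (W (- m)))" "\<And>k w. w \<in> W k \<Longrightarrow> cj w = w"
    and opp: "opposite_filtrations U F (\<lambda>k. span (W k))"
  shows "hodge_tate scl cj U W F"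
proof -
  define \<Omega> where "\<Omega> k = span (W k)" for k
  note FD = finite_filtrationD[OF F]
  have \<Omega>: "subspace (\<Omega> k)" "i \<le> j \<Longrightarrow> \<Omega> i \<subseteq> \<Omega> j" "\<Omega> k \<subseteq> U" for i j k
    using finite_filtrationD(1)[OF W(1), of "- k"] finite_filtrationD(2)[OF W(1), of "- j" "- i"]
      finite_filtrationD(3)[OF W(1), of "- k"] by (auto simp: \<Omega>_def)
  obtain b where b: "\<And>m. m \<ge> b \<Longrightarrow> span (W (- m)) = {0}"
    using finite_filtrationD(6)[OF W(1)] by blast
  then have \<Omega>0: "\<Omega> k = {0}" if "k \<le> - b" for k using that b[of "- k"] by (simp add: \<Omega>_def)
  obtain d where d: "\<And>m. m \<ge> d \<Longrightarrow> F m = {0}" using FD(6) by blast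
  obtain a where a: "F a = U" using FD(5) by blast
  have op: "\<And>p. F p \<inter> \<Omega> (2 * p - 2) = {0}"
    "\<And>p u. u \<in> U \<Longrightarrow> \<exists>x\<in>F p. \<exists>y\<in>\<Omega> (2 * p - 2). u = x + y" "\<And>p. \<Omega> (2 * p - 1) = \<Omega> (2 * p - 2)"
    using opp unfolding opposite_filtrations_def \<Omega>_def by blast+
  define I where "I = (\<lambda>p q. if p = q then F p \<inter> \<Omega> (2 * p) else {0})"
  have I: "subspace (I p q)" for p q using FD(1) \<Omega>(1) by (auto simp: I_def subspace_def)
  have Fstep: "\<exists>y \<in> I p p. \<exists>x \<in> F (p + 1). u = y + x" if u: "u \<in> F p" for u p
  proof -
    obtain x y where xy: "x \<in> F (p + 1)" "y \<in> \<Omega> (2 * p)" "u = x + y"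
      using op(2)[of u "p + 1"] u FD(3) by auto
    have "y = u - x" using xy by simp
    then have "y \<in> F p" using u xy(1) FD(1) FD(2)[of p "p + 1"] by (auto intro: subspace_diff)
    then show ?thesis using xy by (intro bexI[of _ y] bexI[of _ x]) (auto simp: I_def)
  qed
  have \<Omega>step: "\<exists>y \<in> I p p. \<exists>x \<in> \<Omega> (2 * p - 2). u = y + x" if u: "u \<in> \<Omega> (2 * p)" for u p
  proof -
    obtain x y where xy: "x \<in> F p" "y \<in> \<Omega> (2 * p - 2)" "u = x + y"
      using op(2)[of u p] u \<Omega>(3) by blast
    have "x = u - y" using xy by simp
    then have "x \<in> \<Omega> (2 * p)" using u xy(2) \<Omega>(1) \<Omega>(2)[of "2 * p - 2" "2 * p"] by (auto intro: subspace_diff)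
    then show ?thesis using xy by (auto simp: I_def)
  qed
  have mono: "span (\<Union> {I r s | r s. P r s}) \<subseteq> span (\<Union> {I r s | r s. P' r s})"
    if "\<And>r s. P r s \<Longrightarrow> P' r s" for P P'
    using that by (intro span_mono) blast
  have FI: "F p = span (\<Union> {I r s | r s. r \<ge> p})" for p
  proof (rule equalityI)
    have "I r s \<subseteq> F p" if "r \<ge> p" for r s
      using that FD(2)[of p r] subspace_0[OF FD(1)] by (auto simp: I_def)
    then show "span (\<Union> {I r s | r s. r \<ge> p}) \<subseteq> F p" using FD(1) by (intro span_minimal) auto
    show "F p \<subseteq> span (\<Union> {I r s | r s. r \<ge> p})"
    proof (induction p rule: int_down_induct[where b = d])
      case (base m)
      then show ?case using d span_zero by simp
    next
      case (step m)
      show ?case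
      proof
        fix u assume "u \<in> F m"
        then obtain y x where yx: "y \<in> I m m" "x \<in> F (m + 1)" "u = y + x" using Fstep by blast
        have "x \<in> span (\<Union> {I r s | r s. r \<ge> m})"
          using yx(2) step mono[of "\<lambda>r s. m + 1 \<le> r" "\<lambda>r s. m \<le> r"] by auto
        moreover have "y \<in> span (\<Union> {I r s | r s. r \<ge> m})" using yx(1) by (intro span_base) auto
        ultimately show "u \<in> span (\<Union> {I r s | r s. r \<ge> m})" using yx(3) span_add by blast
      qed
    qed
  qed
  have diagI: "\<exists>p. r = p \<and> s = p" if "x \<in> I r s" "x \<noteq> 0" for x r s
    using that by (auto simp: I_def split: if_splits)
  have \<Omega>even: "\<Omega> (2 * p) = span (\<Union> {I r s | r s. r \<le> p \<and> s \<le> p})" for p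
  proof (rule equalityI)
    have "I r s \<subseteq> \<Omega> (2 * p)" if "r \<le> p" for r s
      using that \<Omega>(2)[of "2 * r" "2 * p"] subspace_0[OF \<Omega>(1)] by (auto simp: I_def)
    then show "span (\<Union> {I r s | r s. r \<le> p \<and> s \<le> p}) \<subseteq> \<Omega> (2 * p)"
      using \<Omega>(1) by (intro span_minimal) auto
    show "\<Omega> (2 * p) \<subseteq> span (\<Union> {I r s | r s. r \<le> p \<and> s \<le> p})"
    \<comment> \<open>The bound \<open>- \<bar>b\<bar>\<close> guarantees
      \<open>2 * m \<le> - b\<close> whatever the sign of \<open>b\<close>.\<close>
    proof (induction p rule: int_up_induct[where b = "- \<bar>b\<bar>"])
      case (base m)
      then show ?case using \<Omega>0[of "2 * m"] span_zero by simp
    next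
      case (step m)
      show ?case
      proof
        fix u assume "u \<in> \<Omega> (2 * m)"
        then obtain y x where yx: "y \<in> I m m" "x \<in> \<Omega> (2 * (m - 1))" "u = y + x"
          using \<Omega>step[of u m] by (auto simp: algebra_simps)
        have "x \<in> span (\<Union> {I r s | r s. r \<le> m \<and> s \<le> m})"
          using yx(2) step mono[of "\<lambda>r s. r \<le> m - 1 \<and> s \<le> m - 1" "\<lambda>r s. r \<le> m \<and> s \<le> m"] by auto
        moreover have "y \<in> span (\<Union> {I r s | r s. r \<le> m \<and> s \<le> m})" using yx(1) by (intro span_base) auto
        ultimately show "u \<in> span (\<Union> {I r s | r s. r \<le> m \<and> s \<le> m})" using yx(3) span_add by blast
      qed
    qed
  qed
  have \<Omega>I: "\<Omega> k = span (\<Union> {I p q | p q. p + q \<le> k})" for k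
  proof -
    define p where "p = k div 2"
    have k: "k = 2 * p \<or> k = 2 * (p + 1) - 1" unfolding p_def by presburger
    have "\<Omega> k = \<Omega> (2 * p)" using k op(3)[of "p + 1"] by auto
    also have "\<dots> = span (\<Union> {I p q | p q. p + q \<le> k})"
    proof (rule equalityI)
      show "\<Omega> (2 * p) \<subseteq> span (\<Union> {I p q | p q. p + q \<le> k})"
        unfolding \<Omega>even using k by (intro mono) auto
      have "x \<in> \<Omega> (2 * p)" if "x \<in> I r s" "r + s \<le> k" for x r s
      proof (cases "x = 0")
        case False
        then have "r = s" using diagI that by blast
        then have "r \<le> p" using that k by auto
        then show ?thesis unfolding \<Omega>even using that \<open>r = s\<close> by (intro span_base) auto
      qed (use subspace_0[OF \<Omega>(1)] in auto)
      then show "span (\<Union> {I p q | p q. p + q \<le> k}) \<subseteq> \<Omega> (2 * p)"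
        using \<Omega>(1) by (intro span_minimal) auto
    qed
    finally show ?thesis .
  qed
  have indep: "\<forall>i. h i = 0" if h: "finite {i. h i \<noteq> 0}" "\<And>i. h i \<in> (\<lambda>(p, q). I p q) i"
    "(\<Sum>i | h i \<noteq> 0. h i) = 0" for h
  proof (rule ccontr)
    let ?S = "{i. h i \<noteq> 0}"
    assume "\<not> (\<forall>i. h i = 0)"
    then have ne: "fst ` ?S \<noteq> {}" by auto
    have dg: "fst i = snd i" if "i \<in> ?S" for i using that h(2)[of i] diagI by (cases i) auto
    \<comment> \<open>The summand of largest index lies in \<open>F p\<close>; being minus the sum
      of the others, it lies in \<open>\<Omega> (2 * p - 2)\<close> as well.\<close>
    define p where "p = Max (fst ` ?S)"
    have "p \<in> fst ` ?S" unfolding p_def using h(1) ne by (intro Max_in) auto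
    then have pS: "(p, p) \<in> ?S" using dg by force
    have le: "fst i \<le> p" if "i \<in> ?S" for i unfolding p_def using that h(1) by auto
    have hI: "h (p, p) \<in> F p" using h(2)[of "(p, p)"] by (auto simp: I_def)
    have "h i \<in> \<Omega> (2 * p - 2)" if i: "i \<in> ?S - {(p, p)}" for i
    proof -
      obtain r where r: "i = (r, r)" using dg[of i] i by (cases i) auto
      then have "r \<le> p" "r \<noteq> p" using le[of i] i by auto
      then have "2 * r \<le> 2 * p - 2" by auto
      moreover have "h i \<in> \<Omega> (2 * r)" using h(2)[of i] r by (auto simp: I_def)
      ultimately show ?thesis using \<Omega>(2) by blast
    qed
    then have "(\<Sum>i \<in> ?S - {(p, p)}. h i) \<in> \<Omega> (2 * p - 2)" by (intro subspace_sum \<Omega>(1))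
    then have "- (\<Sum>i \<in> ?S - {(p, p)}. h i) \<in> \<Omega> (2 * p - 2)" by (rule subspace_neg[OF \<Omega>(1)])
    moreover have "h (p, p) = - (\<Sum>i \<in> ?S - {(p, p)}. h i)"
      using sum.remove[OF h(1) pS, of h] unfolding h(3) by (metis eq_neg_iff_add_eq_0)
    ultimately have "h (p, p) \<in> \<Omega> (2 * p - 2)" by metis
    then have "h (p, p) = 0" using op(1) hI by blast
    then show False using pS by simp
  qed
  have ds: "is_direct_sum (\<lambda>(p, q). I p q) U"
    unfolding is_direct_sum_def
  proof (intro conjI allI ballI)
    fix i show "(case i of (p, q) \<Rightarrow> I p q) \<subseteq> U"
      using FD(3) subspace_0[OF FD(4)] by (cases i) (auto simp: I_def)
  next
    fix u assume "u \<in> U"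
    then have "u \<in> span (\<Union> {I r s | r s. r \<ge> a})" using a FI by blast
    moreover have "\<Union> {I r s | r s. r \<ge> a} = \<Union> ((\<lambda>(p, q). I p q) ` {i. fst i \<ge> a})" by force
    moreover have "subspace (case i of (p, q) \<Rightarrow> I p q)" for i using I by (cases i) auto
    ultimately obtain f where f: "finite {i. f i \<noteq> 0}" "\<forall>i. f i \<in> (case i of (p, q) \<Rightarrow> I p q)"
      "u = (\<Sum>i | f i \<noteq> 0. f i)" using span_family_repr[where J = "\<lambda>(p, q). I p q" and u = u and S = "{i. fst i \<ge> a}"]
      by (metis (no_types, lifting))
    show "\<exists>!f. finite {i. f i \<noteq> 0} \<and> (\<forall>i. f i \<in> (case i of (p, q) \<Rightarrow> I p q)) \<and> u = (\<Sum>i | f i \<noteq> 0. f i)"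
    proof (rule ex1I[of _ f])
      fix g assume g: "finite {i. g i \<noteq> 0} \<and> (\<forall>i. g i \<in> (case i of (p, q) \<Rightarrow> I p q)) \<and> u = (\<Sum>i | g i \<noteq> 0. g i)"
      let ?h = "\<lambda>i. g i - f i" and ?A = "{i. f i \<noteq> 0} \<union> {i. g i \<noteq> 0}"
      have fin: "finite ?A" using f g by auto
      have supp: "{i. ?h i \<noteq> 0} \<subseteq> ?A" by auto
      have "(\<Sum>i | ?h i \<noteq> 0. ?h i) = sum ?h ?A" by (rule sum_support_eq[OF fin supp])
      also have "\<dots> = sum g ?A - sum f ?A" by (simp add: sum_subtractf)
      also have "\<dots> = 0" using f g fin sum_support_eq[of ?A f] sum_support_eq[of ?A g] by simp
      finally have "(\<Sum>i | ?h i \<noteq> 0. ?h i) = 0" .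
      moreover have "?h i \<in> (case i of (p, q) \<Rightarrow> I p q)" for i
        using f(2) g I by (cases i) (simp add: subspace_diff)
      ultimately have "\<forall>i. ?h i = 0" using finite_subset[OF supp fin] by (intro indep)
      then show "g = f" by auto
    qed (use f in auto)
  qed
  have conj: "span (cj ` I p q \<union> \<Union> {I r s | r s. r < q \<and> s < p}) =
        span (I q p \<union> \<Union> {I r s | r s. r < q \<and> s < p})" for p q
  proof (cases "p = q")
    case False
    then show ?thesis by (simp add: I_def cj_0)
  next
    case True
    let ?L = "\<Union> {I r s | r s. r < p \<and> s < p}"
    have "2 * (p - 1) = 2 * p - 2" by simp
    then have L: "span ?L = \<Omega> (2 * p - 2)" using \<Omega>even[of "p - 1"] by simp
    have cj\<Omega>: "cj u \<in> \<Omega> k" if "u \<in> \<Omega> k" for u k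
      using that cj_span[of "W k" u] W(2) by (auto simp: \<Omega>_def)
    have Lsub: "?L \<subseteq> \<Omega> (2 * p)" using L span_superset[of ?L] \<Omega>(2)[of "2 * p - 2" "2 * p"] by auto
    have "span (I p p \<union> ?L) = \<Omega> (2 * p)"
    proof (rule equalityI)
      show "span (I p p \<union> ?L) \<subseteq> \<Omega> (2 * p)" using Lsub \<Omega>(1) by (intro span_minimal) (auto simp: I_def)
      show "\<Omega> (2 * p) \<subseteq> span (I p p \<union> ?L)"
      proof
        fix u assume "u \<in> \<Omega> (2 * p)"
        then obtain y x where yx: "y \<in> I p p" "x \<in> span ?L" "u = y + x" using \<Omega>step L by blast
        have "x \<in> span (I p p \<union> ?L)" using yx(2) span_mono[of ?L "I p p \<union> ?L"] by blast
        moreover have "y \<in> span (I p p \<union> ?L)" using yx(1) by (intro span_base) simp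
        ultimately show "u \<in> span (I p p \<union> ?L)" unfolding yx(3) by (intro span_add)
      qed
    qed
    moreover have "span (cj ` I p p \<union> ?L) = \<Omega> (2 * p)"
    proof (rule equalityI)
      show "span (cj ` I p p \<union> ?L) \<subseteq> \<Omega> (2 * p)"
        using Lsub \<Omega>(1) cj\<Omega> by (intro span_minimal) (auto simp: I_def)
      show "\<Omega> (2 * p) \<subseteq> span (cj ` I p p \<union> ?L)"
      proof
        fix u assume "u \<in> \<Omega> (2 * p)"
        then obtain y x where yx: "y \<in> I p p" "x \<in> \<Omega> (2 * p - 2)" "cj u = y + x"
          using \<Omega>step cj\<Omega> by blast
        have "u = cj y + cj x" using yx(3) cj_cj cj_add by metis
        moreover have "cj x \<in> span ?L" using yx(2) cj\<Omega> L by blast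
        then have "cj x \<in> span (cj ` I p p \<union> ?L)" using span_mono[of ?L "cj ` I p p \<union> ?L"] by blast
        moreover have "cj y \<in> span (cj ` I p p \<union> ?L)" using yx(1) by (intro span_base) auto
        ultimately show "u \<in> span (cj ` I p p \<union> ?L)" using span_add by blast
      qed
    qed
    ultimately show ?thesis using True by simp
  qed
  show ?thesis
    unfolding hodge_tate_def deligne_splitting_def
  proof (intro exI[of _ I] conjI allI impI)
    show "span (W k) = span (\<Union> {I p q | p q. p + q \<le> k})" for k using \<Omega>I unfolding \<Omega>_def .
    show "I p q = {0}" if "p \<noteq> q" for p q using that by (simp add: I_def)
  qed (fact I ds FI conj)+
qed

end

section \<open>Complex vectors and matrices: scaling, conjugation, commutators\<close>

global_interpretation cvec: conjugated_space "(*s)" vconj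
  by unfold_locales (simp_all add: vconj_def vec_eq_iff)

global_interpretation cmat: conjugated_space mscale mconj
  by unfold_locales (simp_all add: mscale_def map_matrix_def vec_eq_iff)

lemma mscale_entry [simp]: "mscale c A $ i $ j = c * A $ i $ j"
  by (simp add: mscale_def)

lemma mscale_vec: "mscale c A *v u = c *s (A *v u)"
  by (simp add: mscale_def vec_eq_iff matrix_vector_mult_def sum_distrib_left mult.assoc)

lemma mscale_mult: "mscale c A ** B = mscale c (A ** B)" "A ** mscale c B = mscale c (A ** B)"
  by (simp_all add: mscale_def vec_eq_iff matrix_matrix_mult_def sum_distrib_left algebra_simps)

lemma trace_mscale: "trace (mscale c A) = c * trace A"
  by (simp add: mscale_def trace_def sum_distrib_left)

lemma mconj_mult: "mconj (A ** B) = mconj A ** mconj B"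
  by (simp add: vec_eq_iff matrix_matrix_mult_def)

lemma vconj_matrix_vec: "vconj (A *v u) = mconj A *v vconj u"
  by (simp add: vec_eq_iff vconj_def matrix_vector_mult_def)

lemma mat_vec_linear [simp]:
  fixes A :: "complex ^ 'v ^ 'v"
  shows "A *v (c *s u) = c *s (A *v u)"
  by (simp add: vec_eq_iff matrix_vector_mult_def sum_distrib_left algebra_simps)

lemma matrix_mult_add_distrib:
  fixes A B C :: "complex ^ 'v ^ 'v"
  shows "(A + B) ** C = A ** C + B ** C" "C ** (A + B) = C ** A + C ** B"
    "(A - B) ** C = A ** C - B ** C" "C ** (A - B) = C ** A - C ** B"
  by (simp_all add: vec_eq_iff matrix_matrix_mult_def sum.distrib sum_subtractf algebra_simps)

lemma lie_bracket_linear: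
  "lie_bracket X (Y + Z) = lie_bracket X Y + lie_bracket X Z"
  "lie_bracket X (mscale c Y) = mscale c (lie_bracket X Y)"
  "lie_bracket X (Y - Z) = lie_bracket X Y - lie_bracket X Z"
  "lie_bracket (X + Y) Z = lie_bracket X Z + lie_bracket Y Z"
  "lie_bracket (mscale c X) Z = mscale c (lie_bracket X Z)"
  "lie_bracket (X - Y) Z = lie_bracket X Z - lie_bracket Y Z"
  by (simp_all add: lie_bracket_def matrix_mult_add_distrib mscale_mult cmat.scale_right_diff_distrib algebra_simps)

lemma trace_lie_bracket_left: "trace (lie_bracket X Y ** Z) = - trace (Y ** lie_bracket X Z)"
proof -
  have "trace (X ** Y ** Z) = trace (Y ** Z ** X)"
    by (metis matrix_mul_assoc trace_mul_sym)
  then show ?thesis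
    by (simp add: lie_bracket_def matrix_mult_add_distrib trace_sub matrix_mul_assoc)
qed

subsection \<open>Polynomial functions and the Lie algebra\<close>

lemma matrix_poly_sum:
  assumes "finite S" "\<And>i. i \<in> S \<Longrightarrow> matrix_poly UNIV (f i)"
  shows "matrix_poly UNIV (\<lambda>A. \<Sum>i\<in>S. f i A)"
  using assms by (induction S rule: finite_induct) (auto intro: matrix_poly.intros)

lemma matrix_poly_compose:
  assumes "matrix_poly UNIV f"
    and h: "\<And>i j. matrix_poly UNIV (\<lambda>A. h A $ i $ j)"
  shows "matrix_poly UNIV (\<lambda>A. f (h A))"
  using assms(1) by (induction) (auto intro: matrix_poly.intros h)

lemma matrix_poly_mult_entry:
  "matrix_poly UNIV (\<lambda>A. (B ** A ** C) $ i $ j)"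
  by (auto simp: matrix_matrix_mult_def sum_distrib_right intro!: matrix_poly_sum matrix_poly.intros)

lemma matrix_poly_cnj:
  assumes "matrix_poly K f" "\<And>c. c \<in> K \<Longrightarrow> cnj c \<in> K"
  shows "matrix_poly K (\<lambda>A. cnj (f (mconj A)))"
  using assms(1) by induction (auto intro: matrix_poly.intros assms(2))

lemma matrix_poly_rational_cnj:
  assumes "matrix_poly \<rat> f"
  shows "f (mconj A) = cnj (f A)"
  using assms by induction (auto elim!: Rats_cases')

text \<open>\<open>L\<close> is the derivative of \<open>f\<close> at the identity, and \<open>B\<close> its second derivative. In the last
  clause \<open>g\<close> is the derivative of \<open>f\<close> along the left-invariant vector field of \<open>Y\<close>.\<close>

definition two_jet :: "(complex ^ 'v ^ 'v \<Rightarrow> complex) \<Rightarrow> (complex ^ 'v ^ 'v \<Rightarrow> complex) \<Rightarrow>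
    (complex ^ 'v ^ 'v \<Rightarrow> complex ^ 'v ^ 'v \<Rightarrow> complex) \<Rightarrow> bool" where
  "two_jet f L B \<longleftrightarrow> (\<forall>X Y. L (X + Y) = L X + L Y) \<and> (\<forall>c X. L (mscale c X) = c * L X) \<and>
     (\<forall>\<gamma> X. \<gamma> 0 = mat 1 \<longrightarrow> (\<forall>i j. ((\<lambda>t. \<gamma> t $ i $ j) has_field_derivative X $ i $ j) (at 0)) \<longrightarrow>
        ((\<lambda>t. f (\<gamma> t)) has_field_derivative L X) (at 0)) \<and>
     (\<forall>X Y. B X Y = B Y X) \<and>
     (\<forall>Y. \<exists>g. matrix_poly UNIV g \<and>
          (\<forall>A. ((\<lambda>t. f (A ** (mat 1 + mscale t Y))) has_field_derivative g A) (at 0)) \<and>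
          (\<forall>X. ((\<lambda>t. g (mat 1 + mscale t X)) has_field_derivative B X Y + L (X ** Y)) (at 0)))"

lemma two_jetD:
  assumes "two_jet f L B"
  shows "L (X + Y) = L X + L Y" "L (mscale c X) = c * L X"
    "\<gamma> 0 = mat 1 \<Longrightarrow> (\<And>i j. ((\<lambda>t. \<gamma> t $ i $ j) has_field_derivative X $ i $ j) (at 0)) \<Longrightarrow>
       ((\<lambda>t. f (\<gamma> t)) has_field_derivative L X) (at 0)"
    "B X Y = B Y X"
    "\<exists>g. matrix_poly UNIV g \<and>
          (\<forall>A. ((\<lambda>t. f (A ** (mat 1 + mscale t Y))) has_field_derivative g A) (at 0)) \<and>
          (\<forall>X. ((\<lambda>t. g (mat 1 + mscale t X)) has_field_derivative B X Y + L (X ** Y)) (at 0))"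
  using assms unfolding two_jet_def by (elim conjE; simp)+

lemma two_jet_line:
  assumes "two_jet f L B"
  shows "((\<lambda>t. f (mat 1 + mscale t X)) has_field_derivative L X) (at 0)"
  by (rule two_jetD(3)[OF assms]) (auto intro!: derivative_eq_intros)

text \<open>Induction over the construction of polynomials replaces a second-order Taylor expansion.
  In the product case the Leibniz rule adds the cross terms \<open>L1 X * L2 Y + L1 Y * L2 X\<close>
  to \<open>B\<close>. They are symmetric, and symmetry is what makes \<open>B\<close> cancel from
  commutators.\<close>

lemma matrix_poly_two_jet:
  assumes "matrix_poly UNIV f"
  shows "\<exists>L B. two_jet f L B"
  using assms
proof induction
  case (const c)
  have "two_jet (\<lambda>_. c) (\<lambda>_. 0) (\<lambda>_ _. 0)"
    unfolding two_jet_def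
    by (intro exI[of _ "\<lambda>_. 0"] conjI allI impI) (auto intro: matrix_poly.intros)
  then show ?case by blast
next
  case (entry i j)
  have "two_jet (\<lambda>A. A $ i $ j) (\<lambda>X. X $ i $ j) (\<lambda>_ _. 0)"
    unfolding two_jet_def
  proof (intro conjI allI impI)
    fix Y :: "complex ^ 'a ^ 'a"
    have *: "matrix_poly UNIV (\<lambda>A. (A ** Y) $ i $ j)"
      using matrix_poly_mult_entry[of "mat 1" Y i j] by simp
    have 1: "((\<lambda>t. (A ** (mat 1 + mscale t Y)) $ i $ j) has_field_derivative (A ** Y) $ i $ j) (at 0)" for A
      by (auto simp: matrix_mult_add_distrib mscale_mult intro!: derivative_eq_intros)
    have 2: "((\<lambda>t. ((mat 1 + mscale t X) ** Y) $ i $ j) has_field_derivative 0 + (X ** Y) $ i $ j) (at 0)" for X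
      by (auto simp: matrix_mult_add_distrib mscale_mult intro!: derivative_eq_intros)
    show "\<exists>g. matrix_poly UNIV g \<and>
          (\<forall>A. ((\<lambda>t. (A ** (mat 1 + mscale t Y)) $ i $ j) has_field_derivative g A) (at 0)) \<and>
          (\<forall>X. ((\<lambda>t. g (mat 1 + mscale t X)) has_field_derivative 0 + (X ** Y) $ i $ j) (at 0))"
      by (intro exI[of _ "\<lambda>A. (A ** Y) $ i $ j"] conjI allI * 1 2)
  next
    fix \<gamma> :: "complex \<Rightarrow> complex ^ 'a ^ 'a" and X
    assume "\<forall>i j. ((\<lambda>t. \<gamma> t $ i $ j) has_field_derivative X $ i $ j) (at 0)"
    then show "((\<lambda>t. \<gamma> t $ i $ j) has_field_derivative X $ i $ j) (at 0)" by simp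
  qed simp_all
  then show ?case by blast
next
  case (add f1 f2)
  obtain L1 B1 where j1: "two_jet f1 L1 B1" using add.IH(1) by blast
  note 1 = two_jetD[OF j1]
  obtain L2 B2 where j2: "two_jet f2 L2 B2" using add.IH(2) by blast
  note 2 = two_jetD[OF j2]
  have "two_jet (\<lambda>A. f1 A + f2 A) (\<lambda>X. L1 X + L2 X) (\<lambda>X Y. B1 X Y + B2 X Y)"
    unfolding two_jet_def
  proof (intro conjI allI impI)
    fix Y
    obtain g1 where g1: "matrix_poly UNIV g1"
      "\<And>A. ((\<lambda>t. f1 (A ** (mat 1 + mscale t Y))) has_field_derivative g1 A) (at 0)"
      "\<And>X. ((\<lambda>t. g1 (mat 1 + mscale t X)) has_field_derivative B1 X Y + L1 (X ** Y)) (at 0)"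
      using 1(5)[of Y] by blast
    obtain g2 where g2: "matrix_poly UNIV g2"
      "\<And>A. ((\<lambda>t. f2 (A ** (mat 1 + mscale t Y))) has_field_derivative g2 A) (at 0)"
      "\<And>X. ((\<lambda>t. g2 (mat 1 + mscale t X)) has_field_derivative B2 X Y + L2 (X ** Y)) (at 0)"
      using 2(5)[of Y] by blast
    show "\<exists>g. matrix_poly UNIV g \<and>
      (\<forall>A. ((\<lambda>t. f1 (A ** (mat 1 + mscale t Y)) + f2 (A ** (mat 1 + mscale t Y))) has_field_derivative g A) (at 0)) \<and>
      (\<forall>X. ((\<lambda>t. g (mat 1 + mscale t X)) has_field_derivative
            B1 X Y + B2 X Y + (L1 (X ** Y) + L2 (X ** Y))) (at 0))"
    proof (intro exI[of _ "\<lambda>A. g1 A + g2 A"] conjI allI)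
      show "matrix_poly UNIV (\<lambda>A. g1 A + g2 A)" using g1 g2 by (intro matrix_poly.add)
      show "((\<lambda>t. f1 (A ** (mat 1 + mscale t Y)) + f2 (A ** (mat 1 + mscale t Y))) has_field_derivative g1 A + g2 A) (at 0)" for A
        using g1(2) g2(2) by (rule DERIV_add)
      show "((\<lambda>t. g1 (mat 1 + mscale t X) + g2 (mat 1 + mscale t X)) has_field_derivative
            B1 X Y + B2 X Y + (L1 (X ** Y) + L2 (X ** Y))) (at 0)" for X
        using DERIV_add[OF g1(3) g2(3)] by (simp add: algebra_simps)
    qed
  next
    fix \<gamma> :: "complex \<Rightarrow> complex ^ 'a ^ 'a" and X
    assume "\<gamma> 0 = mat 1" "\<forall>i j. ((\<lambda>t. \<gamma> t $ i $ j) has_field_derivative X $ i $ j) (at 0)"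
    then show "((\<lambda>t. f1 (\<gamma> t) + f2 (\<gamma> t)) has_field_derivative L1 X + L2 X) (at 0)"
      by (intro DERIV_add 1(3) 2(3)) simp_all
  next
    fix X Y
    have "B1 X Y = B1 Y X" "B2 X Y = B2 Y X" by (fact 1(4), fact 2(4))
    then show "B1 X Y + B2 X Y = B1 Y X + B2 Y X" by (simp add: algebra_simps)
  qed (simp_all add: 1(1,2) 2(1,2) algebra_simps)
  then show ?case by blast
next
  case (mult f1 f2)
  obtain L1 B1 where j1: "two_jet f1 L1 B1" using mult.IH(1) by blast
  note 1 = two_jetD[OF j1]
  obtain L2 B2 where j2: "two_jet f2 L2 B2" using mult.IH(2) by blast
  note 2 = two_jetD[OF j2]
  let ?a = "f1 (mat 1)" and ?b = "f2 (mat 1)"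
  have "two_jet (\<lambda>A. f1 A * f2 A) (\<lambda>X. L1 X * ?b + L2 X * ?a)
      (\<lambda>X Y. B1 X Y * ?b + L1 Y * L2 X + L1 X * L2 Y + B2 X Y * ?a)"
    unfolding two_jet_def
  proof (intro conjI allI impI)
    fix Y
    obtain g1 where g1: "matrix_poly UNIV g1"
      "\<And>A. ((\<lambda>t. f1 (A ** (mat 1 + mscale t Y))) has_field_derivative g1 A) (at 0)"
      "\<And>X. ((\<lambda>t. g1 (mat 1 + mscale t X)) has_field_derivative B1 X Y + L1 (X ** Y)) (at 0)"
      using 1(5)[of Y] by blast
    obtain g2 where g2: "matrix_poly UNIV g2"
      "\<And>A. ((\<lambda>t. f2 (A ** (mat 1 + mscale t Y))) has_field_derivative g2 A) (at 0)"
      "\<And>X. ((\<lambda>t. g2 (mat 1 + mscale t X)) has_field_derivative B2 X Y + L2 (X ** Y)) (at 0)"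
      using 2(5)[of Y] by blast
    have g11: "g1 (mat 1) = L1 Y"
      by (rule DERIV_unique[OF g1(2)]) (use two_jet_line[OF j1, of Y] in simp)
    have g21: "g2 (mat 1) = L2 Y"
      by (rule DERIV_unique[OF g2(2)]) (use two_jet_line[OF j2, of Y] in simp)
    show "\<exists>g. matrix_poly UNIV g \<and>
      (\<forall>A. ((\<lambda>t. f1 (A ** (mat 1 + mscale t Y)) * f2 (A ** (mat 1 + mscale t Y))) has_field_derivative g A) (at 0)) \<and>
      (\<forall>X. ((\<lambda>t. g (mat 1 + mscale t X)) has_field_derivative
            B1 X Y * ?b + L1 Y * L2 X + L1 X * L2 Y + B2 X Y * ?a + (L1 (X ** Y) * ?b + L2 (X ** Y) * ?a)) (at 0))"
    proof (intro exI[of _ "\<lambda>A. g1 A * f2 A + g2 A * f1 A"] conjI allI)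
      show "matrix_poly UNIV (\<lambda>A. g1 A * f2 A + g2 A * f1 A)"
        using g1 g2 mult.hyps by (intro matrix_poly.intros)
      show "((\<lambda>t. f1 (A ** (mat 1 + mscale t Y)) * f2 (A ** (mat 1 + mscale t Y))) has_field_derivative g1 A * f2 A + g2 A * f1 A) (at 0)" for A
        using DERIV_mult[OF g1(2)[of A] g2(2)[of A]] by simp
      fix X
      have d: "((\<lambda>t. f1 (mat 1 + mscale t X)) has_field_derivative L1 X) (at 0)"
        "((\<lambda>t. f2 (mat 1 + mscale t X)) has_field_derivative L2 X) (at 0)"
        using two_jet_line[OF j1] two_jet_line[OF j2] by blast+
      show "((\<lambda>t. g1 (mat 1 + mscale t X) * f2 (mat 1 + mscale t X) + g2 (mat 1 + mscale t X) * f1 (mat 1 + mscale t X)) has_field_derivative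
            B1 X Y * ?b + L1 Y * L2 X + L1 X * L2 Y + B2 X Y * ?a + (L1 (X ** Y) * ?b + L2 (X ** Y) * ?a)) (at 0)"
        using DERIV_add[OF DERIV_mult[OF g1(3)[of X] d(2)] DERIV_mult[OF g2(3)[of X] d(1)]]
        by (simp add: g11 g21 algebra_simps)
    qed
  next
    fix \<gamma> :: "complex \<Rightarrow> complex ^ 'a ^ 'a" and X
    assume "\<gamma> 0 = mat 1" "\<forall>i j. ((\<lambda>t. \<gamma> t $ i $ j) has_field_derivative X $ i $ j) (at 0)"
    then show "((\<lambda>t. f1 (\<gamma> t) * f2 (\<gamma> t)) has_field_derivative L1 X * ?b + L2 X * ?a) (at 0)"
      using DERIV_mult[OF 1(3)[of \<gamma> X] 2(3)[of \<gamma> X]] by simp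
  next
    fix X Y
    have "B1 X Y = B1 Y X" "B2 X Y = B2 Y X" by (fact 1(4), fact 2(4))
    then show "B1 X Y * ?b + L1 Y * L2 X + L1 X * L2 Y + B2 X Y * ?a = B1 Y X * ?b + L1 X * L2 Y + L1 Y * L2 X + B2 Y X * ?a" by (simp add: algebra_simps)
  qed (simp_all add: 1(1,2) 2(1,2) algebra_simps)
  then show ?case by blast
qed

lemma lie_algebra_two_jet:
  assumes "two_jet f L B" "matrix_poly UNIV f" "\<forall>A\<in>G. f A = 0" "X \<in> lie_algebra G"
  shows "L X = 0"
  using assms two_jet_line[OF assms(1)] DERIV_unique unfolding lie_algebra_def by blast

text \<open>Replaces derivatives along lines by the linear functional \<open>L\<close>, so that
  closure under sums becomes a matter of linearity.\<close>

lemma lie_algebraI: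
  assumes "\<And>f L B. two_jet f L B \<Longrightarrow> matrix_poly UNIV f \<Longrightarrow> \<forall>A\<in>G. f A = 0 \<Longrightarrow> L X = 0"
  shows "X \<in> lie_algebra G"
  unfolding lie_algebra_def
proof (intro CollectI allI impI)
  fix f assume f: "matrix_poly UNIV f \<and> (\<forall>A\<in>G. f A = 0)"
  then obtain L B where L: "two_jet f L B" using matrix_poly_two_jet by blast
  then have "L X = 0" using assms f by blast
  then show "((\<lambda>t. f (mat 1 + mscale t X)) has_field_derivative 0) (at 0)"
    using two_jet_line[OF L, of X] by simp
qed

lemma subspace_lie_algebra: "cmat.subspace (lie_algebra G)"
proof (rule cmat.subspaceI)
  show "0 \<in> lie_algebra G"
    by (simp add: lie_algebra_def)
next
  fix X Y assume "X \<in> lie_algebra G" "Y \<in> lie_algebra G"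
  then show "X + Y \<in> lie_algebra G"
    by (intro lie_algebraI) (simp add: two_jetD(1) lie_algebra_two_jet)
next
  fix c X assume "X \<in> lie_algebra G"
  then show "mscale c X \<in> lie_algebra G"
    by (intro lie_algebraI) (simp add: two_jetD(2) lie_algebra_two_jet)
qed

text \<open>Differentiating twice along left-invariant fields gives
  \<open>B X Y + L (X ** Y) = 0\<close> on the Lie algebra. Subtracting the identity with X and Y
  exchanged, the symmetric \<open>B\<close> cancels and \<open>L\<close> of the commutator
  remains.\<close>

lemma lie_algebra_bracket:
  assumes mult: "\<And>A B. A \<in> G \<Longrightarrow> B \<in> G \<Longrightarrow> A ** B \<in> G"
    and X: "X \<in> lie_algebra G" and Y: "Y \<in> lie_algebra G"
  shows "lie_bracket X Y \<in> lie_algebra G"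
proof (rule lie_algebraI)
  fix f L B assume j: "two_jet f L B" and f: "matrix_poly UNIV f" "\<forall>A\<in>G. f A = 0"
  note L = two_jetD[OF j]
  text \<open>The left-invariant derivative of \<open>f\<close> along \<open>Y\<close> is a polynomial which vanishes on \<open>G\<close>.\<close>
  have zero: "B X Y + L (X ** Y) = 0" if X: "X \<in> lie_algebra G" and Y: "Y \<in> lie_algebra G" for X Y
  proof -
    obtain g where g: "matrix_poly UNIV g"
      "\<And>A. ((\<lambda>t. f (A ** (mat 1 + mscale t Y))) has_field_derivative g A) (at 0)"
      "\<And>X. ((\<lambda>t. g (mat 1 + mscale t X)) has_field_derivative B X Y + L (X ** Y)) (at 0)"
      using L(5)[of Y] by blast
    have "g A = 0" if A: "A \<in> G" for A
    proof -
      have "matrix_poly UNIV (\<lambda>M. f (A ** M))"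
        using matrix_poly_compose[of f "\<lambda>M. A ** M"] f matrix_poly_mult_entry[of A "mat 1"] by simp
      moreover have "\<forall>M\<in>G. f (A ** M) = 0" using f mult A by blast
      ultimately have "((\<lambda>t. f (A ** (mat 1 + mscale t Y))) has_field_derivative 0) (at 0)"
        using Y unfolding lie_algebra_def by blast
      then show ?thesis using g(2) DERIV_unique by blast
    qed
    then have "((\<lambda>t. g (mat 1 + mscale t X)) has_field_derivative 0) (at 0)"
      using X g(1) unfolding lie_algebra_def by blast
    then show ?thesis using g(3) DERIV_unique by blast
  qed
  have "lie_bracket X Y + Y ** X = X ** Y" by (simp add: lie_bracket_def)
  then have "B X Y + L (X ** Y) = L (lie_bracket X Y) + (B Y X + L (Y ** X))"
    using L(1)[of "lie_bracket X Y" "Y ** X"] L(4)[of X Y] by (simp add: add.left_commute)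
  then show "L (lie_bracket X Y) = 0" using zero[OF X Y] zero[OF Y X] by simp
qed

lemma lie_algebra_conjugate:
  assumes "\<And>A. A \<in> G \<Longrightarrow> C ** A ** D \<in> G" "C ** D = mat 1" "X \<in> lie_algebra G"
  shows "C ** X ** D \<in> lie_algebra G"
  unfolding lie_algebra_def
proof (intro CollectI allI impI)
  fix f assume f: "matrix_poly UNIV f \<and> (\<forall>A\<in>G. f A = 0)"
  then have "matrix_poly UNIV (\<lambda>A. f (C ** A ** D))" "\<forall>A\<in>G. f (C ** A ** D) = 0"
    using assms(1) matrix_poly_compose[of f "\<lambda>A. C ** A ** D"] matrix_poly_mult_entry by blast+
  then have "((\<lambda>t. f (C ** (mat 1 + mscale t X) ** D)) has_field_derivative 0) (at 0)"
    using assms(3) unfolding lie_algebra_def by blast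
  then show "((\<lambda>t. f (mat 1 + mscale t (C ** X ** D))) has_field_derivative 0) (at 0)"
    using assms(2) by (simp add: matrix_mult_add_distrib mscale_mult)
qed

text \<open>Conjugating the coefficients of an equation of \<open>G\<close> gives another equation
  of \<open>G\<close>, and conjugating both variable and value preserves complex
  differentiability.\<close>

lemma lie_algebra_mconj:
  assumes "\<And>A. A \<in> G \<Longrightarrow> mconj A \<in> G" "X \<in> lie_algebra G"
  shows "mconj X \<in> lie_algebra G"
  unfolding lie_algebra_def
proof (intro CollectI allI impI)
  fix f assume f: "matrix_poly UNIV f \<and> (\<forall>A\<in>G. f A = 0)"
  then have "matrix_poly UNIV (\<lambda>A. cnj (f (mconj A)))" "\<forall>A\<in>G. cnj (f (mconj A)) = 0"
    using assms(1) matrix_poly_cnj by auto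
  then have "((\<lambda>t. cnj (f (mconj (mat 1 + mscale t X)))) has_field_derivative 0) (at 0)"
    using assms(2) unfolding lie_algebra_def by blast
  then have "((cnj \<circ> (\<lambda>t. cnj (f (mconj (mat 1 + mscale t X)))) \<circ> cnj) has_field_derivative cnj 0) (at (cnj 0))"
    by (intro has_field_derivative_cnj_cnj) simp
  moreover have "mconj (mat 1 + mscale t X) = mat 1 + mscale (cnj t) (mconj X)" for t
    by (auto simp: vec_eq_iff mat_def)
  ultimately show "((\<lambda>t. f (mat 1 + mscale t (mconj X))) has_field_derivative 0) (at 0)"
    by (simp add: o_def)
qed

text \<open>The complex derivative can be read off along the real axis, so only real parameters have
  to stay in \<open>G\<close>. This suits the Hodge circle, whose values are known to lie in the
  group for |z| = 1.\<close>

lemma lie_algebra_curve: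
  assumes "\<gamma> 0 = mat 1"
    "\<And>i j. ((\<lambda>t. \<gamma> t $ i $ j) has_field_derivative X $ i $ j) (at 0)"
    and G: "\<And>t :: real. \<gamma> (of_real t) \<in> G"
  shows "X \<in> lie_algebra G"
proof (rule lie_algebraI)
  fix f L B assume j: "two_jet f L B" and f: "matrix_poly UNIV f" "\<forall>A\<in>G. f A = 0"
  have "((\<lambda>t. f (\<gamma> t)) has_field_derivative L X) (at (of_real 0))"
    using two_jetD(3)[OF j, of \<gamma> X] assms(1,2) by simp
  then have "((\<lambda>t. f (\<gamma> (of_real t))) has_vector_derivative L X) (at 0)"
    by (rule has_vector_derivative_real_field)
  then have "((\<lambda>t. 0) has_vector_derivative L X) (at (0::real))" using f(2) G by simp
  then show "L X = 0" using vector_derivative_unique_at has_vector_derivative_const by blast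
qed

subsection \<open>The Mumford--Tate group\<close>

lemma mumford_tate_group_mult:
  "A \<in> mumford_tate_group n F \<Longrightarrow> B \<in> mumford_tate_group n F \<Longrightarrow> A ** B \<in> mumford_tate_group n F"
  by (auto simp: mumford_tate_group_def rational_algebraic_group_def)

lemma mumford_tate_group_inv:
  "A \<in> mumford_tate_group n F \<Longrightarrow> matrix_inv A \<in> mumford_tate_group n F"
  by (auto simp: mumford_tate_group_def rational_algebraic_group_def)

lemma hodge_circle_in_mumford_tate_group:
  "norm z = 1 \<Longrightarrow> hodge_circle n F z \<in> mumford_tate_group n F"
  by (auto simp: mumford_tate_group_def)

lemma mconj_mat_1 [simp]: "mconj (mat 1) = mat 1"
  by (auto simp: vec_eq_iff mat_def)

lemma invertible_mconj:
  assumes "invertible A"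
  shows "invertible (mconj A)"
proof -
  obtain B where "A ** B = mat 1" "B ** A = mat 1" using assms by (auto simp: invertible_def)
  then have "mconj A ** mconj B = mat 1" "mconj B ** mconj A = mat 1"
    by (simp_all flip: mconj_mult)
  then show ?thesis by (auto simp: invertible_def)
qed

text \<open>The defining equations are rational, hence fixed by conjugation; this is the source of
  the real structure on the Lie algebra.\<close>

lemma mumford_tate_group_mconj:
  assumes "A \<in> mumford_tate_group n F"
  shows "mconj A \<in> mumford_tate_group n F"
proof -
  have "mconj A \<in> H" if H: "rational_algebraic_group H" "A \<in> H" for H
  proof -
    obtain P where P: "\<And>f. f \<in> P \<Longrightarrow> matrix_poly \<rat> f" "H = {A. invertible A \<and> (\<forall>f\<in>P. f A = 0)}"
      using H(1) unfolding rational_algebraic_group_def by blast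
    have "f (mconj A) = 0" if "f \<in> P" for f
      using matrix_poly_rational_cnj[OF P(1)[OF that], of A] H(2) P(2) that by simp
    moreover have "invertible (mconj A)" using H(2) P(2) by (intro invertible_mconj) simp
    ultimately show ?thesis unfolding P(2) by simp
  qed
  then show ?thesis using assms by (auto simp: mumford_tate_group_def)
qed

lemma matrix_inv_mult:
  assumes "invertible A"
  shows "A ** matrix_inv A = mat 1" "matrix_inv A ** A = mat 1"
  using someI_ex[OF assms[unfolded invertible_def]] unfolding matrix_inv_def by auto

text \<open>As a member of the family intersected in \<open>mumford_tate_group\<close>, it bounds
  that group by the invertible matrices.\<close>

lemma rational_algebraic_group_GL: "rational_algebraic_group {A. invertible A}"
proof -
  have "invertible (matrix_inv A)" if "invertible A" for A :: "complex ^ 'v ^ 'v"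
    using matrix_inv_mult[OF that] unfolding invertible_def by blast
  moreover have "invertible (mat 1 :: complex ^ 'v ^ 'v)"
    unfolding invertible_def by (metis matrix_mul_lid)
  ultimately show ?thesis
    unfolding rational_algebraic_group_def
    by (intro conjI exI[of _ "{}"]) (auto simp: invertible_mult)
qed

subsection \<open>Hodge decomposition\<close>

text \<open>Projections onto the pieces V^{p,n-p}; those with index outside {0..n} vanish
  automatically. The last clause expresses that F^r is the sum of the pieces with p \<ge> r. They
  turn the definite description in \<open>hodge_circle\<close> into a formula.\<close>

definition hodge_projectors :: "nat \<Rightarrow> (complex ^ 'v) filtration \<Rightarrow> (int \<Rightarrow> complex ^ 'v ^ 'v) \<Rightarrow> bool" where
  "hodge_projectors n F pr \<longleftrightarrow> (\<Sum>p\<in>{0..int n}. pr p) = mat 1 \<and>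
     (\<forall>p u. pr p *v u \<in> hodge_piece F p (int n - p)) \<and>
     (\<forall>p r u. u \<in> hodge_piece F r (int n - r) \<longrightarrow> pr p *v u = (if p = r then u else 0)) \<and>
     (\<forall>p r u. u \<in> F r \<longrightarrow> p < r \<longrightarrow> pr p *v u = 0)"

lemma hodge_projectorsD:
  assumes "hodge_projectors n F pr"
  shows "(\<Sum>p\<in>{0..int n}. pr p) = mat 1"
    "pr p *v u \<in> hodge_piece F p (int n - p)"
    "u \<in> hodge_piece F r (int n - r) \<Longrightarrow> pr p *v u = (if p = r then u else 0)"
    "u \<in> F r \<Longrightarrow> p < r \<Longrightarrow> pr p *v u = 0"
  using assms unfolding hodge_projectors_def by blast+

text \<open>\<open>r p\<close> projects onto F^p along the conjugate of F^{n-p+1}, and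
  \<open>pr p\<close> is the difference of consecutive projections. Telescoping from
  \<open>r 0\<close>, the identity, to \<open>r (n + 1)\<close>, zero, gives the sum; the
  complementary parts for p and p + 1 both lie in the conjugate of F^{n-p}, so the difference lies
  in V^{p,n-p}.\<close>

lemma hodge_projectors_exist:
  assumes F: "hodge_structure n F"
  shows "\<exists>pr. hodge_projectors n F pr"
proof -
  define F' where "F' q = vconj ` F q" for q
  have sub: "vec.subspace (F p)" and anti: "p \<le> q \<Longrightarrow> F q \<subseteq> F p" and F0: "F 0 = UNIV"
    and int0: "F p \<inter> F' (int n - p + 1) = {0}"
    and sum: "\<exists>a\<in>F p. \<exists>b\<in>F' (int n - p + 1). u = a + b" for p q u
    using F unfolding hodge_structure_def monotone_def F'_def by blast+
  have sub': "vec.subspace (F' p)" for p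
  proof (rule vec.subspaceI)
    show "0 \<in> F' p" using vec.subspace_0[OF sub[of p]] cvec.cj_0 by (auto simp: F'_def image_iff intro!: bexI[of _ 0])
    show "x + y \<in> F' p" if "x \<in> F' p" "y \<in> F' p" for x y
      using that vec.subspace_add[OF sub[of p]] by (force simp: F'_def simp flip: cvec.cj_add)
    show "c *s x \<in> F' p" if x: "x \<in> F' p" for c x
    proof -
      obtain y where y: "y \<in> F p" "x = vconj y" using x by (auto simp: F'_def)
      have "c *s x = vconj (cnj c *s y)" by (simp add: cvec.cj_scale y)
      then show ?thesis using vec.subspace_scale[OF sub y(1)] by (auto simp: F'_def)
    qed
  qed
  have anti': "p \<le> q \<Longrightarrow> F' q \<subseteq> F' p" for p q using anti unfolding F'_def by (intro image_mono)
  define r where "r p u = (SOME a. a \<in> F p \<and> u - a \<in> F' (int n - p + 1))" for p u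
  have r: "r p u \<in> F p" "u - r p u \<in> F' (int n - p + 1)" for p u
  proof -
    have "\<exists>a. a \<in> F p \<and> u - a \<in> F' (int n - p + 1)"
      using sum[where p = p and u = u] by force
    then show "r p u \<in> F p" "u - r p u \<in> F' (int n - p + 1)"
      unfolding r_def by (metis (mono_tags, lifting) someI_ex)+
  qed
  have uniq: "r p u = a" if "a \<in> F p" "u - a \<in> F' (int n - p + 1)" for p u a
  proof -
    have "r p u - a \<in> F p" by (intro vec.subspace_diff sub r that)
    moreover have "(u - a) - (u - r p u) \<in> F' (int n - p + 1)" by (rule vec.subspace_diff[OF sub' that(2) r(2)])
    then have "r p u - a \<in> F' (int n - p + 1)" by simp
    ultimately have "r p u - a = 0" using int0 by blast
    then show ?thesis by simp
  qed
  have "Vector_Spaces.linear (*s) (*s) (r p)" for p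
  proof (unfold_locales, goal_cases)
    case (1 x y)
    have "(x - r p x) + (y - r p y) \<in> F' (int n - p + 1)" by (intro vec.subspace_add sub' r)
    then show ?case using r sub by (intro uniq) (auto simp: algebra_simps intro: vec.subspace_add)
  next
    case (2 c x)
    have "c *s (x - r p x) \<in> F' (int n - p + 1)" by (intro vec.subspace_scale sub' r)
    then show ?case using r sub by (intro uniq) (auto simp: algebra_simps intro: vec.subspace_scale)
  qed
  define R where "R p = matrix (r p)" for p
  have R: "R p *v u = r p u" for p u
    unfolding R_def using \<open>Vector_Spaces.linear (*s) (*s) (r p)\<close> by (rule matrix_works)
  define pr where "pr p = R p - R (p + 1)" for p
  have pr: "pr p *v u = r p u - r (p + 1) u" for p u
    by (simp add: pr_def matrix_vector_mult_diff_rdistrib R)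
  have rF: "r p u = u" if "u \<in> F q" "p \<le> q" for p q u
    using that anti[of p q] vec.subspace_0[OF sub'] by (intro uniq) auto
  have rF': "r p u = 0" if "u \<in> F' q" "int n - p + 1 \<le> q" for p q u
    using that anti'[of "int n - p + 1" q] vec.subspace_0[OF sub] by (intro uniq) auto
  have "hodge_projectors n F pr"
    unfolding hodge_projectors_def
  proof (intro conjI allI impI)
    have "F' 0 = UNIV" unfolding F'_def F0 using cvec.cj_cj by (metis surjI)
    then have "r (int n + 1) u = 0" for u using rF'[of u 0 "int n + 1"] by simp
    moreover have "r 0 u = u" for u using rF[of u 0 0] F0 by simp
    moreover have "(\<Sum>p\<in>{0..int m}. pr p) *v u = r 0 u - r (int m + 1) u" for m u
    proof (induction m)
      case (Suc m)
      have "{0..int (Suc m)} = insert (int m + 1) {0..int m}" by auto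
      then show ?case using Suc by (simp add: matrix_vector_mult_add_rdistrib pr add.commute)
    qed (simp add: pr)
    ultimately show "(\<Sum>p\<in>{0..int n}. pr p) = mat 1"
      by (simp add: matrix_eq)
  next
    fix p u
    have "u - r (p + 1) u \<in> F' (int n - p)" "u - r p u \<in> F' (int n - p)"
      using r(2)[where p = "p + 1" and u = u] r(2)[where p = p and u = u] anti'[of "int n - p" "int n - p + 1"]
      by auto
    from vec.subspace_diff[OF sub' this]
    have "(u - r (p + 1) u) - (u - r p u) \<in> F' (int n - p)" .
    moreover have "r p u - r (p + 1) u \<in> F p"
      using r[where p = "p + 1" and u = u] r[where p = p and u = u] anti[of p "p + 1"] sub
      by (intro vec.subspace_diff) auto
    ultimately show "pr p *v u \<in> hodge_piece F p (int n - p)"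
      by (simp add: pr hodge_piece_def F'_def)
  next
    fix p q u assume u: "u \<in> hodge_piece F q (int n - q)"
    then have "u \<in> F q" "u \<in> F' (int n - q)" by (auto simp: hodge_piece_def F'_def)
    then show "pr p *v u = (if p = q then u else 0)"
      unfolding pr using rF[of u q p] rF[of u q "p + 1"] rF'[of u "int n - q" p] rF'[of u "int n - q" "p + 1"]
      by (cases p q rule: linorder_cases) auto
  next
    fix p q u assume "u \<in> F q" "p < q"
    then show "pr p *v u = 0" unfolding pr using rF[of u q p] rF[of u q "p + 1"] by simp
  qed
  then show ?thesis by blast
qed

lemma sum_matrix_vec:
  fixes A :: "'i \<Rightarrow> complex ^ 'v ^ 'v"
  shows "(\<Sum>p\<in>S. A p) *v u = (\<Sum>p\<in>S. A p *v u)"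
  by (induction S rule: infinite_finite_induct) (auto simp: matrix_vector_mult_add_rdistrib)

lemma hodge_circle_eq:
  fixes F :: "(complex ^ 'v) filtration"
  assumes "hodge_projectors n F pr"
  shows "hodge_circle n F z = (\<Sum>p\<in>{0..int n}. mscale (z powi (2 * p - int n)) (pr p))"
  unfolding hodge_circle_def
proof (rule the_equality)
  note pr = hodge_projectorsD[OF assms]
  have dec: "(\<Sum>p\<in>{0..int n}. pr p *v u) = u" for u using pr(1) sum_matrix_vec[of pr "{0..int n}" u] by simp
  \<comment> \<open>Pieces with index outside {0..n} are zero, so the condition that the definite
    description imposes on them holds trivially.\<close>
  have out: "u = 0" if "u \<in> hodge_piece F r (int n - r)" "r \<notin> {0..int n}" for u r
    using dec[of u] that(2) unfolding pr(3)[OF that(1)] by (simp add: sum.delta split: if_splits)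
  show "\<forall>p q. p + q = int n \<longrightarrow> (\<forall>u\<in>hodge_piece F p q.
      (\<Sum>p\<in>{0..int n}. mscale (z powi (2 * p - int n)) (pr p)) *v u = (z powi (p - q)) *s u)"
  proof (intro allI impI ballI)
    fix r q u assume rq: "r + q = int n" and "u \<in> hodge_piece F r q"
    moreover have q: "q = int n - r" using rq by simp
    ultimately have u: "u \<in> hodge_piece F r (int n - r)" by simp
    have "(\<Sum>p\<in>{0..int n}. mscale (z powi (2 * p - int n)) (pr p)) *v u =
        (\<Sum>p\<in>{0..int n}. if p = r then (z powi (2 * r - int n)) *s u else 0)"
      unfolding sum_matrix_vec mscale_vec by (intro sum.cong) (auto simp: pr(3)[OF u])
    also have "\<dots> = (z powi (r - q)) *s u"
      using out[OF u] by (simp add: sum.delta q)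
    finally show "(\<Sum>p\<in>{0..int n}. mscale (z powi (2 * p - int n)) (pr p)) *v u = (z powi (r - q)) *s u" .
  qed
  fix A assume A: "\<forall>p q. p + q = int n \<longrightarrow> (\<forall>u\<in>hodge_piece F p q. A *v u = (z powi (p - q)) *s u)"
  have AP: "A *v (pr p *v u) = (z powi (2 * p - int n)) *s (pr p *v u)" for p u
    using A[rule_format, of p "int n - p" "pr p *v u"] pr(2) by simp
  show "A = (\<Sum>p\<in>{0..int n}. mscale (z powi (2 * p - int n)) (pr p))"
    unfolding matrix_eq
  proof
    fix u
    have "A *v u = A *v (\<Sum>p\<in>{0..int n}. pr p *v u)" by (simp add: dec)
    also have "\<dots> = (\<Sum>p\<in>{0..int n}. A *v (pr p *v u))"
      by (simp add: vec.linear_sum[OF matrix_vector_mul_linear_gen])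
    also have "\<dots> = (\<Sum>p\<in>{0..int n}. mscale (z powi (2 * p - int n)) (pr p)) *v u"
      unfolding AP by (simp add: sum_matrix_vec mscale_vec)
    finally show "A *v u = \<dots>" .
  qed
qed

lemma hodge_circle_vec:
  fixes F :: "(complex ^ 'v) filtration"
  assumes "hodge_structure n F"
  shows "\<exists>pr. (\<forall>u. (\<Sum>p\<in>{0..int n}. pr p *v u) = u) \<and>
      (\<forall>z p u. hodge_circle n F z *v (pr p *v u) = (z powi (2 * p - int n)) *s (pr p *v u))"
proof -
  obtain pr where P: "hodge_projectors n F pr" using hodge_projectors_exist[OF assms] by blast
  note pr = hodge_projectorsD[OF P]
  have dec: "(\<Sum>p\<in>{0..int n}. pr p *v u) = u" for u using pr(1) sum_matrix_vec[of pr "{0..int n}" u] by simp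
  have "hodge_circle n F z *v (pr p *v u) = (z powi (2 * p - int n)) *s (pr p *v u)" for z p u
  proof (cases "p \<in> {0..int n}")
    case True
    have "hodge_circle n F z *v (pr p *v u) =
        (\<Sum>r\<in>{0..int n}. if r = p then (z powi (2 * p - int n)) *s (pr p *v u) else 0)"
      unfolding hodge_circle_eq[OF P] sum_matrix_vec mscale_vec
      by (intro sum.cong) (auto simp: pr(3)[OF pr(2)])
    then show ?thesis using True by (simp add: sum.delta)
  next
    case False
    then have "pr p *v u = 0" using dec[of "pr p *v u"] unfolding pr(3)[OF pr(2)] by (simp add: sum.delta split: if_splits)
    then show ?thesis by simp
  qed
  then show ?thesis using dec by blast
qed

lemma invertible_hodge_circle:
  fixes F :: "(complex ^ 'v) filtration"
  assumes F: "hodge_structure n F" and z: "z \<noteq> 0"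
  shows "invertible (hodge_circle n F z)"
proof -
  obtain pr where pr: "\<And>u. (\<Sum>p\<in>{0..int n}. pr p *v u) = u"
    "\<And>z p u. hodge_circle n F z *v (pr p *v u) = (z powi (2 * p - int n)) *s (pr p *v u)"
    using hodge_circle_vec[OF F] by blast
  have inv: "hodge_circle n F w ** hodge_circle n F (inverse w) = mat 1" if w: "w \<noteq> 0" for w
    unfolding matrix_eq
  proof
    fix u
    let ?A = "hodge_circle n F w ** hodge_circle n F (inverse w)"
    have "?A *v u = (\<Sum>p\<in>{0..int n}. ?A *v (pr p *v u))"
      by (subst pr(1)[of u, symmetric]) (simp only: vec.linear_sum[OF matrix_vector_mul_linear_gen])
    also have "\<dots> = (\<Sum>p\<in>{0..int n}. pr p *v u)"
      using w by (intro sum.cong) (auto simp: pr(2) power_int_inverse simp flip: matrix_vector_mul_assoc)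
    finally show "?A *v u = mat 1 *v u" by (simp add: pr(1))
  qed
  show ?thesis using inv[of z] inv[of "inverse z"] z by (auto simp: invertible_def)
qed

lemma mumford_tate_group_invertible:
  assumes "hodge_structure n F" "A \<in> mumford_tate_group n F"
  shows "invertible A"
proof -
  have "hodge_circle n F z \<in> {A. invertible A}" if "norm z = 1" for z
  proof -
    have "z \<noteq> 0" using that by auto
    then show ?thesis using invertible_hodge_circle[OF assms(1)] by simp
  qed
  then have "A \<in> {A. invertible A}"
    using assms(2)[unfolded mumford_tate_group_def] rational_algebraic_group_GL
    by (elim InterD) simp
  then show ?thesis by simp
qed

text \<open>The derivative of the Hodge circle at the identity is a multiple of the operator which acts on
  \<open>V\<^sup>p\<^sup>,\<^sup>q\<close> as \<open>p - n/2 = (p - q)/2\<close>.\<close>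

lemma hodge_grading_element:
  fixes F :: "(complex ^ 'v) filtration"
  assumes F: "hodge_structure n F"
  obtains E where "E \<in> lie_algebra (mumford_tate_group n F)"
    "\<And>p u. u \<in> F p \<Longrightarrow> E *v u - (of_int p - of_nat n / 2) *s u \<in> F (p + 1)"
proof -
  obtain pr where P: "hodge_projectors n F pr" using hodge_projectors_exist[OF assms] by blast
  note pr = hodge_projectorsD[OF P]
  define E where "E = (\<Sum>p\<in>{0..int n}. mscale (of_int p - of_nat n / 2) (pr p))"
  \<comment> \<open>The exponential makes the curve holomorphic in t; for real t it runs through the
    Hodge circle at z = exp (i t). Since 2p - n = 2 (p - n/2), its derivative at 0 is 2i times
    \<open>E\<close>.\<close>
  define \<gamma> where "\<gamma> t = (\<Sum>p\<in>{0..int n}. mscale (exp (of_int (2 * p - int n) * (\<i> * t))) (pr p))" for t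
  have entry: "(\<Sum>p\<in>S. A p) $ i $ j = (\<Sum>p\<in>S. A p $ i $ j)" for S i j and A :: "int \<Rightarrow> complex ^ 'v ^ 'v"
    by (induction S rule: infinite_finite_induct) auto
  have "mscale (2 * \<i>) E \<in> lie_algebra (mumford_tate_group n F)"
  proof (rule lie_algebra_curve)
    show "\<gamma> 0 = mat 1" using pr(1) by (simp add: \<gamma>_def)
    show "\<gamma> (of_real t) \<in> mumford_tate_group n F" for t :: real
    proof -
      have "\<gamma> (of_real t) = hodge_circle n F (exp (\<i> * of_real t))"
        unfolding hodge_circle_eq[OF P] \<gamma>_def exp_power_int ..
      then show ?thesis by (simp add: hodge_circle_in_mumford_tate_group)
    qed
    show "((\<lambda>t. \<gamma> t $ i $ j) has_field_derivative mscale (2 * \<i>) E $ i $ j) (at 0)" for i j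
      unfolding \<gamma>_def E_def entry mscale_entry sum_distrib_left
      by (rule derivative_eq_intros refl)+ (auto simp: algebra_simps intro!: sum.cong)
  qed
  then have "mscale (1 / (2 * \<i>)) (mscale (2 * \<i>) E) \<in> lie_algebra (mumford_tate_group n F)"
    using cmat.subspace_scale[OF subspace_lie_algebra] by blast
  then have "E \<in> lie_algebra (mumford_tate_group n F)" by simp
  moreover have "E *v u - (of_int p - of_nat n / 2) *s u \<in> F (p + 1)" if u: "u \<in> F p" for p u
  proof -
    have sub: "vec.subspace (F p)" and anti: "p \<le> q \<Longrightarrow> F q \<subseteq> F p" for p q
      using F unfolding hodge_structure_def monotone_def by blast+
    have "(\<Sum>r\<in>{0..int n}. pr r *v u) = u" using pr(1) sum_matrix_vec[of pr "{0..int n}" u] by simp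
    then have "E *v u - (of_int p - of_nat n / 2) *s u =
        (\<Sum>r\<in>{0..int n}. (of_int r - of_nat n / 2) *s (pr r *v u)) -
        (of_int p - of_nat n / 2) *s (\<Sum>r\<in>{0..int n}. pr r *v u)"
      by (simp add: E_def sum_matrix_vec mscale_vec)
    also have "\<dots> = (\<Sum>r\<in>{0..int n}. (of_int r - of_int p) *s (pr r *v u))"
      unfolding vec.scale_sum_right sum_subtractf[symmetric] vec.scale_left_diff_distrib[symmetric] by simp
    also have "\<dots> \<in> F (p + 1)"
    proof (intro vec.subspace_sum sub)
      fix r
      \<comment> \<open>Components below p vanish on F^p, the one at p is killed by its coefficient,
        and the others lie in F^{p+1}.\<close>
      consider "r < p" | "r = p" | "p + 1 \<le> r" by linarith
      then show "(of_int r - of_int p) *s (pr r *v u) \<in> F (p + 1)"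
      proof cases
        case 3
        have "pr r *v u \<in> F r" using pr(2) unfolding hodge_piece_def by blast
        then show ?thesis using anti[OF 3] sub by (intro vec.subspace_scale) auto
      qed (use pr(4)[OF u] vec.subspace_0[OF sub] in auto)
    qed
    finally show ?thesis .
  qed
  ultimately show ?thesis using that by blast
qed

subsection \<open>Nondegeneracy of the trace form\<close>

text \<open>Meant for h(u, v) = Q(Cu, conj v). Hermitian symmetry is a consequence of positivity on
  the diagonal.\<close>

locale positive_form =
  fixes h :: "complex ^ 'v \<Rightarrow> complex ^ 'v \<Rightarrow> complex"
  assumes add_left: "h (u + v) w = h u w + h v w" and scale_left: "h (c *s u) w = c * h u w"
    and add_right: "h w (u + v) = h w u + h w v" and scale_right: "h w (c *s u) = cnj c * h w u"
    and positive: "u \<noteq> 0 \<Longrightarrow> h u u \<in> \<real> \<and> Re (h u u) > 0"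
begin

lemma real_diag: "cnj (h u u) = h u u"
proof (cases "u = 0")
  case True
  then show ?thesis using scale_left[of 0 0 0] by simp
qed (use positive Reals_cnj_iff in blast)

lemma hermitian: "h v u = cnj (h u v)"
proof -
  have "cnj (h u v + h v u) = h u v + h v u"
    using real_diag[of "u + v"] real_diag[of u] real_diag[of v] by (simp add: add_left add_right algebra_simps)
  moreover have "cnj (\<i> * h v u - \<i> * h u v) = \<i> * h v u - \<i> * h u v"
    using real_diag[of "u + \<i> *s v"] real_diag[of u] real_diag[of v]
    by (simp add: add_left add_right scale_left scale_right algebra_simps)
  ultimately show ?thesis
    by (auto simp: complex_eq_iff)
qed

lemma expand: "h u w = (\<Sum>j\<in>UNIV. u $ j * h (axis j 1) w)"
proof -
  have lin: "h (\<Sum>j\<in>J. u $ j *s axis j 1) w = (\<Sum>j\<in>J. u $ j * h (axis j 1) w)" for J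
    using scale_left[of 0 0]
    by (induction J rule: infinite_finite_induct) (simp_all add: add_left scale_left)
  have "(\<Sum>j\<in>UNIV. u $ j *s axis j 1) = u" by (simp add: basis_expansion)
  then show ?thesis using lin[of UNIV] by simp
qed

text \<open>Gram--Schmidt by counting: orthogonality to \<open>e i\<close> for
  \<open>i \<in> S\<close> is a square linear system \<open>M\<close> whose row \<open>k\<close> is
  zero since \<open>k\<close> is not in \<open>S\<close>, so it has a nonzero solution. Indexing by
  the coordinates of the space makes the full family a basis.\<close>

lemma orthonormal_exists:
  "\<exists>e. \<forall>i\<in>S. \<forall>j\<in>S. h (e i) (e j) = (if i = (j::'v) then 1 else 0)"
proof (induction S rule: infinite_finite_induct)
  case (insert k S)
  then obtain e where e: "\<And>i j. i \<in> S \<Longrightarrow> j \<in> S \<Longrightarrow> h (e i) (e j) = (if i = j then 1 else 0)" by blast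
  define M :: "complex ^ 'v ^ 'v" where "M = (\<chi> i j. if i \<in> S then h (axis j 1) (e i) else 0)"
  have "\<exists>u. u \<noteq> 0 \<and> M *v u = 0"
  proof (rule ccontr)
    assume "\<not> (\<exists>u. u \<noteq> 0 \<and> M *v u = 0)"
    then obtain B where "B ** M = mat 1" using matrix_left_invertible_ker by blast
    then have "M ** B = mat 1" by (simp add: matrix_left_right_inverse)
    then have "(M ** B) $ k $ k = 1" by (simp add: mat_def)
    then show False using insert.hyps by (simp add: matrix_matrix_mult_def M_def)
  qed
  then obtain u where u: "u \<noteq> 0" "M *v u = 0" by blast
  have orth: "h u (e i) = 0" if "i \<in> S" for i
  proof -
    have "(M *v u) $ i = h u (e i)"
      using that expand[of u "e i"] by (simp add: matrix_vector_mult_def M_def mult.commute)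
    then show ?thesis using u by simp
  qed
  define a where "a = Re (h u u)"
  have a: "a > 0" "h u u = of_real a" using positive[OF u(1)] by (auto simp: a_def)
  define v where "v = of_real (1 / sqrt a) *s u"
  have "h v v = 1"
    using a by (simp add: v_def scale_left scale_right flip: of_real_mult)
  moreover have "h v (e i) = 0" "h (e i) v = 0" if "i \<in> S" for i
    using orth[OF that] hermitian[of u "e i"] by (simp_all add: v_def scale_left scale_right)
  ultimately show ?case
    using e insert.hyps by (intro exI[of _ "e(k := v)"]) auto
qed auto

lemma trace_orthonormal:
  assumes e: "\<And>i j. h (e i) (e j) = (if i = (j::'v) then 1 else 0)"
  shows "trace A = (\<Sum>i\<in>UNIV. h (A *v e i) (e i))"
    and "(\<And>i. A *v e i = 0) \<Longrightarrow> A = 0"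
proof -
  define B :: "complex ^ 'v ^ 'v" where "B = (\<chi> k i. e i $ k)"
  \<comment> \<open>\<open>B\<close> has the vectors \<open>e i\<close> as columns and
    \<open>B'\<close> computes the coefficients with respect to them, so the two are inverse to each
    other.\<close>
  define B' :: "complex ^ 'v ^ 'v" where "B' = (\<chi> i k. h (axis k 1) (e i))"
  have B': "(B' *v u) $ i = h u (e i)" for u i
    using expand[of u "e i"] by (simp add: matrix_vector_mult_def B'_def mult.commute)
  have col: "(M ** B) $ i $ j = (M *v e j) $ i" for M :: "complex ^ 'v ^ 'v" and i j
    by (simp add: matrix_matrix_mult_def matrix_vector_mult_def B_def)
  have "B' ** B = mat 1"
    using e by (auto simp: vec_eq_iff col B' mat_def)
  then have BB': "B ** B' = mat 1" by (simp add: matrix_left_right_inverse)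
  have "trace A = trace (A ** (B ** B'))" using BB' by simp
  also have "\<dots> = trace (B' ** A ** B)"
    by (metis matrix_mul_assoc trace_mul_sym)
  also have "\<dots> = (\<Sum>i\<in>UNIV. h (A *v e i) (e i))"
    by (simp add: trace_def col B' flip: matrix_vector_mul_assoc)
  finally show "trace A = (\<Sum>i\<in>UNIV. h (A *v e i) (e i))" .
  assume "\<And>i. A *v e i = 0"
  then have "A ** B = 0" by (simp add: vec_eq_iff col)
  then have "A ** B ** B' = 0" by simp
  then show "A = 0" using BB' by (simp flip: matrix_mul_assoc)
qed

text \<open>In an orthonormal basis the trace of \<open>X ** X'\<close> is the sum of h(X' e_i, X'
  e_i), whose terms are all nonnegative.\<close>

lemma adjoint_trace_zero:
  assumes adj: "\<And>u w. h (X *v u) w = h u (X' *v w)" and zero: "trace (X ** X') = 0"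
  shows "X' = 0"
proof -
  obtain e where e: "\<And>i j. h (e i) (e j) = (if i = (j::'v) then 1 else 0)"
    using orthonormal_exists[of UNIV] by auto
  let ?w = "\<lambda>i. X' *v e i"
  have nonneg: "Re (h u u) \<ge> 0" for u
    using positive[of u] scale_left[of 0 0 0] by (cases "u = 0") auto
  have "(\<Sum>i\<in>UNIV. Re (h (?w i) (?w i))) = Re (\<Sum>i\<in>UNIV. h ((X ** X') *v e i) (e i))"
    by (simp add: adj flip: matrix_vector_mul_assoc)
  also have "\<dots> = 0" using trace_orthonormal(1)[OF e, of "X ** X'"] zero by simp
  finally have "\<forall>i. Re (h (?w i) (?w i)) = 0"
    using nonneg by (simp add: sum_nonneg_eq_0_iff)
  then have w0: "?w i = 0" for i using positive[of "?w i"] by auto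
  then show ?thesis by (rule trace_orthonormal(2)[OF e])
qed

end

section \<open>Powers of a matrix\<close>

lemma mpow_0 [simp]: "mpow A 0 = mat 1"
  by (simp add: mpow_def)

lemma mpow_Suc: "mpow A (Suc k) = A ** mpow A k"
  by (simp add: mpow_def)

lemma mpow_add: "mpow A (j + k) = mpow A j ** mpow A k"
  by (induction j) (simp_all add: mpow_Suc matrix_mul_assoc)

lemma mpow_Suc_right: "mpow A (Suc k) = mpow A k ** A"
  using mpow_add[of A k 1] by (simp add: mpow_Suc)

lemma mpow_zero_mono: "mpow A j *v u = 0 \<Longrightarrow> j \<le> k \<Longrightarrow> mpow A k *v u = 0"
  using mpow_add[of A "k - j" j] by (simp flip: matrix_vector_mul_assoc)

subsection \<open>Filtrations on Lie algebras of matrices\<close>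

locale matrix_lie_algebra =
  fixes \<gg> :: "(complex ^ 'v ^ 'v) set"
  assumes subspace: "cmat.subspace \<gg>"
    and bracket: "X \<in> \<gg> \<Longrightarrow> Y \<in> \<gg> \<Longrightarrow> lie_bracket X Y \<in> \<gg>"
begin

text \<open>For \<open>F\<close> this is the adjoint Hodge filtration; for
  \<open>\<lambda>m. W (- m)\<close>, with \<open>W\<close> complexified, it is the complexified
  adjoint weight filtration in reversed index.\<close>

definition lift :: "(complex ^ 'v) filtration \<Rightarrow> (complex ^ 'v ^ 'v) filtration" where
  "lift \<Phi> m = {X \<in> \<gg>. \<forall>q. \<forall>u \<in> \<Phi> q. X *v u \<in> \<Phi> (m + q)}"

lemma liftD: "X \<in> lift \<Phi> m \<Longrightarrow> X \<in> \<gg>" "X \<in> lift \<Phi> m \<Longrightarrow> u \<in> \<Phi> q \<Longrightarrow> X *v u \<in> \<Phi> (m + q)"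
  by (auto simp: lift_def)

lemma liftI: "X \<in> \<gg> \<Longrightarrow> (\<And>q u. u \<in> \<Phi> q \<Longrightarrow> X *v u \<in> \<Phi> (m + q)) \<Longrightarrow> X \<in> lift \<Phi> m"
  by (auto simp: lift_def)

lemma lift_filtration:
  assumes \<Phi>: "cvec.finite_filtration UNIV \<Phi>"
  shows "cmat.finite_filtration \<gg> (lift \<Phi>)"
proof -
  note D = cvec.finite_filtrationD[OF \<Phi>]
  obtain a b where a: "\<And>m. m \<le> a \<Longrightarrow> \<Phi> m = UNIV" and b: "\<And>m. m \<ge> b \<Longrightarrow> \<Phi> m = {0}"
    using D(5,6) by blast
  have sub: "cmat.subspace (lift \<Phi> m)" for m
  proof (rule cmat.subspaceI)
    show "0 \<in> lift \<Phi> m"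
      using cmat.subspace_0[OF subspace] vec.subspace_0[OF D(1)] by (auto intro!: liftI)
    show "x + y \<in> lift \<Phi> m" if "x \<in> lift \<Phi> m" "y \<in> lift \<Phi> m" for x y
    proof (rule liftI)
      show "x + y \<in> \<gg>" using that liftD(1) cmat.subspace_add[OF subspace] by blast
      show "(x + y) *v u \<in> \<Phi> (m + q)" if "u \<in> \<Phi> q" for q u
        using liftD(2)[OF \<open>x \<in> lift \<Phi> m\<close> that] liftD(2)[OF \<open>y \<in> lift \<Phi> m\<close> that]
        by (simp add: matrix_vector_mult_add_rdistrib vec.subspace_add[OF D(1)])
    qed
    show "mscale c x \<in> lift \<Phi> m" if "x \<in> lift \<Phi> m" for c x
    proof (rule liftI)
      show "mscale c x \<in> \<gg>" using that liftD(1) cmat.subspace_scale[OF subspace] by blast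
      show "mscale c x *v u \<in> \<Phi> (m + q)" if "u \<in> \<Phi> q" for q u
        using liftD(2)[OF \<open>x \<in> lift \<Phi> m\<close> that] by (simp add: mscale_vec vec.subspace_scale[OF D(1)])
    qed
  qed
  have "lift \<Phi> j \<subseteq> lift \<Phi> i" if "i \<le> j" for i j
  proof
    fix X assume X: "X \<in> lift \<Phi> j"
    show "X \<in> lift \<Phi> i"
    proof (rule liftI)
      show "X *v u \<in> \<Phi> (i + q)" if "u \<in> \<Phi> q" for q u
        using liftD(2)[OF X that] D(2)[of "i + q" "j + q"] \<open>i \<le> j\<close> by auto
    qed (use X liftD(1) in blast)
  qed
  \<comment> \<open>Shifting by a - b moves every index q < b below a, where \<open>\<Phi>\<close>
    is everything; for q \<ge> b only u = 0 has to be considered.\<close>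
  moreover have "lift \<Phi> (a - b) = \<gg>"
  proof -
    have "X *v u \<in> \<Phi> (a - b + q)" if "u \<in> \<Phi> q" for X u q
      using that a[of "a - b + q"] b[of q] vec.subspace_0[OF D(1)] by (cases "q \<ge> b") auto
    then show ?thesis by (auto simp: lift_def)
  qed
  moreover have "lift \<Phi> (b - a) = {0}"
  proof -
    have "X = 0" if "X \<in> lift \<Phi> (b - a)" for X
    proof -
      have "X *v u \<in> \<Phi> (b - a + a)" for u using liftD(2)[OF that, of u a] a by simp
      then have "X *v u = 0 *v u" for u using b by simp
      then show ?thesis by (subst matrix_eq) blast
    qed
    then show ?thesis using cmat.subspace_0[OF sub] by blast
  qed
  ultimately show ?thesis
    using sub liftD(1) unfolding cmat.finite_filtration_def monotone_def by blast
qed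

lemma lift_bracket:
  assumes \<Phi>: "cvec.finite_filtration UNIV \<Phi>" and X: "X \<in> lift \<Phi> i" and Y: "Y \<in> lift \<Phi> j"
  shows "lie_bracket X Y \<in> lift \<Phi> (i + j)"
proof (rule liftI)
  show "lie_bracket X Y \<in> \<gg>" using X Y liftD(1) bracket by blast
  fix q u assume u: "u \<in> \<Phi> q"
  have "X *v (Y *v u) \<in> \<Phi> (i + j + q)" "Y *v (X *v u) \<in> \<Phi> (i + j + q)"
    using liftD(2)[OF X liftD(2)[OF Y u]] liftD(2)[OF Y liftD(2)[OF X u]] by (simp_all add: ac_simps)
  then have "X *v (Y *v u) - Y *v (X *v u) \<in> \<Phi> (i + j + q)"
    using cvec.finite_filtrationD(1)[OF \<Phi>] vec.subspace_diff by blast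
  then show "lie_bracket X Y *v u \<in> \<Phi> (i + j + q)"
    by (simp add: lie_bracket_def matrix_vector_mult_diff_rdistrib matrix_vector_mul_assoc)
qed

text \<open>The slope \<open>l\<close> is 1 for a Hodge filtration and -1/2 for a weight filtration
  in reversed index. Commutators do not see the offset \<open>c\<close>; it matters when gradings
  are compared on the space itself.\<close>

definition grades :: "complex ^ 'v ^ 'v \<Rightarrow> complex \<Rightarrow> complex \<Rightarrow> (complex ^ 'v) filtration \<Rightarrow> bool" where
  "grades T l c \<Phi> \<longleftrightarrow> cvec.finite_filtration UNIV \<Phi> \<and> T \<in> \<gg> \<and> l \<noteq> 0 \<and>
     (\<forall>m. \<forall>u \<in> \<Phi> m. T *v u - (l * of_int m + c) *s u \<in> \<Phi> (m + 1))"

lemma gradesD: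
  assumes "grades T l c \<Phi>"
  shows "cvec.finite_filtration UNIV \<Phi>" "T \<in> \<gg>" "l \<noteq> 0"
    "u \<in> \<Phi> m \<Longrightarrow> T *v u - (l * of_int m + c) *s u \<in> \<Phi> (m + 1)"
  using assms by (auto simp: grades_def)

text \<open>A commutator acts by differences of eigenvalues: an element of degree m takes degree q
  to m + q, where the scalar of \<open>T\<close> is larger by l m, and the offset \<open>c\<close>
  cancels.\<close>

lemma grades_lift:
  assumes T: "grades T l c \<Phi>" and X: "X \<in> lift \<Phi> m"
  shows "lie_bracket T X - mscale (l * of_int m) X \<in> lift \<Phi> (m + 1)"
proof (rule liftI)
  note G = gradesD[OF T]
  note sub = cvec.finite_filtrationD(1)[OF G(1)]
  show "lie_bracket T X - mscale (l * of_int m) X \<in> \<gg>"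
    using G(2) liftD(1)[OF X] bracket subspace by (intro cmat.subspace_diff cmat.subspace_scale)
  fix q u assume u: "u \<in> \<Phi> q"
  have "X *v u \<in> \<Phi> (m + q)" using liftD(2)[OF X u] .
  then have 1: "T *v (X *v u) - (l * of_int (m + q) + c) *s (X *v u) \<in> \<Phi> (m + q + 1)" by (rule G(4))
  have 2: "X *v (T *v u - (l * of_int q + c) *s u) \<in> \<Phi> (m + q + 1)"
    using liftD(2)[OF X G(4)[OF u]] unfolding add.assoc .
  have "(lie_bracket T X - mscale (l * of_int m) X) *v u =
      (T *v (X *v u) - (l * of_int (m + q) + c) *s (X *v u)) - X *v (T *v u - (l * of_int q + c) *s u)"
    by (simp add: lie_bracket_def matrix_vector_mult_diff_rdistrib matrix_vector_mul_assoc mscale_vec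
        matrix_vector_mult_diff_distrib algebra_simps)
  also have "\<dots> \<in> \<Phi> (m + q + 1)"
    by (rule vec.subspace_diff[OF sub 1 2])
  finally show "(lie_bracket T X - mscale (l * of_int m) X) *v u \<in> \<Phi> (m + 1 + q)"
    by (simp add: ac_simps)
qed

lemma lift_decompose:
  assumes T: "grades T l c \<Phi>" and X: "X \<in> lift \<Phi> m"
  shows "\<exists>Y \<in> lift \<Phi> m. lie_bracket T Y = mscale (l * of_int m) Y \<and> X - Y \<in> lift \<Phi> (m + 1)"
    and "X \<in> cmat.span {Y. \<exists>j\<ge>m. Y \<in> lift \<Phi> j \<and> lie_bracket T Y = mscale (l * of_int j) Y}"
proof -
  have "inj (\<lambda>m. l * of_int m)" using gradesD(3)[OF T] by (auto intro!: injI)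
  note dec = cmat.graded_part_exists[OF lift_filtration[OF gradesD(1)[OF T]] lie_bracket_linear(1,2) this grades_lift[OF T] X]
  show "\<exists>Y \<in> lift \<Phi> m. lie_bracket T Y = mscale (l * of_int m) Y \<and> X - Y \<in> lift \<Phi> (m + 1)"
    and "X \<in> cmat.span {Y. \<exists>j\<ge>m. Y \<in> lift \<Phi> j \<and> lie_bracket T Y = mscale (l * of_int j) Y}"
    using dec by blast+
qed

end

section \<open>Vanishing of traces\<close>

lemma trace_eigen:
  assumes "lie_bracket T Y = mscale a Y" "a \<noteq> 0"
  shows "trace Y = 0"
proof -
  have "trace (lie_bracket T Y) = 0" using trace_mul_sym[of T Y] by (simp add: lie_bracket_def trace_sub)
  then show ?thesis using assms by (simp add: trace_mscale)
qed

lemma trace_span_zero: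
  assumes "X \<in> cmat.span S" "\<And>Y. Y \<in> S \<Longrightarrow> trace (Z ** Y) = 0"
  shows "trace (Z ** X) = 0"
  using assms(1)
proof (induction rule: cmat.span_induct_alt)
  case base
  show ?case by (simp add: trace_def)
next
  case (step c x y)
  then show ?case by (simp add: matrix_mult_add_distrib trace_add mscale_mult trace_mscale assms(2))
qed

lemma projection_exists:
  fixes S :: "(complex ^ 'v) set"
  assumes "vec.subspace S"
  shows "\<exists>P :: complex ^ 'v ^ 'v. (\<forall>u. P *v u \<in> S) \<and> (\<forall>u\<in>S. P *v u = u)"
proof -
  obtain g where g: "range g \<subseteq> S" "Vector_Spaces.linear (*s) (*s) g" "\<forall>v\<in>S. g (id v) = v"
    using vec.linear_exists_left_inverse_on[OF vec.linear_id assms, of] by auto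
  then show ?thesis
    using matrix_works[OF g(2)] by (intro exI[of _ "matrix g"]) auto
qed

text \<open>The sum of projections onto the steps of a filtration grades it.\<close>

lemma grading_exists:
  fixes \<Phi> :: "(complex ^ 'v) filtration"
  assumes \<Phi>: "cvec.finite_filtration UNIV \<Phi>"
  shows "\<exists>T c. \<forall>m. \<forall>u \<in> \<Phi> m. T *v u - (1 * of_int m + c) *s u \<in> \<Phi> (m + 1)"
proof -
  note D = cvec.finite_filtrationD[OF \<Phi>]
  obtain a b where a: "\<And>m. m \<le> a \<Longrightarrow> \<Phi> m = UNIV" and b: "\<And>m. m \<ge> b \<Longrightarrow> \<Phi> m = {0}"
    using D(5,6) by blast
  obtain P :: "int \<Rightarrow> complex ^ 'v ^ 'v" where P: "\<And>m u. P m *v u \<in> \<Phi> m" "\<And>m u. u \<in> \<Phi> m \<Longrightarrow> P m *v u = u"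
    using projection_exists[OF D(1)] by metis
  \<comment> \<open>Modulo the next step, on \<open>\<Phi> m\<close> the projections with index up
    to m are the identity and the later ones vanish. So \<open>T\<close> counts the indices in (a,
    m], and its scalar is m - a.\<close>
  define T where "T = (\<Sum>m\<in>{a<..b}. P m)"
  have T: "T *v u = (\<Sum>m\<in>{a<..b}. P m *v u)" for u
    unfolding T_def by (induction rule: infinite_finite_induct[of _ "{a<..b}"]) (auto simp: matrix_vector_mult_add_rdistrib)
  have "T *v u - (of_int m - of_int a) *s u \<in> \<Phi> (m + 1)" if u: "u \<in> \<Phi> m" for m u
  proof -
    consider "m < a" | "m \<ge> b" | "a \<le> m" "m < b" by linarith
    then show ?thesis
    proof cases
      case 1
      then show ?thesis using a[of "m + 1"] by simp
    next
      case 2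
      then have "u = 0" using u b by simp
      then show ?thesis using vec.subspace_0[OF D(1)] by simp
    next
      case 3
      have "{a<..b} = {a<..m} \<union> {m<..b}" using 3 by auto
      then have "T *v u = (\<Sum>j\<in>{a<..m}. P j *v u) + (\<Sum>j\<in>{m<..b}. P j *v u)"
        unfolding T by (simp add: sum.union_disjoint)
      moreover have "(\<Sum>j\<in>{a<..m}. P j *v u) = (\<Sum>j\<in>{a<..m}. u)"
        using u D(2) by (intro sum.cong refl P(2)) auto
      moreover have "\<dots> = (of_int m - of_int a) *s u"
      proof -
        have "(\<Sum>j\<in>J. u) = of_nat (card J) *s u" if "finite J" for J :: "int set"
          using that by induction (simp_all add: vec.scale_left_distrib del: sum_constant)
        then have card: "(\<Sum>j\<in>{a<..m}. u) = of_nat (card {a<..m}) *s u" by blast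
        show ?thesis unfolding card using 3 by simp
      qed
      moreover have "(\<Sum>j\<in>{m<..b}. P j *v u) \<in> \<Phi> (m + 1)"
      proof (intro vec.subspace_sum D(1))
        fix j assume "j \<in> {m<..b}"
        then show "P j *v u \<in> \<Phi> (m + 1)" using P(1)[of j u] D(2)[of "m + 1" j] by auto
      qed
      ultimately show ?thesis by simp
    qed
  qed
  then have "\<forall>m. \<forall>u \<in> \<Phi> m. T *v u - (1 * of_int m + (- of_int a)) *s u \<in> \<Phi> (m + 1)" by simp
  then show ?thesis by blast
qed

text \<open>If \<open>T\<close> grades the filtration, such an \<open>A\<close> is a sum of
  eigenvectors of ad T with nonzero eigenvalues; each of them is a multiple of a commutator, hence
  traceless.\<close>

lemma trace_filtered_zero:
  fixes \<Phi> :: "(complex ^ 'v) filtration"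
  assumes \<Phi>: "cvec.finite_filtration UNIV \<Phi>" and A: "\<And>m u. u \<in> \<Phi> m \<Longrightarrow> A *v u \<in> \<Phi> (m + 1)"
  shows "trace A = 0"
proof -
  interpret matrix_lie_algebra UNIV by unfold_locales auto
  obtain T c where "\<forall>m. \<forall>u \<in> \<Phi> m. T *v u - (1 * of_int m + c) *s u \<in> \<Phi> (m + 1)"
    using grading_exists[OF \<Phi>] by blast
  then have T: "grades T 1 c \<Phi>" using \<Phi> unfolding grades_def by simp
  have "A \<in> lift \<Phi> 1" using A by (intro liftI) (auto simp: add.commute)
  then have A: "A \<in> cmat.span {Y. \<exists>j\<ge>1. Y \<in> lift \<Phi> j \<and> lie_bracket T Y = mscale (1 * of_int j) Y}"
    by (rule lift_decompose(2)[OF T])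
  have "trace (mat 1 ** A) = 0"
  proof (rule trace_span_zero[OF A])
    fix Y assume "Y \<in> {Y. \<exists>j\<ge>1. Y \<in> lift \<Phi> j \<and> lie_bracket T Y = mscale (1 * of_int j) Y}"
    then obtain j :: int where "j \<ge> 1" "lie_bracket T Y = mscale (of_int j) Y" by auto
    then show "trace (mat 1 ** Y) = 0" using trace_eigen[of T Y "of_int j"] by simp
  qed
  then show ?thesis by simp
qed

lemma trace_nilpotent:
  fixes A :: "complex ^ 'v ^ 'v"
  assumes "mpow A M = 0"
  shows "trace A = 0"
proof (rule trace_filtered_zero)
  \<comment> \<open>Kernels of decreasing powers. The truncation by \<open>nat\<close> makes the
    exponent 0 from index M on, so the filtration ends in 0.\<close>
  define \<Phi> where "\<Phi> m = {u. mpow A (nat (int M - m)) *v u = 0}" for m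
  have "vec.subspace (\<Phi> m)" for m
    by (rule vec.subspaceI) (auto simp: \<Phi>_def matrix_vector_right_distrib)
  moreover have "\<Phi> j \<subseteq> \<Phi> i" if "i \<le> j" for i j
    using that by (auto simp: \<Phi>_def intro: mpow_zero_mono)
  moreover have "\<Phi> 0 = UNIV" "\<Phi> (int M) = {0}" using assms by (auto simp: \<Phi>_def)
  ultimately show "cvec.finite_filtration UNIV \<Phi>"
    unfolding cvec.finite_filtration_def monotone_def by blast
  fix m u assume u: "u \<in> \<Phi> m"
  show "A *v u \<in> \<Phi> (m + 1)"
  proof (cases "m < int M")
    case True
    then have "nat (int M - m) = Suc (nat (int M - (m + 1)))" by auto
    then show ?thesis using u by (simp add: \<Phi>_def mpow_Suc_right matrix_vector_mul_assoc)
  next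
    case False
    then show ?thesis using u by (simp add: \<Phi>_def)
  qed
qed

text \<open>Since \<open>C\<close> commutes with \<open>N\<close>, the commutator with
  \<open>X\<close> differentiates powers of \<open>N\<close> as in one variable.\<close>

lemma mpow_commutator:
  fixes N X :: "complex ^ 'v ^ 'v"
  assumes C: "C = lie_bracket N X" and NC: "lie_bracket N C = 0"
  shows "mpow N (Suc j) ** X = X ** mpow N (Suc j) + mscale (of_nat (Suc j)) (C ** mpow N j)"
proof (induction j)
  case 0
  show ?case by (simp add: C lie_bracket_def mpow_Suc)
next
  case (Suc j)
  have 1: "N ** X = X ** N + C" by (simp add: C lie_bracket_def)
  have 2: "N ** C = C ** N" using NC by (simp add: lie_bracket_def)
  have "mpow N (Suc (Suc j)) ** X = N ** (mpow N (Suc j) ** X)"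
    by (simp add: mpow_Suc[of N "Suc j"] matrix_mul_assoc)
  also have "\<dots> = (N ** X) ** mpow N (Suc j) + mscale (of_nat (Suc j)) ((N ** C) ** mpow N j)"
    unfolding Suc by (simp only: matrix_mult_add_distrib mscale_mult matrix_mul_assoc)
  also have "\<dots> = X ** (N ** mpow N (Suc j)) + C ** mpow N (Suc j) + mscale (of_nat (Suc j)) (C ** (N ** mpow N j))"
    unfolding 1 2 by (simp only: matrix_mult_add_distrib matrix_mul_assoc)
  also have "\<dots> = X ** mpow N (Suc (Suc j)) + mscale (of_nat (Suc (Suc j))) (C ** mpow N (Suc j))"
    by (simp only: of_nat_Suc[of "Suc j"] cmat.scale_left_distrib cmat.scale_one mpow_Suc[symmetric] add.assoc)
  finally show ?case .
qed

text \<open>With \<open>C = [N, X]\<close>, the operator \<open>N X\<close> preserves \<open>ker N\<^sup>j\<close>, and it acts on the image of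
  \<open>N\<^sup>j\<^sup>-\<^sup>1 : ker N\<^sup>j \<rightarrow> ker N\<close> as \<open>j C\<close>. Moreover \<open>C\<close> is nilpotent on \<open>ker N\<close>, because it maps
  \<open>ker N \<inter> im N\<^sup>i\<close> to \<open>im N\<^sup>i\<^sup>+\<^sup>1\<close>. So \<open>N X\<close> is nilpotent.\<close>

lemma trace_mult_double_commutator:
  fixes N X :: "complex ^ 'v ^ 'v"
  assumes nil: "mpow N k = 0" and comm: "lie_bracket N (lie_bracket N X) = 0"
  shows "trace (N ** X) = 0"
proof -
  define C where "C = lie_bracket N X"
  have NC: "lie_bracket N C = 0" using comm C_def by simp
  have pw: "mpow N (Suc j) *v (X *v u) = X *v (mpow N (Suc j) *v u) + of_nat (Suc j) *s (C *v (mpow N j *v u))" for j u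
    using mpow_commutator[OF C_def NC, of j]
    by (metis (no_types, lifting) matrix_vector_mul_assoc matrix_vector_mult_add_rdistrib mscale_vec)
  have NCv: "N *v (C *v u) = C *v (N *v u)" for u
    using NC by (simp add: lie_bracket_def matrix_vector_mul_assoc)
  have CN0: "N *v (mpow C i *v v) = 0" if "N *v v = 0" for i v
    using that by (induction i) (simp_all add: mpow_Suc NCv flip: matrix_vector_mul_assoc)
  have C_im: "\<exists>w. mpow C i *v v = mpow N i *v w" if v: "N *v v = 0" for i v
  proof (induction i)
    case 0
    show ?case by auto
  next
    case (Suc i)
    then obtain w where w: "mpow C i *v v = mpow N i *v w" by blast
    have "mpow N (Suc i) *v w = N *v (mpow C i *v v)" by (simp add: w mpow_Suc matrix_vector_mul_assoc)
    then have "mpow N (Suc i) *v w = 0" using CN0[OF v] by simp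
    then have "mpow N (Suc i) *v (X *v w) = of_nat (Suc i) *s (C *v (mpow C i *v v))"
      using pw[of i w] w by simp
    then have "(1 / of_nat (Suc i)) *s (mpow N (Suc i) *v (X *v w)) = C *v (mpow C i *v v)"
      by (simp del: of_nat_Suc)
    then have "mpow C (Suc i) *v v = mpow N (Suc i) *v ((1 / of_nat (Suc i)) *s (X *v w))"
      by (simp add: mpow_Suc[of C] mat_vec_linear flip: matrix_vector_mul_assoc)
    then show ?case by blast
  qed
  have Ck: "mpow C k *v v = 0" if v: "N *v v = 0" for v
  proof -
    obtain w where "mpow C k *v v = mpow N k *v w" using C_im[OF v] by blast
    then show ?thesis using nil by simp
  qed
  let ?A = "N ** X"
  have step: "mpow N (Suc j) *v (mpow ?A i *v u) = 0 \<and>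
      mpow N j *v (mpow ?A i *v u) = (of_nat (Suc j)) ^ i *s (mpow C i *v (mpow N j *v u))"
    if u: "mpow N (Suc j) *v u = 0" for i j u
  proof (induction i)
    case 0
    show ?case using u by simp
  next
    case (Suc i)
    let ?x = "mpow ?A i *v u"
    have Ax: "mpow ?A (Suc i) *v u = N *v (X *v ?x)"
      by (simp add: mpow_Suc matrix_vector_mul_assoc matrix_mul_assoc)
    have N1: "mpow N j *v (N *v y) = mpow N (Suc j) *v y" for y
      by (simp add: mpow_Suc_right matrix_vector_mul_assoc)
    have 1: "mpow N j *v (mpow ?A (Suc i) *v u) = of_nat (Suc j) *s (C *v (mpow N j *v ?x))"
      unfolding Ax N1 pw using Suc by simp
    also have "\<dots> = (of_nat (Suc j)) ^ Suc i *s (mpow C (Suc i) *v (mpow N j *v u))"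
      using Suc by (simp add: mpow_Suc del: of_nat_Suc flip: matrix_vector_mul_assoc)
    finally have 2: "mpow N j *v (mpow ?A (Suc i) *v u) = \<dots>" .
    have "mpow N (Suc j) *v (mpow ?A (Suc i) *v u) = N *v (of_nat (Suc j) *s (C *v (mpow N j *v ?x)))"
      unfolding 1[symmetric] by (simp add: mpow_Suc[of N j] matrix_mul_assoc matrix_vector_mul_assoc)
    also have "\<dots> = of_nat (Suc j) *s (C *v (mpow N (Suc j) *v ?x))"
      unfolding mpow_Suc[of N j] by (simp only: mat_vec_linear NCv flip: matrix_vector_mul_assoc)
    also have "\<dots> = 0" using Suc by simp
    finally show ?case using 2 by simp
  qed
  \<comment> \<open>k applications of \<open>N ** X\<close> take the kernel of N^{j+1} into that of
    N^j, because C^k vanishes on ker N; k such rounds exhaust the space.\<close>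
  have "mpow ?A (k * j) *v u = 0" if "mpow N j *v u = 0" for j u
    using that
  proof (induction j arbitrary: u)
    case (Suc j)
    have "N *v (mpow N j *v u) = 0" using Suc.prems by (simp add: mpow_Suc matrix_vector_mul_assoc)
    then have "mpow N j *v (mpow ?A k *v u) = 0" using step[OF Suc.prems, of k] Ck by simp
    from Suc.IH[OF this] show ?case
      using mpow_add[of ?A "k * j" k] by (simp add: matrix_vector_mul_assoc add.commute)
  qed simp
  then have "mpow ?A (k * k) *v u = 0 *v u" for u using nil by simp
  then have "mpow ?A (k * k) = 0" by (subst matrix_eq) blast
  then show ?thesis by (rule trace_nilpotent)
qed

section \<open>Duality for a nondegenerate trace form\<close>

locale trace_lie_algebra = matrix_lie_algebra \<gg> for \<gg> :: "(complex ^ 'v ^ 'v) set" +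
  assumes nondegenerate: "X \<in> \<gg> \<Longrightarrow> (\<And>Y. Y \<in> \<gg> \<Longrightarrow> trace (X ** Y) = 0) \<Longrightarrow> X = 0"
begin

text \<open>Invariance of the trace form makes eigenspaces of ad T orthogonal unless their degrees
  add to zero. If the degree m of \<open>X\<close> is below 1 - p, its leading part \<open>Z\<close>
  can pair only with degree -m \<ge> p, that is, with elements of \<open>lift \<Phi> p\<close>, to
  which \<open>X\<close> is orthogonal. Hence Z = 0 and the degree goes up by one.\<close>

lemma lift_orthogonal:
  assumes T: "grades T l c \<Phi>" and X: "X \<in> \<gg>" and perp: "\<And>Y. Y \<in> lift \<Phi> p \<Longrightarrow> trace (X ** Y) = 0"
  shows "X \<in> lift \<Phi> (1 - p)"
proof -
  note \<Phi> = gradesD(1)[OF T]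
  note D = cmat.finite_filtrationD[OF lift_filtration[OF \<Phi>]]
  let ?E = "\<lambda>m. {Y. \<exists>j\<ge>m. Y \<in> lift \<Phi> j \<and> lie_bracket T Y = mscale (l * of_int j) Y}"
  obtain a where a: "\<And>m. m \<le> a \<Longrightarrow> lift \<Phi> m = \<gg>" using D(5) by blast
  have eig: "trace (Z ** Y) = 0" if "lie_bracket T Z = mscale (l * of_int i) Z"
    "lie_bracket T Y = mscale (l * of_int j) Y" "i + j \<noteq> 0" for Z Y i j
  proof -
    have "l * of_int i * trace (Z ** Y) = - (l * of_int j * trace (Z ** Y))"
      using trace_lie_bracket_left[of T Z Y] that(1,2) by (simp add: mscale_mult trace_mscale)
    then have "l * of_int (i + j) * trace (Z ** Y) = 0" by (simp add: algebra_simps)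
    then show ?thesis using gradesD(3)[OF T] that(3) by (simp del: of_int_add)
  qed
  have step: "X \<in> lift \<Phi> (m + 1)" if Xm: "X \<in> lift \<Phi> m" and m: "m < 1 - p" for m
  proof -
    obtain Z where Z: "Z \<in> lift \<Phi> m" "lie_bracket T Z = mscale (l * of_int m) Z" "X - Z \<in> lift \<Phi> (m + 1)"
      using lift_decompose(1)[OF T Xm] by blast
    have "Z = 0"
    proof (rule nondegenerate)
      show "Z \<in> \<gg>" using Z(1) liftD(1) by blast
      fix Y assume "Y \<in> \<gg>"
      then have "Y \<in> cmat.span (?E a)" using lift_decompose(2)[OF T] a by blast
      then show "trace (Z ** Y) = 0"
      proof (rule trace_span_zero)
        fix Y assume "Y \<in> ?E a"
        then obtain j where j: "Y \<in> lift \<Phi> j" "lie_bracket T Y = mscale (l * of_int j) Y" by blast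
        show "trace (Z ** Y) = 0"
        proof (cases "m + j = 0")
          case True
          then have "Y \<in> lift \<Phi> p" using j(1) m D(2)[of p j] by auto
          then have "trace (X ** Y) = 0" by (rule perp)
          \<comment> \<open>The rest X - Z has only degrees above m = -j, so it is orthogonal to
            \<open>Y\<close>, and \<open>Z\<close> and \<open>X\<close> pair with \<open>Y\<close>
            alike.\<close>
          moreover have "trace (Y ** (X - Z)) = 0"
          proof (rule trace_span_zero[OF lift_decompose(2)[OF T Z(3)]])
            fix Y' assume "Y' \<in> ?E (m + 1)"
            then obtain i where "i \<ge> m + 1" "lie_bracket T Y' = mscale (l * of_int i) Y'" by blast
            then show "trace (Y ** Y') = 0" using eig[OF j(2), of Y' i] True by simp
          qed
          then have "trace (X ** Y) - trace (Z ** Y) = 0"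
            using trace_mul_sym[of Y "X - Z"] by (simp add: matrix_mult_add_distrib trace_sub)
          ultimately show ?thesis by simp
        qed (rule eig[OF Z(2) j(2)])
      qed
    qed
    then show ?thesis using Z(3) by simp
  qed
  have "X \<in> lift \<Phi> m" if "m \<le> 1 - p" for m
    using that
  proof (induction m rule: int_up_induct[where b = a])
    case (base m)
    then show ?case using a X by blast
  next
    case (step m)
    then show ?case using \<open>\<And>m. X \<in> lift \<Phi> m \<Longrightarrow> m < 1 - p \<Longrightarrow> X \<in> lift \<Phi> (m + 1)\<close>[of "m - 1"] by simp
  qed
  then show ?thesis by simp
qed

text \<open>A dual basis: a basis of \<open>S\<close> together with \<open>Z\<close> extends to a
  basis \<open>B\<close> of \<gg>. The map sending X to the combination of \<open>B\<close> with
  coefficients trace (X b) is injective by nondegeneracy, hence onto, and a preimage of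
  \<open>Z\<close> pairs to 1 with \<open>Z\<close> and to 0 with the rest of
  \<open>B\<close>.\<close>

lemma trace_separation:
  assumes S: "cmat.subspace S" "S \<subseteq> \<gg>" and Z: "Z \<in> \<gg>" "Z \<notin> S"
  shows "\<exists>X\<in>\<gg>. (\<forall>Y\<in>S. trace (X ** Y) = 0) \<and> trace (X ** Z) \<noteq> 0"
proof -
  obtain B0 where B0: "B0 \<subseteq> S" "cmat.independent B0" "S \<subseteq> cmat.span B0"
    using cmat.maximal_independent_subset[of S] by blast
  have "Z \<notin> cmat.span B0" using Z(2) cmat.span_minimal[OF B0(1) S(1)] by blast
  then have "cmat.independent (insert Z B0)" using B0(2) by (rule cmat.independent_insertI)
  then obtain B where B: "insert Z B0 \<subseteq> B" "B \<subseteq> \<gg>" "cmat.independent B" "\<gg> \<subseteq> cmat.span B"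
    using cmat.maximal_independent_subset_extend[of "insert Z B0" \<gg>] B0(1) S(2) Z(1) by blast
  \<comment> \<open>Dimensions are counted over the reals: complex independence implies real
    independence, and complex subspaces are real ones.\<close>
  have scaleR: "r *\<^sub>R A = mscale (of_real r) A" for r and A :: "complex ^ 'v ^ 'v"
    by (simp add: vec_eq_iff scaleR_conv_of_real[where 'a = complex])
  have real_sub: "subspace U" if "cmat.subspace U" for U :: "(complex ^ 'v ^ 'v) set"
    using that by (auto simp: subspace_def cmat.subspace_def scaleR)
  have "independent B"
  proof -
    have "span (B - {b}) \<subseteq> cmat.span (B - {b})" for b
      by (intro span_minimal real_sub cmat.subspace_span cmat.span_superset)
    then show ?thesis using B(3) unfolding dependent_def cmat.dependent_def by blast
  qed
  then have fin: "finite B" by (rule independent_imp_finite)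
  define f where "f X = (\<Sum>b\<in>B. mscale (trace (X ** b)) b)" for X
  have coeff: "u b = v b" if "(\<Sum>b\<in>B. mscale (u b) b) = (\<Sum>b\<in>B. mscale (v b) b)" "b \<in> B" for u v b
  proof -
    have "(\<Sum>b\<in>B. mscale (u b - v b) b) = 0"
      using that(1) by (simp add: cmat.scale_left_diff_distrib sum_subtractf)
    then have "u b - v b = 0" using cmat.independentD[OF B(3) fin subset_refl, of "\<lambda>b. u b - v b"] that(2) by blast
    then show ?thesis by simp
  qed
  have "linear f"
    unfolding f_def scaleR
    by (rule linearI) (simp_all add: matrix_mult_add_distrib trace_add cmat.scale_left_distrib sum.distrib scaleR mscale_mult trace_mscale cmat.scale_sum_right)
  moreover have "inj_on f \<gg>"
  proof (rule inj_onI)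
    fix X Y assume XY: "X \<in> \<gg>" "Y \<in> \<gg>" "f X = f Y"
    have "X - Y = 0"
    proof (rule nondegenerate)
      show "X - Y \<in> \<gg>" using XY cmat.subspace_diff[OF subspace] by blast
      fix W assume "W \<in> \<gg>"
      then have "W \<in> cmat.span B" using B(4) by blast
      then show "trace ((X - Y) ** W) = 0"
        using coeff[OF XY(3)[unfolded f_def]]
        by (intro trace_span_zero[of W B]) (simp_all add: matrix_mult_add_distrib trace_sub)
    qed
    then show "X = Y" by simp
  qed
  moreover have "span \<gg> = \<gg>" using real_sub[OF subspace] span_eq_iff by blast
  ultimately have "dim (f ` \<gg>) = dim \<gg>" using dim_image_eq[of f \<gg>] by metis
  moreover have "f ` \<gg> \<subseteq> \<gg>"
    unfolding f_def using B(2) subspace by (auto intro!: cmat.subspace_sum cmat.subspace_scale)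
  moreover have "subspace (f ` \<gg>)" using \<open>linear f\<close> real_sub[OF subspace] by (rule linear_subspace_image)
  ultimately have "f ` \<gg> = \<gg>" using subspace_dim_equal real_sub[OF subspace] by (metis order_refl)
  then obtain X where X: "X \<in> \<gg>" "f X = Z" using Z(1) by (metis imageE)
  have "(\<Sum>b\<in>B. mscale (trace (X ** b)) b) = (\<Sum>b\<in>B. mscale (if b = Z then 1 else 0) b)"
  proof -
    have "(\<Sum>b\<in>B. mscale (if b = Z then 1 else 0) b) = (\<Sum>b\<in>B. if b = Z then Z else 0)"
      by (intro sum.cong) auto
    then show ?thesis using X(2) fin B(1) by (simp add: f_def)
  qed
  then have tr: "trace (X ** b) = (if b = Z then 1 else 0)" if "b \<in> B" for b
    using coeff[of "\<lambda>b. trace (X ** b)" "\<lambda>b. if b = Z then 1 else 0" b] that by simp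
  have "trace (X ** Y) = 0" if "Y \<in> S" for Y
  proof (rule trace_span_zero)
    show "Y \<in> cmat.span B0" using that B0(3) by blast
    fix b assume "b \<in> B0"
    then have "b \<in> B" "b \<noteq> Z" using B(1) B0(1) Z(2) by blast+
    then show "trace (X ** b) = 0" by (simp add: tr)
  qed
  moreover have "trace (X ** Z) \<noteq> 0" using tr[of Z] B(1) by simp
  ultimately show ?thesis using X(1) by blast
qed

text \<open>(ad N)^2 is self-adjoint for the trace form. Were \<open>N\<close> outside its image,
  some \<open>X\<close> orthogonal to the image would pair nontrivially with \<open>N\<close>; but
  such an \<open>X\<close> is killed by (ad N)^2, which forces trace (N X) = 0.\<close>

lemma double_commutator_image:
  assumes N: "N \<in> \<gg>" and nil: "mpow N k = 0"
  shows "\<exists>U\<in>\<gg>. lie_bracket N (lie_bracket N U) = N"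
proof (rule ccontr)
  let ?S = "(\<lambda>U. lie_bracket N (lie_bracket N U)) ` \<gg>"
  assume "\<not> ?thesis"
  then have "N \<notin> ?S" by auto
  have "cmat.subspace ?S"
  proof (rule cmat.subspaceI)
    show "0 \<in> ?S" using cmat.subspace_0[OF subspace] by (auto simp: lie_bracket_def intro!: image_eqI[of _ _ 0])
    show "x + y \<in> ?S" if "x \<in> ?S" "y \<in> ?S" for x y
      using that cmat.subspace_add[OF subspace] by (auto simp flip: lie_bracket_linear)
    show "mscale c x \<in> ?S" if "x \<in> ?S" for c x
      using that cmat.subspace_scale[OF subspace] by (auto simp flip: lie_bracket_linear)
  qed
  moreover have "?S \<subseteq> \<gg>" using N bracket by blast
  ultimately have "\<exists>X\<in>\<gg>. (\<forall>Y\<in>?S. trace (X ** Y) = 0) \<and> trace (X ** N) \<noteq> 0"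
    using N \<open>N \<notin> ?S\<close> by (rule trace_separation)
  then obtain X where X: "X \<in> \<gg>" "\<And>Y. Y \<in> ?S \<Longrightarrow> trace (X ** Y) = 0" "trace (X ** N) \<noteq> 0"
    by blast
  have "lie_bracket N (lie_bracket N X) = 0"
  proof (rule nondegenerate)
    show "lie_bracket N (lie_bracket N X) \<in> \<gg>" using N X(1) bracket by blast
    fix U assume "U \<in> \<gg>"
    have "trace (lie_bracket N (lie_bracket N X) ** U) = trace (X ** lie_bracket N (lie_bracket N U))"
      by (simp add: trace_lie_bracket_left)
    then show "trace (lie_bracket N (lie_bracket N X) ** U) = 0" using X(2) \<open>U \<in> \<gg>\<close> by simp
  qed
  then have "trace (N ** X) = 0" by (rule trace_mult_double_commutator[OF nil])
  then show False using X(3) trace_mul_sym[of X N] by simp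
qed

end

subsection \<open>The monodromy weight filtration\<close>

lemma mpow_shift_left:
  assumes NK: "lie_bracket N K = N"
  shows "K ** mpow N j = mpow N j ** K - mscale (of_nat j) (mpow N j)"
proof (induction j)
  case (Suc j)
  have 1: "K ** N = N ** K - N" using NK by (simp add: lie_bracket_def algebra_simps)
  have "K ** mpow N (Suc j) = (K ** N) ** mpow N j" by (simp add: mpow_Suc matrix_mul_assoc)
  also have "\<dots> = N ** (K ** mpow N j) - mpow N (Suc j)"
    unfolding 1 by (simp add: matrix_mult_add_distrib matrix_mul_assoc mpow_Suc)
  also have "\<dots> = mpow N (Suc j) ** K - (mscale (of_nat j) (mpow N (Suc j)) + mpow N (Suc j))"
    unfolding Suc by (simp add: matrix_mult_add_distrib matrix_mul_assoc mpow_Suc mscale_mult)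
  finally show ?case by (simp add: cmat.scale_left_distrib add.commute)
qed simp

text \<open>The sl2 identity for powers of the lowering operator, with \<open>K\<close> as half the
  semisimple element. It rests on the two given brackets alone; nothing is said about
  [K, U].\<close>

lemma mpow_bracket:
  assumes K: "lie_bracket N U = K" and NK: "lie_bracket N K = N"
  shows "mpow N (Suc p) ** U = U ** mpow N (Suc p) +
    mscale (of_nat (Suc p) / 2) (mscale 2 (K ** mpow N p) + mscale (of_nat p) (mpow N p))"
proof (induction p)
  case 0
  show ?case using K by (simp add: lie_bracket_def mpow_Suc algebra_simps)
next
  case (Suc p)
  have 1: "N ** U = U ** N + K" "N ** K = K ** N + N"
    using K NK by (simp_all add: lie_bracket_def algebra_simps)
  let ?P = "mpow N (Suc p)" and ?a = "of_nat p :: complex"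
  have "mpow N (Suc (Suc p)) ** U = N ** (?P ** U)"
    by (simp add: mpow_Suc[of N "Suc p"] matrix_mul_assoc)
  also have "\<dots> = (N ** U) ** ?P + mscale ((?a + 1) / 2) (mscale 2 ((N ** K) ** mpow N p) + mscale ?a ?P)"
    unfolding Suc by (simp add: matrix_mult_add_distrib mscale_mult matrix_mul_assoc mpow_Suc add.commute)
  also have "\<dots> = U ** mpow N (Suc (Suc p)) + K ** ?P + mscale ((?a + 1) / 2) (mscale 2 (K ** ?P + ?P) + mscale ?a ?P)"
    unfolding 1 by (simp add: matrix_mult_add_distrib mpow_Suc matrix_mul_assoc)
  also have "\<dots> = U ** mpow N (Suc (Suc p)) +
    mscale (of_nat (Suc (Suc p)) / 2) (mscale 2 (K ** ?P) + mscale (of_nat (Suc p)) ?P)"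
    by (auto simp: vec_eq_iff field_simps)
  finally show ?case .
qed

context
  fixes n :: nat and N K U :: "complex ^ 'v ^ 'v" and W :: "(complex ^ 'v) filtration"
  assumes sub: "\<And>k. vec.subspace (W k)" and mono: "\<And>i j. i \<le> j \<Longrightarrow> W i \<subseteq> W j"
    and bot: "\<exists>k. W k = {0}" and top: "\<exists>k. W k = UNIV"
    and N: "\<And>k u. u \<in> W k \<Longrightarrow> N *v u \<in> W (k - 2)"
    and surj: "\<And>k w. w \<in> W (int n - int k) \<Longrightarrow> \<exists>u \<in> W (int n + int k). w - mpow N k *v u \<in> W (int n - int k - 1)"
    and inj: "\<And>k u. u \<in> W (int n + int k) \<Longrightarrow> mpow N k *v u \<in> W (int n - int k - 1) \<Longrightarrow> u \<in> W (int n + int k - 1)"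
    and K: "lie_bracket N U = K" and NK: "lie_bracket N K = N"
begin

lemma mpow_weight: "u \<in> W k \<Longrightarrow> mpow N j *v u \<in> W (k - 2 * int j)"
proof (induction j)
  case (Suc j)
  then show ?case using N[of "mpow N j *v u" "k - 2 * int j"]
    by (simp add: mpow_Suc algebra_simps flip: matrix_vector_mul_assoc)
qed simp

text \<open>If u has weight n + j with j > k, then N^j u = 0, and injectivity of N^j on the graded
  piece lowers the weight. This is repeated from the top weight down to n + k.\<close>

lemma kernel_weight: "mpow N (Suc k) *v u = 0 \<Longrightarrow> u \<in> W (int n + int k)"
proof -
  assume u: "mpow N (Suc k) *v u = 0"
  obtain b where b: "W b = UNIV" using top by blast
  have "u \<in> W (int n + int (k + j))" if "u \<in> W (int n + int (k + m))" "j \<le> m" for m j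
    using that(2,1)
  proof (induction j rule: inc_induct)
    case (step j)
    have "mpow N (Suc (k + j)) *v u = 0" by (rule mpow_zero_mono[OF u]) simp
    then have "u \<in> W (int n + int (Suc (k + j)) - 1)"
      using step vec.subspace_0[OF sub] by (intro inj) simp_all
    then show ?case by simp
  qed simp
  moreover have "b \<le> int n + int (k + nat \<bar>b\<bar>)" by linarith
  then have "u \<in> W (int n + int (k + nat \<bar>b\<bar>))" using mono b by blast
  ultimately show ?thesis by (metis add.right_neutral le0)
qed

text \<open>With m = n - j - t, surjectivity of N^{j+m} onto Gr_t provides u, and N^m u is a
  preimage under N^j up to lower weight; the error is corrected by induction from the
  bottom.\<close>

lemma mpow_weight_surj: "w \<in> W t \<Longrightarrow> t \<le> int n - int j \<Longrightarrow> \<exists>u \<in> W (t + 2 * int j). mpow N j *v u = w"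
proof -
  obtain a where a: "W a = {0}" using bot by blast
  show "w \<in> W t \<Longrightarrow> t \<le> int n - int j \<Longrightarrow> \<exists>u \<in> W (t + 2 * int j). mpow N j *v u = w"
  proof (induction t arbitrary: w rule: int_up_induct[where b = a])
    case (base t)
    then have "w = 0" using mono[of t a] a by auto
    then show ?case using vec.subspace_0[OF sub] by (intro bexI[of _ 0]) auto
  next
    case (step t)
    define m where "m = nat (int n - int j - t)"
    have m: "int m = int n - int j - t" using step.prems(2) by (simp add: m_def)
    have t: "t = int n - int (j + m)" using m by simp
    obtain u where u: "u \<in> W (int n + int (j + m))" "w - mpow N (j + m) *v u \<in> W (t - 1)"
      using surj[of w "j + m"] step.prems(1) t by auto
    obtain v where v: "v \<in> W (t - 1 + 2 * int j)" "mpow N j *v v = w - mpow N (j + m) *v u"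
      using step.IH[OF u(2)] step.prems(2) by auto
    have "int n + int (j + m) - 2 * int m = t + 2 * int j" using m by simp
    then have "mpow N m *v u \<in> W (t + 2 * int j)" using mpow_weight[OF u(1), of m] by metis
    moreover have "v \<in> W (t + 2 * int j)" using v(1) mono[of "t - 1 + 2 * int j" "t + 2 * int j"] by auto
    ultimately have "mpow N m *v u + v \<in> W (t + 2 * int j)" by (rule vec.subspace_add[OF sub])
    moreover have "mpow N j *v (mpow N m *v u + v) = w"
      using v(2) by (simp add: matrix_vector_right_distrib mpow_add matrix_vector_mul_assoc)
    ultimately show ?case by blast
  qed
qed

lemma K_mpow: "K *v (mpow N j *v u) = mpow N j *v (K *v u) - of_nat j *s (mpow N j *v u)"
  using mpow_shift_left[OF NK, of j]
  by (simp add: matrix_vector_mul_assoc matrix_vector_mult_diff_rdistrib mscale_vec)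

lemma mpow_K: "mpow N j *v (K *v u) = K *v (mpow N j *v u) + of_nat j *s (mpow N j *v u)"
  using K_mpow[of j u] by simp

text \<open>Here \<open>v\<close> represents a primitive class. N^k (2K - k) v = (2K + k) N^k v is
  N^{k+1} applied to a multiple \<open>y\<close> of U v. It is also killed by N, so N^{k+2} y = 0;
  this bounds the weight of y by n + k + 1 and that of N^{k+1} y by n - k - 1. Injectivity of N^k on
  the graded piece then applies.\<close>

lemma primitive_weight:
  assumes v: "mpow N (Suc k) *v v = 0"
  shows "2 *s (K *v v) - of_nat k *s v \<in> W (int n + int k - 1)"
proof (rule inj)
  have "mpow N (Suc k) *v (K *v v) = 0" unfolding mpow_K v by simp
  then show "2 *s (K *v v) - of_nat k *s v \<in> W (int n + int k)"
    using kernel_weight v by (intro vec.subspace_diff[OF sub] vec.subspace_scale[OF sub]) blast+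
  let ?z = "mpow N k *v v"
  \<comment> \<open>The factor inverts the (k + 1)/2 in \<open>mpow_bracket\<close>.\<close>
  define y where "y = (2 / of_nat (Suc k)) *s (U *v v)"
  have "mpow N k *v (2 *s (K *v v) - of_nat k *s v) = 2 *s (K *v ?z) + of_nat k *s ?z"
    unfolding matrix_vector_mult_diff_distrib mat_vec_linear mpow_K by (simp add: vec_eq_iff algebra_simps)
  also have "\<dots> = mpow N (Suc k) *v y"
  proof -
    have "mpow N (Suc k) *v (U *v v) = (of_nat (Suc k) / 2) *s (2 *s (K *v ?z) + of_nat k *s ?z)"
      using mpow_bracket[OF K NK, of k] v
      by (simp add: matrix_vector_mul_assoc matrix_vector_mult_add_rdistrib mscale_vec
          del: of_nat_Suc flip: matrix_vector_mul_assoc[of U])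
    then show ?thesis by (simp add: y_def del: of_nat_Suc)
  qed
  finally have eq: "mpow N k *v (2 *s (K *v v) - of_nat k *s v) = mpow N (Suc k) *v y" .
  have Nz: "N *v ?z = 0" using v by (simp add: mpow_Suc matrix_vector_mul_assoc)
  have "N *v (K *v ?z) = K *v (N *v ?z) + N *v ?z" using mpow_K[of 1 ?z] by (simp add: mpow_Suc)
  then have "N *v (2 *s (K *v ?z) + of_nat k *s ?z) = 0" using Nz by (simp add: matrix_vector_right_distrib)
  then have "mpow N (Suc (Suc k)) *v y = 0"
    using \<open>2 *s (K *v ?z) + of_nat k *s ?z = mpow N (Suc k) *v y\<close>
    by (simp add: mpow_Suc[of N "Suc k"] flip: matrix_vector_mul_assoc)
  then have "y \<in> W (int n + int (Suc k))" by (rule kernel_weight)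
  then have "mpow N (Suc k) *v y \<in> W (int n + int (Suc k) - 2 * int (Suc k))" by (rule mpow_weight)
  then show "mpow N k *v (2 *s (K *v v) - of_nat k *s v) \<in> W (int n - int k - 1)"
    unfolding eq by (simp add: algebra_simps)
qed

text \<open>Descending induction on k through the primitive decomposition w = v + N w', with v
  primitive and w' two weights higher. Moving N past K lowers the scalar of 2K from k + 2 to
  k.\<close>

lemma upper_weight: "w \<in> W (int n + int k) \<Longrightarrow> 2 *s (K *v w) - of_nat k *s w \<in> W (int n + int k - 1)"
proof -
  obtain b where b: "W b = UNIV" using top by blast
  let ?Q = "\<lambda>k. \<forall>w. w \<in> W (int n + int k) \<longrightarrow> 2 *s (K *v w) - of_nat k *s w \<in> W (int n + int k - 1)"
  have "?Q k"
  proof (induction "nat (\<bar>b\<bar> + 1 - int k)" arbitrary: k rule: less_induct)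
    case less
    show ?case
    proof (cases "b \<le> int n + int k - 1")
      case True
      then show ?thesis using mono[OF True] b by auto
    next
      case False
      then have Q2: "?Q (k + 2)" by (intro less) auto
      show ?thesis
      proof (intro allI impI)
        fix w assume w: "w \<in> W (int n + int k)"
        \<comment> \<open>N^{k+1} w has weight n - k - 2, so it equals N^{k+2} w' for some w' of
          weight n + k + 2, and w - N w' is killed by N^{k+1}.\<close>
        have "mpow N (Suc k) *v w \<in> W (int n + int k - 2 * int (Suc k))" using w by (rule mpow_weight)
        moreover have "int n + int k - 2 * int (Suc k) = int n - int (k + 2)" by simp
        ultimately have "mpow N (Suc k) *v w \<in> W (int n - int (k + 2))" by metis
        from mpow_weight_surj[OF this order_refl] obtain w' where
          w': "w' \<in> W (int n + int (k + 2))" "mpow N (k + 2) *v w' = mpow N (Suc k) *v w"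
          by (auto simp: algebra_simps)
        define v where "v = w - N *v w'"
        have "mpow N (Suc k) *v (N *v w') = mpow N (k + 2) *v w'"
          using mpow_Suc_right[of N "Suc k"] by (simp add: matrix_vector_mul_assoc)
        then have "mpow N (Suc k) *v v = 0" using w'(2) by (simp add: v_def matrix_vector_mult_diff_distrib)
        then have 1: "2 *s (K *v v) - of_nat k *s v \<in> W (int n + int k - 1)" by (rule primitive_weight)
        have "2 *s (K *v w') - of_nat (k + 2) *s w' \<in> W (int n + int (k + 2) - 1)"
          using Q2 w'(1) by blast
        then have "N *v (2 *s (K *v w') - of_nat (k + 2) *s w') \<in> W (int n + int (k + 2) - 1 - 2)" by (rule N)
        moreover have "N *v (2 *s (K *v w') - of_nat (k + 2) *s w') = 2 *s (K *v (N *v w')) - of_nat k *s (N *v w')"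
          using mpow_K[of 1 w'] by (simp add: mpow_Suc matrix_vector_mult_diff_distrib vec_eq_iff algebra_simps)
        ultimately have 2: "2 *s (K *v (N *v w')) - of_nat k *s (N *v w') \<in> W (int n + int k - 1)" by simp
        have "2 *s (K *v w) - of_nat k *s w = (2 *s (K *v v) - of_nat k *s v) + (2 *s (K *v (N *v w')) - of_nat k *s (N *v w'))"
          by (simp add: v_def matrix_vector_mult_diff_distrib vec_eq_iff algebra_simps)
        then show "2 *s (K *v w) - of_nat k *s w \<in> W (int n + int k - 1)"
          using vec.subspace_add[OF sub 1 2] by simp
      qed
    qed
  qed
  then show "w \<in> W (int n + int k) \<Longrightarrow> 2 *s (K *v w) - of_nat k *s w \<in> W (int n + int k - 1)" by blast
qed

text \<open>Weights n - k are reached from n + k by N^k, which changes the scalar of 2K from k to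
  -k.\<close>

lemma weight_scalar: "w \<in> W m \<Longrightarrow> 2 *s (K *v w) - (of_int m - of_nat n) *s w \<in> W (m - 1)"
proof -
  assume w: "w \<in> W m"
  show ?thesis
  proof (cases "m \<ge> int n")
    case True
    then obtain k where k: "m = int n + int k" using zle_iff_zadd by blast
    then show ?thesis using upper_weight[of w k] w by simp
  next
    case False
    define k where "k = nat (int n - m)"
    have m: "m = int n - int k" using False by (simp add: k_def)
    obtain u where u: "u \<in> W (int n + int k)" "mpow N k *v u = w"
      using mpow_weight_surj[of w m k] w m by (auto simp: algebra_simps)
    have "mpow N k *v (2 *s (K *v u) - of_nat k *s u) \<in> W (int n + int k - 1 - 2 * int k)"
      by (rule mpow_weight[OF upper_weight[OF u(1)]])
    moreover have "mpow N k *v (2 *s (K *v u) - of_nat k *s u) = 2 *s (K *v w) - (of_int m - of_nat n) *s w"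
    proof -
      have c: "of_int m = (of_nat n - of_nat k :: complex)" unfolding m by simp
      show ?thesis
        unfolding c u(2)[symmetric] matrix_vector_mult_diff_distrib mat_vec_linear mpow_K
        by (simp add: vec_eq_iff algebra_simps)
    qed
    moreover have "int n + int k - 1 - 2 * int k = m - 1" using m by simp
    ultimately show ?thesis by simp
  qed
qed

end

subsection \<open>Opposite filtrations on the space and on the Lie algebra\<close>

text \<open>An eigenvector of \<open>T\<close> with eigenvalue j + c belongs to F^j and to W_{2j};
  the shared offset \<open>c\<close> ties the two filtrations together. An odd weight would need a
  half-integral j, which F does not allow.\<close>

lemma common_grading_opposite:
  fixes F W :: "(complex ^ 'v) filtration" and T :: "complex ^ 'v ^ 'v"
  assumes F: "cvec.finite_filtration UNIV F" and W: "cvec.finite_filtration UNIV (\<lambda>m. W (- m))"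
    and TF: "\<And>p u. u \<in> F p \<Longrightarrow> T *v u - (of_int p + c) *s u \<in> F (p + 1)"
    and TW: "\<And>k u. u \<in> W k \<Longrightarrow> T *v u - (of_int k / 2 + c) *s u \<in> W (k - 1)"
  shows "opposite_filtrations UNIV F W"
proof -
  note FD = cvec.finite_filtrationD[OF F]
  have Wsub: "vec.subspace (W k)" and Wmono: "i \<le> j \<Longrightarrow> W i \<subseteq> W j" for i j k
    using cvec.finite_filtrationD(1)[OF W, of "- k"] cvec.finite_filtrationD(2)[OF W, of "- j" "- i"] by auto
  obtain a d where a: "\<And>p. p \<le> a \<Longrightarrow> F p = UNIV" and d: "\<And>p. p \<ge> d \<Longrightarrow> F p = {0}"
    using FD(5,6) by blast
  obtain b t where b': "\<And>m. m \<ge> b \<Longrightarrow> W (- m) = {0}" and t': "\<And>m. m \<le> t \<Longrightarrow> W (- m) = UNIV"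
    using cvec.finite_filtrationD(5,6)[OF W] by blast
  have b: "W k = {0}" if "k \<le> - b" for k using b'[of "- k"] that by simp
  have t: "W k = UNIV" if "k \<ge> - t" for k using t'[of "- k"] that by simp
  have scale_mem: "v \<in> S" if "vec.subspace S" "r *s v \<in> S" "r \<noteq> 0" for r v and S :: "(complex ^ 'v) set"
    using vec.subspace_scale[OF that(1,2), of "1 / r"] that(3) by simp
  \<comment> \<open>\<open>T\<close> preserves F^p \<inter> W_k. Subtracting either scalar moves u
    into a smaller intersection, zero by induction; so u would be an eigenvector for two different
    eigenvalues.\<close>
  have zero: "u = 0" if "u \<in> F p" "u \<in> W k" "k < 2 * p" for u p k
    using that
  proof (induction "nat (d - p) + nat (k + b)" arbitrary: p k u rule: less_induct)
    case less
    show ?case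
    proof (cases "d \<le> p \<or> k \<le> - b")
      case True
      then show ?thesis using less.prems d b by blast
    next
      case False
      have TFu: "T *v u \<in> F p"
        using vec.subspace_add[OF FD(1) subsetD[OF FD(2) TF[OF less.prems(1)], of p] vec.subspace_scale[OF FD(1) less.prems(1), of "of_int p + c"]]
        by (simp only: diff_add_cancel)
      have TWu: "T *v u \<in> W k"
        using vec.subspace_add[OF Wsub subsetD[OF Wmono TW[OF less.prems(2)], of k] vec.subspace_scale[OF Wsub less.prems(2), of "of_int k / 2 + c"]]
        by (simp only: diff_add_cancel)
      have "T *v u - (of_int p + c) *s u = 0"
        using False less.prems TWu
        by (intro less.hyps[of "p + 1" k] TF vec.subspace_diff[OF Wsub] vec.subspace_scale[OF Wsub]) auto
      moreover have "T *v u - (of_int k / 2 + c) *s u = 0"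
        using False less.prems TFu
        by (intro less.hyps[of p "k - 1"] TW vec.subspace_diff[OF FD(1)] vec.subspace_scale[OF FD(1)]) auto
      ultimately have "(of_int p + c) *s u = (of_int k / 2 + c) *s u" by simp
      then have "((of_int p + c) - (of_int k / 2 + c)) *s u = 0" by (simp add: vec.scale_left_diff_distrib)
      moreover have "(of_int p + c) - (of_int k / 2 + c) \<noteq> 0"
      proof
        assume "of_int p + c - (of_int k / 2 + c) = 0"
        then have "(of_int (2 * p) :: complex) = of_int k" by (simp add: field_simps)
        then show False using less.prems(3) by (simp only: of_int_eq_iff)
      qed
      ultimately show ?thesis by (simp only: vec.scale_eq_0_iff) simp
    qed
  qed
  show ?thesis
    unfolding opposite_filtrations_def
  proof (intro conjI allI ballI)
    show "F p \<inter> W (2 * p - 2) = {0}" for p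
      using zero[of _ p "2 * p - 2"] vec.subspace_0[OF FD(1)] vec.subspace_0[OF Wsub] by auto
  next
    fix p and u :: "complex ^ 'v"
    let ?S = "{x + y |x y. x \<in> F p \<and> y \<in> W (2 * p - 2)}"
    let ?E = "{v. \<exists>j\<ge>a. v \<in> F j \<and> T *v v = (of_int j + c) *s v}"
    have S: "vec.subspace ?S" by (rule vec.subspace_sums[OF FD(1) Wsub])
    have "inj (\<lambda>j. of_int j + c)" by (auto intro!: injI)
    moreover have "u \<in> F a" using a by simp
    ultimately have "u \<in> vec.span ?E"
      using TF by (intro cvec.graded_part_exists(2)[OF F, where T = "(*v) T" and c = "\<lambda>j. of_int j + c"])
        (simp_all only: matrix_vector_right_distrib mat_vec_linear)
    moreover have "?E \<subseteq> ?S"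
    proof
      fix v assume "v \<in> ?E"
      then obtain j where j: "v \<in> F j" "T *v v = (of_int j + c) *s v" by blast
      show "v \<in> ?S"
      proof (cases "j \<ge> p")
        case True
        then have "v \<in> F p" using j(1) FD(2) by blast
        then show ?thesis using vec.subspace_0[OF Wsub] by force
      next
        case False
        \<comment> \<open>Descent from the top weight: while k + 1 > 2j, the eigenvalue differs from
          the scalar on Gr_{k+1}, so v drops into W_k.\<close>
        have "v \<in> W k" if "k \<ge> 2 * j" for k
          using that
        proof (induction k rule: int_down_induct[where b = "- t"])
          case (base k)
          then show ?case using t by simp
        next
          case (step k)
          then have "v \<in> W (k + 1)" by simp
          from TW[OF this] have "(of_int j - of_int (k + 1) / 2) *s v \<in> W k"
            unfolding j(2) vec.scale_left_diff_distrib[symmetric] by simp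
          moreover have "of_int j - of_int (k + 1) / 2 \<noteq> (0 :: complex)"
          proof
            assume "of_int j - of_int (k + 1) / 2 = (0 :: complex)"
            then have "(of_int (2 * j) :: complex) = of_int (k + 1)" by (simp add: field_simps)
            then show False using step.prems by (simp only: of_int_eq_iff)
          qed
          ultimately show ?case using scale_mem[OF Wsub] by blast
        qed
        then have "v \<in> W (2 * j)" by simp
        then have "v \<in> W (2 * p - 2)" using Wmono[of "2 * j" "2 * p - 2"] False by auto
        then show ?thesis using vec.subspace_0[OF FD(1)] by force
      qed
    qed
    ultimately have "u \<in> ?S" using vec.span_minimal[OF _ S] by blast
    then show "\<exists>x\<in>F p. \<exists>y\<in>W (2 * p - 2). u = x + y" by blast
  next
    fix p
    let ?E = "{v. \<exists>j\<ge>- (2 * p - 1). v \<in> W (- j) \<and> T *v v = (of_int (- j) / 2 + c) *s v}"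
    have dec: "W (2 * p - 1) \<subseteq> vec.span ?E"
    proof
      fix u assume u: "u \<in> W (2 * p - 1)"
      have "inj (\<lambda>j. of_int (- j) / 2 + c)" by (auto intro!: injI)
      moreover have "u \<in> W (- (- (2 * p - 1)))" using u by simp
      moreover have "T *v v - (of_int (- j) / 2 + c) *s v \<in> W (- (j + 1))" if "v \<in> W (- j)" for v j
        using TW[OF that] by simp
      ultimately show "u \<in> vec.span ?E"
        by (intro cvec.graded_part_exists(2)[OF W, where T = "(*v) T" and c = "\<lambda>j. of_int (- j) / 2 + c"])
           (simp_all only: matrix_vector_right_distrib mat_vec_linear)
    qed
    have "?E \<subseteq> W (2 * p - 2)"
    proof
      fix v assume "v \<in> ?E"
      then obtain j where j: "j \<ge> - (2 * p - 1)" "v \<in> W (- j)" "T *v v = (of_int (- j) / 2 + c) *s v" by blast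
      show "v \<in> W (2 * p - 2)"
      proof (cases "- j \<le> 2 * p - 2")
        case True
        then show ?thesis using j(2) Wmono by blast
      next
        case False
        then have jp: "- j = 2 * p - 1" using j(1) by simp
        \<comment> \<open>The eigenvalue is half-integral up to \<open>c\<close>, so it differs from
          every scalar on the graded pieces of F, and v climbs through all of F.\<close>
        have "v \<in> F q" for q
        proof (induction q rule: int_up_induct[where b = a])
          case (base q)
          then show ?case using a by simp
        next
          case (step q)
          from TF[OF step] have "(of_int (- j) / 2 - of_int (q - 1)) *s v \<in> F q"
            unfolding j(3) vec.scale_left_diff_distrib[symmetric] add_diff_cancel_right by (simp only: diff_add_cancel)
          moreover have "of_int (- j) / 2 - of_int (q - 1) \<noteq> (0 :: complex)"
          proof
            assume "of_int (- j) / 2 - of_int (q - 1) = (0 :: complex)"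
            then have "(of_int (- j) :: complex) = of_int (2 * (q - 1))" by (simp add: field_simps)
            then have "2 * p - 1 = 2 * (q - 1)" unfolding jp of_int_eq_iff .
            then show False by presburger
          qed
          ultimately show ?case using scale_mem[OF FD(1)] by blast
        qed
        then have "v = 0" using d[of d] by blast
        then show ?thesis using vec.subspace_0[OF Wsub] by simp
      qed
    qed
    then have "W (2 * p - 1) \<subseteq> W (2 * p - 2)" using dec vec.span_minimal[OF _ Wsub] by blast
    then show "W (2 * p - 1) = W (2 * p - 2)" using Wmono[of "2 * p - 2" "2 * p - 1"] by auto
  qed
qed

context trace_lie_algebra
begin

abbreviation lift_weight :: "(complex ^ 'v) filtration \<Rightarrow> (complex ^ 'v ^ 'v) filtration" where
  "lift_weight W \<equiv> \<lambda>k. lift (\<lambda>m. W (- m)) (- k)"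

lemma lift_weightD: "X \<in> lift_weight W k \<Longrightarrow> u \<in> W j \<Longrightarrow> X *v u \<in> W (k + j)"
  using liftD(2)[of X "\<lambda>m. W (- m)" "- k" u "- j"] by (simp add: add.commute)

lemma lift_weightI: "X \<in> \<gg> \<Longrightarrow> (\<And>j u. u \<in> W j \<Longrightarrow> X *v u \<in> W (k + j)) \<Longrightarrow> X \<in> lift_weight W k"
  by (rule liftI) (force simp: algebra_simps)+

lemma opposite_lift:
  assumes E: "grades E l c F" and K: "grades K l' c' (\<lambda>m. W (- m))"
    and opp: "opposite_filtrations UNIV F W"
  shows "opposite_filtrations \<gg> (lift F) (lift_weight W)"
proof -
  note FD = cvec.finite_filtrationD[OF gradesD(1)[OF E]]
  note W = gradesD(1)[OF K]
  have Wmono: "i \<le> j \<Longrightarrow> W i \<subseteq> W j" for i j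
    using cvec.finite_filtrationD(2)[OF W, of "- j" "- i"] by auto
  obtain d where d: "\<And>p. p \<ge> d \<Longrightarrow> F p = {0}" using FD(6) by blast
  obtain a where a: "F a = UNIV" using FD(5) by blast
  note LF = cmat.finite_filtrationD[OF lift_filtration[OF gradesD(1)[OF E]]]
  note LW = cmat.finite_filtrationD[OF lift_filtration[OF W]]
  have op: "F p \<inter> W (2 * p - 2) = {0}" "\<exists>x\<in>F p. \<exists>y\<in>W (2 * p - 2). u = x + y" "W (2 * p - 1) = W (2 * p - 2)"
    for p u using opp unfolding opposite_filtrations_def by blast+
  \<comment> \<open>F^r is the sum of F^{r+1} and F^r \<inter> W_{2r}. The second summand is mapped
    into F^{p+r} \<inter> W_{2(p+r)-2} = 0; the first is covered by descending induction on
    r.\<close>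
  have int0: "X = 0" if XF: "X \<in> lift F p" and XW: "X \<in> lift_weight W (2 * p - 2)" for X p
  proof -
    have "X *v u = 0" if "u \<in> F r" for u r
      using that
    proof (induction r arbitrary: u rule: int_down_induct[where b = d])
      case (base r)
      then show ?case using d by auto
    next
      case (step r)
      obtain x y where xy: "x \<in> F (r + 1)" "y \<in> W (2 * (r + 1) - 2)" "u = x + y" using op(2) by blast
      have "y = u - x" using xy by simp
      then have "y \<in> F r" using step.prems xy(1) FD(2)[of r "r + 1"] vec.subspace_diff[OF FD(1)] by auto
      then have "X *v y \<in> F (p + r)" by (rule liftD(2)[OF XF])
      moreover have "X *v y \<in> W (2 * p - 2 + (2 * (r + 1) - 2))" by (rule lift_weightD[OF XW xy(2)])
      then have "X *v y \<in> W (2 * (p + r) - 2)" by (simp add: algebra_simps)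
      ultimately have "X *v y = 0" using op(1) by blast
      then show ?case using step.IH[OF xy(1)] xy(3) by (simp add: matrix_vector_right_distrib)
    qed
    then have "X *v u = 0 *v u" for u using a by (metis UNIV_I matrix_vector_mult_0)
    then show ?thesis by (subst matrix_eq) blast
  qed
  \<comment> \<open>Every W_j equals W_{2r} with r the integer part of j/2, and X of odd weight maps
    it into an odd step, which equals the step below.\<close>
  have odd: "lift_weight W (2 * p - 1) \<subseteq> lift_weight W (2 * p - 2)" for p
  proof
    fix X assume X: "X \<in> lift_weight W (2 * p - 1)"
    show "X \<in> lift_weight W (2 * p - 2)"
    proof (rule lift_weightI)
      show "X \<in> \<gg>" using X liftD(1) by blast
      fix j u assume u: "u \<in> W j"
      define r where "r = j div 2"
      have j: "j = 2 * r \<or> j = 2 * (r + 1) - 1" "2 * r \<le> j" unfolding r_def by presburger+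
      have "2 * (r + 1) - 2 = 2 * r" by simp
      then have "u \<in> W (2 * r)" using j(1) u op(3)[of "r + 1"] by metis
      then have "X *v u \<in> W (2 * p - 1 + 2 * r)" by (rule lift_weightD[OF X])
      then have "X *v u \<in> W (2 * (p + r) - 1)" by (simp add: algebra_simps)
      then have "X *v u \<in> W (2 * (p + r) - 2)" unfolding op(3) .
      then show "X *v u \<in> W (2 * p - 2 + j)" using Wmono[of "2 * (p + r) - 2" "2 * p - 2 + j"] j(2) by auto
    qed
  qed
  show ?thesis
    unfolding opposite_filtrations_def
  proof (intro conjI allI ballI)
    show "lift F p \<inter> lift_weight W (2 * p - 2) = {0}" for p
      using int0 cmat.subspace_0[OF LF(1)] cmat.subspace_0[OF LW(1)] by blast
    show "lift_weight W (2 * p - 1) = lift_weight W (2 * p - 2)" for p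
      using odd LW(2)[of "- (2 * p - 1)" "- (2 * p - 2)"] by auto
  next
    fix p Z assume Z: "Z \<in> \<gg>"
    let ?S = "{x + y |x y. x \<in> lift F p \<and> y \<in> lift_weight W (2 * p - 2)}"
    have S: "cmat.subspace ?S" by (rule cmat.subspace_sums[OF LF(1) LW(1)])
    have sub: "lift F p \<subseteq> ?S" "lift_weight W (2 * p - 2) \<subseteq> ?S"
      using cmat.subspace_0[OF LF(1)] cmat.subspace_0[OF LW(1)] by force+
    have "?S \<subseteq> \<gg>" using cmat.subspace_add[OF subspace] LF(3) LW(3) by blast
    have "Z \<in> ?S"
    proof (rule ccontr)
      assume "Z \<notin> ?S"
      with S \<open>?S \<subseteq> \<gg>\<close> Z have "\<exists>X\<in>\<gg>. (\<forall>Y\<in>?S. trace (X ** Y) = 0) \<and> trace (X ** Z) \<noteq> 0"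
        by (rule trace_separation)
      then obtain X where X: "X \<in> \<gg>" "\<And>Y. Y \<in> ?S \<Longrightarrow> trace (X ** Y) = 0" "trace (X ** Z) \<noteq> 0"
        by blast
      have "X \<in> lift F (1 - p)" using X(2) sub by (intro lift_orthogonal[OF E X(1)]) blast
      \<comment> \<open>In terms of weights the index is 1 - 2p = 2 (1 - p) - 1; being odd it can be
        lowered to 2 (1 - p) - 2, the step complementary to F^{1-p}.\<close>
      moreover have "X \<in> lift (\<lambda>m. W (- m)) (1 - - (2 * p - 2))"
        using X(2) sub by (intro lift_orthogonal[OF K X(1)]) blast
      then have "X \<in> lift_weight W (2 * (1 - p) - 1)" by (simp add: algebra_simps)
      then have "X \<in> lift_weight W (2 * (1 - p) - 2)" using odd by blast
      ultimately have "X = 0" using int0 by blast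
      then show False using X(3) by (simp add: trace_def)
    qed
    then show "\<exists>a\<in>lift F p. \<exists>b\<in>lift_weight W (2 * p - 2). Z = a + b" by blast
  qed
qed

lemma grades_in_lift:
  assumes T: "grades T l c \<Phi>"
  shows "T \<in> lift \<Phi> 0"
proof (rule liftI)
  note D = cvec.finite_filtrationD[OF gradesD(1)[OF T]]
  fix q u assume u: "u \<in> \<Phi> q"
  have "T *v u - (l * of_int q + c) *s u \<in> \<Phi> q"
    using gradesD(4)[OF T u] D(2)[of q "q + 1"] by auto
  from vec.subspace_add[OF D(1) this vec.subspace_scale[OF D(1) u, of "l * of_int q + c"]]
  show "T *v u \<in> \<Phi> (0 + q)" by simp
qed (rule gradesD(2)[OF T])

lemma opposite_lift_converse:
  assumes E: "grades E 1 c F" and K: "grades K (- 1 / 2) c (\<lambda>m. W (- m))"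
    and centre: "\<And>Z. Z \<in> \<gg> \<Longrightarrow> (\<And>X. X \<in> \<gg> \<Longrightarrow> lie_bracket Z X = 0) \<Longrightarrow> Z = 0"
    and opp: "opposite_filtrations \<gg> (lift F) (lift_weight W)"
  shows "opposite_filtrations UNIV F W"
proof -
  note F = gradesD(1)[OF E] and W = gradesD(1)[OF K]
  note FD = cvec.finite_filtrationD[OF F]
  have Wsub: "vec.subspace (W k)" and Wmono: "i \<le> j \<Longrightarrow> W i \<subseteq> W j" for i j k
    using cvec.finite_filtrationD(1)[OF W, of "- k"] cvec.finite_filtrationD(2)[OF W, of "- j" "- i"] by auto
  note LF = cmat.finite_filtrationD[OF lift_filtration[OF F]]
  note LW = cmat.finite_filtrationD[OF lift_filtration[OF W]]
  have op: "lift F p \<inter> lift_weight W (2 * p - 2) = {0}"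
    "X \<in> \<gg> \<Longrightarrow> \<exists>x\<in>lift F p. \<exists>y\<in>lift_weight W (2 * p - 2). X = x + y"
    "lift_weight W (2 * p - 1) = lift_weight W (2 * p - 2)"
    for p X using opp unfolding opposite_filtrations_def by blast+
  \<comment> \<open>Along F^1 + W_0, removing the F^1 part of E leaves its component in I^{0,0}; K
    is treated in the same way along F^0 + W_{-2}.\<close>
  obtain e Y where Y: "e \<in> lift F 1" "Y \<in> lift_weight W 0" "E = e + Y"
    using op(2)[OF gradesD(2)[OF E], of 1] by auto
  obtain Y' k where Y': "Y' \<in> lift F 0" "k \<in> lift_weight W (- 2)" "K = Y' + k"
    using op(2)[OF gradesD(2)[OF K], of 0] by auto
  have YE: "Y = E - e" "Y' = K - k" using Y(3) Y'(3) by simp_all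
  have YF: "Y \<in> lift F 0"
    unfolding YE using grades_in_lift[OF E] Y(1) LF(2)[of 0 1] by (intro cmat.subspace_diff[OF LF(1)]) auto
  have Y'W: "Y' \<in> lift_weight W 0"
    unfolding YE using grades_in_lift[OF K] Y'(2) LW(2)[of 0 2] by (intro cmat.subspace_diff[OF LW(1)]) auto
  \<comment> \<open>[Y, X] - p X lies in F^{p+1}, because e raises F, and in W_{2p}; [Y', X] - p X
    lies in W_{2p-2}, because k lowers weights, and in F^p. Both intersections are zero.\<close>
  have act: "lie_bracket Y X = mscale (of_int p) X" "lie_bracket Y' X = mscale (of_int p) X"
    if XF: "X \<in> lift F p" and XW: "X \<in> lift_weight W (2 * p)" for X p
  proof -
    have "lie_bracket E X - mscale (1 * of_int p) X \<in> lift F (p + 1)" by (rule grades_lift[OF E XF])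
    moreover have "lie_bracket e X \<in> lift F (1 + p)" by (rule lift_bracket[OF F Y(1) XF])
    then have "lie_bracket e X \<in> lift F (p + 1)" by (simp add: add.commute)
    ultimately have "(lie_bracket E X - mscale (1 * of_int p) X) - lie_bracket e X \<in> lift F (p + 1)"
      by (rule cmat.subspace_diff[OF LF(1)])
    then have 1: "lie_bracket Y X - mscale (of_int p) X \<in> lift F (p + 1)"
      by (simp add: YE lie_bracket_linear algebra_simps)
    have "lie_bracket Y X \<in> lift (\<lambda>m. W (- m)) (- 0 + - (2 * p))" by (rule lift_bracket[OF W Y(2) XW])
    then have "lie_bracket Y X - mscale (of_int p) X \<in> lift_weight W (2 * p)"
      using XW by (intro cmat.subspace_diff[OF LW(1)] cmat.subspace_scale[OF LW(1)]) simp_all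
    moreover have "2 * p = 2 * (p + 1) - 2" by simp
    ultimately have "lie_bracket Y X - mscale (of_int p) X \<in> lift_weight W (2 * (p + 1) - 2)" by metis
    then have "lie_bracket Y X - mscale (of_int p) X = 0" using 1 op(1) by blast
    then show "lie_bracket Y X = mscale (of_int p) X" by simp
    have "lie_bracket K X - mscale (- 1 / 2 * of_int (- (2 * p))) X \<in> lift (\<lambda>m. W (- m)) (- (2 * p) + 1)"
      by (rule grades_lift[OF K XW])
    then have "lie_bracket K X - mscale (of_int p) X \<in> lift_weight W (2 * p - 1)" by simp
    \<comment> \<open>The grading alone reaches weight 2p - 1; the vanishing of odd graded pieces
      supplies the missing step.\<close>
    then have "lie_bracket K X - mscale (of_int p) X \<in> lift_weight W (2 * p - 2)" unfolding op(3) .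
    moreover have "lie_bracket k X \<in> lift (\<lambda>m. W (- m)) (- (- 2) + - (2 * p))" by (rule lift_bracket[OF W Y'(2) XW])
    then have "lie_bracket k X \<in> lift_weight W (2 * p - 2)" by simp
    ultimately have "(lie_bracket K X - mscale (of_int p) X) - lie_bracket k X \<in> lift_weight W (2 * p - 2)"
      by (rule cmat.subspace_diff[OF LW(1)])
    then have "lie_bracket Y' X - mscale (of_int p) X \<in> lift_weight W (2 * p - 2)"
      by (simp add: YE lie_bracket_linear algebra_simps)
    moreover have "lie_bracket Y' X \<in> lift F (0 + p)" by (rule lift_bracket[OF F Y'(1) XF])
    then have "lie_bracket Y' X - mscale (of_int p) X \<in> lift F p"
      using XF by (intro cmat.subspace_diff[OF LF(1)] cmat.subspace_scale[OF LF(1)]) simp_all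
    ultimately have "lie_bracket Y' X - mscale (of_int p) X = 0" using op(1) by blast
    then show "lie_bracket Y' X = mscale (of_int p) X" by simp
  qed
  obtain d where d: "\<And>p. p \<ge> d \<Longrightarrow> lift F p = {0}" using LF(6) by blast
  obtain a where a: "\<And>p. p \<le> a \<Longrightarrow> lift F p = \<gg>" using LF(5) by blast
  have comm: "lie_bracket (Y - Y') X = 0" if "X \<in> lift F p" for X p
    using that
  proof (induction p arbitrary: X rule: int_down_induct[where b = d])
    case (base p)
    then show ?case using d[of p] by (auto simp: lie_bracket_def)
  next
    case (step p)
    have "X \<in> \<gg>" using step.prems liftD(1) by blast
    then obtain x y where xy: "x \<in> lift F (p + 1)" "y \<in> lift_weight W (2 * (p + 1) - 2)" "X = x + y"
      using op(2) by blast
    have "2 * (p + 1) - 2 = 2 * p" by simp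
    then have yW: "y \<in> lift_weight W (2 * p)" using xy(2) by metis
    have "y = X - x" using xy(3) by simp
    then have "y \<in> lift F p"
      using step.prems xy(1) LF(2)[of p "p + 1"] cmat.subspace_diff[OF LF(1)] by auto
    then have "lie_bracket (Y - Y') y = 0" using act yW by (simp add: lie_bracket_linear)
    then show ?case using step.IH[OF xy(1)] xy(3) by (simp add: lie_bracket_linear(1))
  qed
  have "Y - Y' = 0"
  proof (rule centre)
    show "Y - Y' \<in> \<gg>" using YF Y'(1) liftD(1) cmat.subspace_diff[OF subspace] by blast
    show "lie_bracket (Y - Y') X = 0" if "X \<in> \<gg>" for X
      using that a[of a] by (intro comm[of X a]) simp
  qed
  \<comment> \<open>Now Y is at once E - e and K - k: on the graded pieces of F it acts like E, on
    those of W like K, with the same offset.\<close>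
  then have YY': "Y = K - k" using YE(2) by simp
  show ?thesis
  proof (rule common_grading_opposite[OF F W])
    fix p u assume u: "u \<in> F p"
    have "E *v u - (1 * of_int p + c) *s u \<in> F (p + 1)" by (rule gradesD(4)[OF E u])
    moreover have "e *v u \<in> F (p + 1)" using liftD(2)[OF Y(1) u] by (simp add: add.commute)
    ultimately have "(E *v u - (1 * of_int p + c) *s u) - e *v u \<in> F (p + 1)"
      by (rule vec.subspace_diff[OF FD(1)])
    then show "Y *v u - (of_int p + c) *s u \<in> F (p + 1)"
      by (simp add: YE matrix_vector_mult_diff_rdistrib algebra_simps)
  next
    fix j u assume u: "u \<in> W j"
    then have "u \<in> W (- (- j))" by simp
    from gradesD(4)[OF K this] have "K *v u - (of_int j / 2 + c) *s u \<in> W (j - 1)" by simp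
    moreover have "k *v u \<in> W (j - 1)"
      using lift_weightD[OF Y'(2) u] Wmono[of "- 2 + j" "j - 1"] by auto
    ultimately have "(K *v u - (of_int j / 2 + c) *s u) - k *v u \<in> W (j - 1)"
      by (rule vec.subspace_diff[OF Wsub])
    then show "Y *v u - (of_int j / 2 + c) *s u \<in> W (j - 1)"
      by (simp add: YY' matrix_vector_mult_diff_rdistrib algebra_simps)
  qed
qed

end

subsection \<open>Semisimplicity and the trace form\<close>

text \<open>The centre is an abelian, hence solvable, ideal.\<close>

lemma semisimple_centre_trivial:
  assumes ss: "semisimple_lie_algebra \<gg>" and sub: "cmat.subspace \<gg>"
    and Z: "Z \<in> \<gg>" "\<And>X. X \<in> \<gg> \<Longrightarrow> lie_bracket Z X = 0"
  shows "Z = 0"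
proof -
  define \<zz> where "\<zz> = {Z \<in> \<gg>. \<forall>X\<in>\<gg>. lie_bracket Z X = 0}"
  have anti: "lie_bracket X Y = - lie_bracket Y X" for X Y :: "complex ^ 'a ^ 'a"
    by (simp add: lie_bracket_def)
  have "cmat.subspace \<zz>"
    using cmat.subspace_0[OF sub] cmat.subspace_add[OF sub] cmat.subspace_scale[OF sub]
    by (intro cmat.subspaceI) (auto simp: \<zz>_def lie_bracket_linear, simp add: lie_bracket_def)
  moreover have zero: "lie_bracket X Y = 0" if "X \<in> \<gg>" "Y \<in> \<zz>" for X Y
    using that anti[of X Y] by (simp add: \<zz>_def)
  ultimately have "lie_ideal \<gg> \<zz>"
    using cmat.subspace_0 unfolding lie_ideal_def by (auto simp: \<zz>_def)
  moreover have "derived_algebra \<zz> = {0}"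
  proof -
    have "{lie_bracket X Y |X Y. X \<in> \<zz> \<and> Y \<in> \<zz>} \<subseteq> {0}" by (auto simp: \<zz>_def)
    then have "derived_algebra \<zz> \<subseteq> cmat.span {0}" unfolding derived_algebra_def by (rule cmat.span_mono)
    then show ?thesis using cmat.span_zero by (auto simp: derived_algebra_def)
  qed
  then have "solvable_lie_algebra \<zz>"
    unfolding solvable_lie_algebra_def by (intro exI[of _ 1]) simp
  ultimately have "\<zz> = {0}" using ss unfolding semisimple_lie_algebra_def by blast
  moreover have "Z \<in> \<zz>" using Z by (simp add: \<zz>_def)
  ultimately show ?thesis by simp
qed

lemma bilin_linear:
  "bilin Q (u + v) w = bilin Q u w + bilin Q v w" "bilin Q (c *s u) w = c * bilin Q u w"
  "bilin Q w (u + v) = bilin Q w u + bilin Q w v" "bilin Q w (c *s u) = c * bilin Q w u"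
  by (simp_all add: bilin_def matrix_vector_right_distrib sum.distrib sum_distrib_left algebra_simps)

text \<open>For h(u, v) = Q(Cu, conj v) the adjoint of X is minus the complex conjugate of C X
  C^{-1}: passing C conjugates X by C, skewness for Q gives the sign, and the conjugate-linear slot
  the complex conjugation. It stays in the Lie algebra because C lies in the group and the group is
  stable under complex conjugation.\<close>

lemma mumford_tate_trace_lie_algebra:
  fixes F :: "(complex ^ 'v) filtration"
  assumes pol: "polarized_hodge_structure n Q F"
    and iso: "lie_algebra (mumford_tate_group n F) \<subseteq> end_Q Q"
  shows "trace_lie_algebra (lie_algebra (mumford_tate_group n F))"
proof
  let ?G = "mumford_tate_group n F" and ?\<gg> = "lie_algebra (mumford_tate_group n F)"
  show "cmat.subspace ?\<gg>" by (rule subspace_lie_algebra)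
  show "lie_bracket X Y \<in> ?\<gg>" if "X \<in> ?\<gg>" "Y \<in> ?\<gg>" for X Y
    using that mumford_tate_group_mult by (intro lie_algebra_bracket)
  define C where "C = weil_operator n F"
  have hs: "hodge_structure n F"
    and pos: "u \<noteq> 0 \<Longrightarrow> bilin Q (C *v u) (vconj u) \<in> \<real> \<and> Re (bilin Q (C *v u) (vconj u)) > 0" for u
    using pol unfolding polarized_hodge_structure_def C_def by blast+
  have CG: "C \<in> ?G" unfolding C_def weil_operator_def by (rule hodge_circle_in_mumford_tate_group) simp
  then have inv: "C ** matrix_inv C = mat 1" "matrix_inv C ** C = mat 1"
    using matrix_inv_mult mumford_tate_group_invertible[OF hs] by blast+
  interpret positive_form "\<lambda>u v. bilin Q (C *v u) (vconj v)"
    by unfold_locales (use pos in \<open>simp_all add: matrix_vector_right_distrib bilin_linear cvec.cj_add cvec.cj_scale\<close>)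
  fix X assume X: "X \<in> ?\<gg>" and perp: "\<And>Y. Y \<in> ?\<gg> \<Longrightarrow> trace (X ** Y) = 0"
  define X1 where "X1 = C ** X ** matrix_inv C"
  have X1: "X1 \<in> ?\<gg>"
    unfolding X1_def
    by (rule lie_algebra_conjugate[OF _ inv(1) X])
       (intro mumford_tate_group_mult CG mumford_tate_group_inv[OF CG])
  define X' where "X' = mscale (- 1) (mconj X1)"
  have "X' \<in> ?\<gg>"
    unfolding X'_def
    by (intro cmat.subspace_scale[OF subspace_lie_algebra] lie_algebra_mconj[OF mumford_tate_group_mconj X1])
  have "X1 ** C = C ** X" unfolding X1_def by (metis inv(2) matrix_mul_assoc matrix_mul_rid)
  have adj: "bilin Q (C *v (X *v u)) (vconj w) = bilin Q (C *v u) (vconj (X' *v w))" for u w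
  proof -
    have "bilin Q (X1 *v (C *v u)) (vconj w) + bilin Q (C *v u) (X1 *v vconj w) = 0"
      using X1 iso unfolding end_Q_def by blast
    moreover have "X1 *v (C *v u) = C *v (X *v u)"
      using \<open>X1 ** C = C ** X\<close> by (simp add: matrix_vector_mul_assoc)
    moreover have "mconj X' = mscale (- 1) X1"
      by (simp only: X'_def cmat.cj_scale cmat.cj_cj complex_cnj_minus complex_cnj_one)
    then have "vconj (X' *v w) = (- 1) *s (X1 *v vconj w)"
      by (simp only: vconj_matrix_vec mscale_vec)
    ultimately show ?thesis by (simp only: bilin_linear) (simp add: add_eq_0_iff)
  qed
  have "X' = 0" by (rule adjoint_trace_zero[OF adj perp[OF \<open>X' \<in> ?\<gg>\<close>]])
  then have "mscale (- 1) (mconj X') = 0" by (simp add: cmat.cj_0)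
  then have "X1 = 0" unfolding X'_def cmat.cj_scale cmat.cj_cj by simp
  then have "C ** X = 0" using \<open>X1 ** C = C ** X\<close> by simp
  then have "matrix_inv C ** C ** X = 0" by (simp flip: matrix_mul_assoc)
  then show "X = 0" by (simp add: inv)
qed

subsection \<open>Real structures\<close>

definition re_part :: "complex ^ 'v \<Rightarrow> complex ^ 'v" where
  "re_part u = (\<chi> i. of_real (Re (u $ i)))"

definition im_part :: "complex ^ 'v \<Rightarrow> complex ^ 'v" where
  "im_part u = (\<chi> i. of_real (Im (u $ i)))"

lemma re_im_part: "re_part u + \<i> *s im_part u = u"
  by (simp add: vec_eq_iff re_part_def im_part_def complex_eq_iff)

lemma real_points_iff: "u \<in> real_points \<longleftrightarrow> (\<forall>i. Im (u $ i) = 0)"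
  by (auto simp: real_points_def vconj_def vec_eq_iff complex_eq_iff)

text \<open>Describes the complexification by real and imaginary parts, so that statements about
  real subspaces and real operators transfer componentwise.\<close>

lemma span_real_subspace_iff:
  assumes W: "subspace W" "W \<subseteq> real_points"
  shows "u \<in> vec.span W \<longleftrightarrow> re_part u \<in> W \<and> im_part u \<in> W"
proof
  assume "u \<in> vec.span W"
  then show "re_part u \<in> W \<and> im_part u \<in> W"
  proof (induction rule: vec.span_induct_alt)
    case base
    have "re_part 0 = (0 :: complex ^ 'a)" "im_part 0 = (0 :: complex ^ 'a)"
      by (simp_all add: re_part_def im_part_def vec_eq_iff)
    then show ?case using subspace_0[OF W(1)] by simp
  next
    case (step c x y)
    have "re_part (c *s x + y) = Re c *\<^sub>R x + re_part y" "im_part (c *s x + y) = Im c *\<^sub>R x + im_part y"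
      using step.hyps W(2) real_points_iff[of x]
      by (auto simp: re_part_def im_part_def vec_eq_iff complex_eq_iff)
    then show ?case
      using step by (simp add: subspace_add[OF W(1)] subspace_scale[OF W(1)])
  qed
next
  assume "re_part u \<in> W \<and> im_part u \<in> W"
  then have "re_part u + \<i> *s im_part u \<in> vec.span W"
    by (intro vec.span_add vec.span_scale vec.span_base) auto
  then show "u \<in> vec.span W" by (simp add: re_im_part)
qed

lemma real_matrices_iff: "A \<in> real_matrices \<longleftrightarrow> (\<forall>i j. Im (A $ i $ j) = 0)"
  by (auto simp: real_matrices_def vec_eq_iff complex_eq_iff)

lemma real_matrix_parts:
  assumes "A \<in> real_matrices"
  shows "re_part (A *v u) = A *v re_part u" "im_part (A *v u) = A *v im_part u"
  using assms
  by (simp_all add: real_matrices_iff re_part_def im_part_def vec_eq_iff matrix_vector_mult_def complex_eq_iff)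

lemma real_matrices_mpow: "N \<in> real_matrices \<Longrightarrow> mpow N k \<in> real_matrices"
  by (induction k) (auto simp: mpow_Suc real_matrices_def mconj_mult)

lemma monodromy_weight_filtration_span:
  assumes W: "monodromy_weight_filtration n N W" and N: "N \<in> real_matrices"
  shows "i \<le> j \<Longrightarrow> vec.span (W i) \<subseteq> vec.span (W j)"
    and "\<exists>k. vec.span (W k) = {0}" and "\<exists>k. vec.span (W k) = UNIV"
    and "u \<in> vec.span (W l) \<Longrightarrow> N *v u \<in> vec.span (W (l - 2))"
    and "w \<in> vec.span (W (int n - int k)) \<Longrightarrow>
      \<exists>u \<in> vec.span (W (int n + int k)). w - mpow N k *v u \<in> vec.span (W (int n - int k - 1))"
    and "u \<in> vec.span (W (int n + int k)) \<Longrightarrow> mpow N k *v u \<in> vec.span (W (int n - int k - 1)) \<Longrightarrow>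
      u \<in> vec.span (W (int n + int k - 1))"
proof -
  have sub: "subspace (W k)" "W k \<subseteq> real_points" and mono: "i \<le> j \<Longrightarrow> W i \<subseteq> W j"
    and NW: "u \<in> W k \<Longrightarrow> N *v u \<in> W (k - 2)" for i j k u
    using W unfolding monodromy_weight_filtration_def monotone_def by blast+
  have surj: "w \<in> W (int n - int k) \<Longrightarrow> \<exists>u\<in>W (int n + int k). w - mpow N k *v u \<in> W (int n - int k - 1)"
    and inj: "u \<in> W (int n + int k) \<Longrightarrow> mpow N k *v u \<in> W (int n - int k - 1) \<Longrightarrow> u \<in> W (int n + int k - 1)" for k u w
    using W unfolding monodromy_weight_filtration_def by blast+
  obtain a b where ab: "W a = {0}" "W b = real_points"
    using W unfolding monodromy_weight_filtration_def by blast
  note iff = span_real_subspace_iff[OF sub]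
  show "i \<le> j \<Longrightarrow> vec.span (W i) \<subseteq> vec.span (W j)" using mono vec.span_mono by blast
  show "\<exists>k. vec.span (W k) = {0}" using ab(1) by (metis vec.span_insert_0 vec.span_empty)
  have "u \<in> vec.span (W b)" for u
    unfolding iff by (simp add: ab(2) real_points_iff re_part_def im_part_def)
  then show "\<exists>k. vec.span (W k) = UNIV" by blast
  show "u \<in> vec.span (W l) \<Longrightarrow> N *v u \<in> vec.span (W (l - 2))"
    unfolding iff real_matrix_parts[OF N] using NW by blast
  show "\<exists>u \<in> vec.span (W (int n + int k)). w - mpow N k *v u \<in> vec.span (W (int n - int k - 1))"
    if w: "w \<in> vec.span (W (int n - int k))"
  proof -
    obtain x where x: "x \<in> W (int n + int k)" "re_part w - mpow N k *v x \<in> W (int n - int k - 1)"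
      using surj w unfolding iff by blast
    obtain y where y: "y \<in> W (int n + int k)" "im_part w - mpow N k *v y \<in> W (int n - int k - 1)"
      using surj w unfolding iff by blast
    have "x + \<i> *s y \<in> vec.span (W (int n + int k))"
      using x y by (intro vec.span_add vec.span_scale vec.span_base)
    moreover have "(re_part w - mpow N k *v x) + \<i> *s (im_part w - mpow N k *v y) \<in> vec.span (W (int n - int k - 1))"
      using x y by (intro vec.span_add vec.span_scale vec.span_base)
    moreover have "(re_part w - mpow N k *v x) + \<i> *s (im_part w - mpow N k *v y) =
        (re_part w + \<i> *s im_part w) - mpow N k *v (x + \<i> *s y)"
      by (simp add: matrix_vector_right_distrib vec.scale_right_diff_distrib)
    ultimately show ?thesis unfolding re_im_part by metis
  qed
  show "u \<in> vec.span (W (int n + int k)) \<Longrightarrow> mpow N k *v u \<in> vec.span (W (int n - int k - 1)) \<Longrightarrow>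
      u \<in> vec.span (W (int n + int k - 1))"
    unfolding iff real_matrix_parts[OF real_matrices_mpow[OF N]] using inj by blast
qed

text \<open>The real and imaginary parts of \<open>X\<close> stay in the Lie algebra by its
  stability under conjugation, and on real vectors they yield the real and imaginary parts of
  \<open>X *v u\<close>; so both preserve the real filtration up to the shift.\<close>

lemma adjoint_W_span:
  assumes W: "\<And>k. subspace (W k)" "\<And>k. W k \<subseteq> real_points"
    and conj: "\<And>A. A \<in> G \<Longrightarrow> mconj A \<in> G"
  shows "cmat.span (adjoint_W G W l) =
    {X \<in> lie_algebra G. \<forall>m. \<forall>u \<in> vec.span (W m). X *v u \<in> vec.span (W (m + l))}" (is "_ = ?R")
proof (rule equalityI)
  note iff = span_real_subspace_iff[OF W]
  note g = subspace_lie_algebra[of G]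
  have sub: "cmat.subspace ?R"
    using cmat.subspace_0[OF g] cmat.subspace_add[OF g] cmat.subspace_scale[OF g]
    by (intro cmat.subspaceI)
       (simp_all add: vec.span_zero matrix_vector_mult_add_rdistrib vec.span_add mscale_vec vec.span_scale)
  have "adjoint_W G W l \<subseteq> ?R"
    by (auto simp: adjoint_W_def real_lie_algebra_def iff real_matrix_parts)
  then show "cmat.span (adjoint_W G W l) \<subseteq> ?R" using sub by (rule cmat.span_minimal)
  show "?R \<subseteq> cmat.span (adjoint_W G W l)"
  proof
    fix X assume X: "X \<in> ?R"
    define A where "A = mscale (1 / 2) (X + mconj X)"
    define B where "B = mscale (- \<i> / 2) (X - mconj X)"
    have parts: "A *v u = re_part (X *v u) \<and> B *v u = im_part (X *v u)" if "u \<in> real_points" for u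
    proof -
      have "vconj u = u" using that by (simp add: real_points_def)
      then have "mconj X *v u = vconj (X *v u)" by (simp add: vconj_matrix_vec)
      then show ?thesis
        unfolding A_def B_def mscale_vec matrix_vector_mult_add_rdistrib matrix_vector_mult_diff_rdistrib
        by (simp add: vec_eq_iff re_part_def im_part_def vconj_def complex_eq_iff)
    qed
    have "mconj X \<in> lie_algebra G" using X lie_algebra_mconj[OF conj] by blast
    moreover have "X \<in> lie_algebra G" using X by blast
    ultimately have "A \<in> lie_algebra G" "B \<in> lie_algebra G"
      unfolding A_def B_def
      by (rule cmat.subspace_scale[OF g cmat.subspace_add[OF g, rotated]],
          rule cmat.subspace_scale[OF g cmat.subspace_diff[OF g, rotated]])
    moreover have "A \<in> real_matrices" "B \<in> real_matrices"
      by (simp_all add: real_matrices_iff A_def B_def)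
    moreover have "A *v u \<in> W (m + l) \<and> B *v u \<in> W (m + l)" if u: "u \<in> W m" for u m
    proof -
      have "X *v u \<in> vec.span (W (m + l))" using X u vec.span_base by blast
      moreover have "u \<in> real_points" using u W(2) by blast
      ultimately show ?thesis using parts iff by simp
    qed
    ultimately have "A \<in> adjoint_W G W l" "B \<in> adjoint_W G W l"
      by (auto simp: adjoint_W_def real_lie_algebra_def)
    then have "A + mscale \<i> B \<in> cmat.span (adjoint_W G W l)"
      by (intro cmat.span_add cmat.span_scale cmat.span_base)
    moreover have "A + mscale \<i> B = X"
      by (simp add: A_def B_def vec_eq_iff complex_eq_iff)
    ultimately show "X \<in> cmat.span (adjoint_W G W l)" by simp
  qed
qed

subsection \<open>Hodge--Tate degenerations\<close>

lemma hodge_tate_iff_opposite_vec: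
  assumes "cvec.finite_filtration UNIV F" "cvec.finite_filtration UNIV (\<lambda>m. vec.span (W (- m)))"
    and "\<And>k. W k \<subseteq> real_points"
  shows "hodge_tate (*s) vconj UNIV W F \<longleftrightarrow> opposite_filtrations UNIV F (\<lambda>k. vec.span (W k))"
  using cvec.hodge_tate_imp_opposite[OF _ vec.subspace_UNIV] cvec.opposite_imp_hodge_tate[OF assms(1,2)] assms(3)
  unfolding real_points_def by blast

theorem proposition1p9:
  fixes n :: nat
    and Q :: "complex ^ 'v ^ 'v"
    and G :: "(complex ^ 'v ^ 'v) set"
    and D :: "(complex ^ 'v) filtration set"
    and F W :: "(complex ^ 'v) filtration"
    and N :: "complex ^ 'v ^ 'v"
  assumes "mumford_tate_domain n Q G D"
    and "semisimple_lie_algebra (lie_algebra G)"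
    and "lie_algebra G \<subseteq> end_Q Q"
    and "nilpotent_orbit G D F N"
    and "monodromy_weight_filtration n N W"
  shows "hodge_tate (\<lambda>c u. c *s u) vconj UNIV W F \<longleftrightarrow>
         hodge_tate mscale mconj (lie_algebra G) (adjoint_W G W) (adjoint_F G F)"
proof -
  obtain F0 where pol: "polarized_hodge_structure n Q F0" and G: "G = mumford_tate_group n F0"
    and D: "D = {act A F0 |A. A \<in> real_form G}"
    using assms(1) unfolding mumford_tate_domain_def by blast
  have hs: "hodge_structure n F0" using pol unfolding polarized_hodge_structure_def by blast
  let ?\<gg> = "lie_algebra G"
  interpret trace_lie_algebra ?\<gg>
    using mumford_tate_trace_lie_algebra[OF pol] assms(3) unfolding G by blast
  \<comment> \<open>A point of the compact dual is a translate under \<open>G\<close> of a point of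
    \<open>D\<close>, itself a real translate of \<open>F0\<close>. So \<open>F\<close> is the image
    of \<open>F0\<close> under one element \<open>B\<close> of \<open>G\<close>, and conjugation by
    \<open>B\<close> carries the grading element along.\<close>
  obtain A A' where A: "A \<in> G" "A' \<in> real_form G" "F = act A (act A' F0)"
    using assms(4) unfolding nilpotent_orbit_def compact_dual_def D by blast
  have "A' \<in> G" using A(2) connected_component_subset unfolding real_form_def by blast
  define B where "B = A ** A'"
  have BG: "B \<in> G" using A(1) \<open>A' \<in> G\<close> mumford_tate_group_mult unfolding B_def G by blast
  have inv: "B ** matrix_inv B = mat 1" "matrix_inv B ** B = mat 1"
    using BG matrix_inv_mult mumford_tate_group_invertible[OF hs] unfolding G by blast+
  have FB: "F p = (*v) B ` F0 p" for p
    by (simp add: A(3) act_def B_def image_image matrix_vector_mul_assoc)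
  obtain E0 where E0: "E0 \<in> ?\<gg>" "\<And>p u. u \<in> F0 p \<Longrightarrow> E0 *v u - (of_int p - of_nat n / 2) *s u \<in> F0 (p + 1)"
    using hodge_grading_element[OF hs] unfolding G by blast
  define E where "E = B ** E0 ** matrix_inv B"
  have "E \<in> ?\<gg>"
    unfolding E_def
    by (rule lie_algebra_conjugate[OF _ inv(1) E0(1)])
       (use BG mumford_tate_group_mult mumford_tate_group_inv in \<open>unfold G, blast\<close>)
  have fF: "cvec.finite_filtration UNIV F"
  proof -
    have hF: "vec.subspace (F0 p)" "p \<le> q \<Longrightarrow> F0 q \<subseteq> F0 p" "F0 0 = UNIV"
      "F0 p \<inter> vconj ` F0 (int n - p + 1) = {0}" for p q
      using hs unfolding hodge_structure_def monotone_def by blast+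
    have "range vconj = UNIV" using cvec.cj_cj by (metis surjI)
    \<comment> \<open>At p = n + 1 the opposite filtration step is the conjugate of F^0, the whole
      space, which forces F^{n+1} = 0.\<close>
    moreover have "F0 (int n + 1) \<inter> vconj ` F0 0 = {0}" using hF(4)[of "int n + 1"] by simp
    ultimately have "F0 (int n + 1) = {0}" unfolding hF(3) by (metis Int_UNIV_right)
    then have "F (int n + 1) = {0}" by (simp add: FB)
    moreover have "F 0 = UNIV"
    proof -
      have "u = B *v (matrix_inv B *v u)" for u by (simp add: matrix_vector_mul_assoc inv)
      then show ?thesis unfolding FB hF(3) by blast
    qed
    moreover have "vec.subspace (F p)" for p
      unfolding FB by (rule vec.subspace_image[OF hF(1)])
    moreover have "F q \<subseteq> F p" if "p \<le> q" for p q
      unfolding FB using hF(2)[OF that] by blast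
    ultimately show ?thesis unfolding cvec.finite_filtration_def monotone_def by blast
  qed
  have E: "grades E 1 (- of_nat n / 2) F"
    unfolding grades_def
  proof (intro conjI allI ballI)
    fix p u assume "u \<in> F p"
    then obtain v where v: "v \<in> F0 p" "u = B *v v" by (auto simp: FB)
    have "E *v u = B *v (E0 *v v)"
      by (simp add: E_def v(2) matrix_vector_mul_assoc flip: matrix_mul_assoc) (simp add: inv)
    then have "E *v u - (1 * of_int p + - of_nat n / 2) *s u = B *v (E0 *v v - (of_int p - of_nat n / 2) *s v)"
      by (simp add: v(2) matrix_vector_mult_diff_distrib)
    then show "E *v u - (1 * of_int p + - of_nat n / 2) *s u \<in> F (p + 1)"
      using E0(2)[OF v(1)] by (simp add: FB)
  qed (use fF \<open>E \<in> ?\<gg>\<close> in auto)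
  have N: "N \<in> ?\<gg>" "N \<in> real_matrices" and "\<exists>k. mpow N k = 0"
    using assms(4) unfolding nilpotent_orbit_def real_lie_algebra_def by blast+
  then obtain U where U: "U \<in> ?\<gg>" "lie_bracket N (lie_bracket N U) = N"
    using double_commutator_image by blast
  define K where "K = lie_bracket N U"
  define W' where "W' k = vec.span (W k)" for k
  note ws = monodromy_weight_filtration_span[OF assms(5) N(2), folded W'_def]
  have Wr: "subspace (W k)" "W k \<subseteq> real_points" for k
    using assms(5) unfolding monodromy_weight_filtration_def by blast+
  have W'sub: "vec.subspace (W' k)" for k unfolding W'_def by (rule vec.subspace_span)
  have fW: "cvec.finite_filtration UNIV (\<lambda>m. W' (- m))"
  proof -
    obtain a b where "W' a = {0}" "W' b = UNIV" using ws(2,3) by blast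
    then have "W' (- (- a)) = {0}" "W' (- (- b)) = UNIV" by simp_all
    then show ?thesis
      using W'sub ws(1) unfolding cvec.finite_filtration_def monotone_def by (metis neg_le_iff_le top_greatest)
  qed
  \<comment> \<open>In the reversed index m = -k the scalar (k - n)/2 reads -m/2 - n/2: slope -1/2,
    and the same offset as for \<open>E\<close>.\<close>
  have K: "grades K (- 1 / 2) (- of_nat n / 2) (\<lambda>m. W' (- m))"
    unfolding grades_def
  proof (intro conjI allI ballI)
    show "K \<in> ?\<gg>" unfolding K_def using N(1) U(1) by (rule bracket)
    fix m u assume "u \<in> W' (- m)"
    then have "2 *s (K *v u) - (of_int (- m) - of_nat n) *s u \<in> W' (- m - 1)"
      using ws W'sub K_def U(2) by (intro weight_scalar[where W = W' and n = n and N = N and U = U and K = K]) auto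
    then have "(1 / 2) *s (2 *s (K *v u) - (of_int (- m) - of_nat n) *s u) \<in> W' (- m - 1)"
      by (rule vec.subspace_scale[OF W'sub])
    moreover have "(1 / 2) *s (2 *s (K *v u) - (of_int (- m) - of_nat n) *s u) =
        K *v u - (- 1 / 2 * of_int m + - of_nat n / 2) *s u"
      by (simp add: vec_eq_iff field_simps)
    ultimately show "K *v u - (- 1 / 2 * of_int m + - of_nat n / 2) *s u \<in> W' (- (m + 1))" by simp
  qed (use fW in auto)
  have adjF: "adjoint_F G F = lift F"
    by (auto simp: adjoint_F_def lift_def)
  have adjW: "cmat.span (adjoint_W G W l) = lift_weight W' l" for l
  proof -
    have "cmat.span (adjoint_W G W l) = {X \<in> ?\<gg>. \<forall>m. \<forall>u \<in> W' m. X *v u \<in> W' (m + l)}"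
      unfolding W'_def using mumford_tate_group_mconj by (intro adjoint_W_span Wr) (simp add: G)
    also have "\<dots> = lift_weight W' l"
    proof (intro equalityI subsetI)
      fix X assume "X \<in> {X \<in> ?\<gg>. \<forall>m. \<forall>u \<in> W' m. X *v u \<in> W' (m + l)}"
      then show "X \<in> lift_weight W' l" by (intro lift_weightI) (auto simp: add.commute)
    next
      fix X assume X: "X \<in> lift_weight W' l"
      then show "X \<in> {X \<in> ?\<gg>. \<forall>m. \<forall>u \<in> W' m. X *v u \<in> W' (m + l)}"
        using lift_weightD[OF X] liftD(1)[OF X] by (auto simp: add.commute)
    qed
    finally show ?thesis .
  qed
  have "hodge_tate (*s) vconj UNIV W F \<longleftrightarrow> opposite_filtrations UNIV F W'"
    using hodge_tate_iff_opposite_vec[OF fF _ Wr(2)] fW unfolding W'_def .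
  also have "\<dots> \<longleftrightarrow> opposite_filtrations ?\<gg> (lift F) (lift_weight W')"
    using opposite_lift[OF E K] opposite_lift_converse[OF E K] semisimple_centre_trivial[OF assms(2) subspace] by blast
  also have "\<dots> \<longleftrightarrow> hodge_tate mscale mconj ?\<gg> (adjoint_W G W) (adjoint_F G F)"
  proof
    have cj: "mconj X = X" if "X \<in> adjoint_W G W l" for X l
      using that by (simp add: adjoint_W_def real_lie_algebra_def real_matrices_def)
    have fgW: "cmat.finite_filtration ?\<gg> (\<lambda>m. cmat.span (adjoint_W G W (- m)))"
      unfolding adjW using lift_filtration[OF fW] by simp
    show "hodge_tate mscale mconj ?\<gg> (adjoint_W G W) (adjoint_F G F)"
      if "opposite_filtrations ?\<gg> (lift F) (lift_weight W')"
      using that fgW lift_filtration[OF fF] cj unfolding adjF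
      by (intro cmat.opposite_imp_hodge_tate) (simp_all add: adjW)
    show "opposite_filtrations ?\<gg> (lift F) (lift_weight W')"
      if "hodge_tate mscale mconj ?\<gg> (adjoint_W G W) (adjoint_F G F)"
      using cmat.hodge_tate_imp_opposite[OF that subspace] unfolding adjF adjW .
  qed
  finally show ?thesis .
qed

end
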